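(* Let $x_1\in\mathbb C$, let $v_\lambda$ be the highest weight vector of the generalized Verma module $M_\lambda(so(7),\mathfrak p_{(1,0,0)})$, and let $\bar{\mathfrak b}$ be the Borel subalgebra of $\mathrm{Lie}\,G_2$. **1.** Suppose $\lambda=x_1\omega_1+\omega_2$. Then $$\begin{aligned}v_{\lambda,0}&:=v_\lambda\\ v_{\lambda,1}&:=\left((-x_1-2)g_{-3}g_{-2}-4g_{-4}+2g_{-2}g_{-1}\right)\cdot v_\lambda\\ v_{\lambda,2}&:=\left((x_1^2+2x_1)g_{-3}^2g_{-2}+(x_1-1)g_{-6}+(-2x_1-1)g_{-1}g_{-3}g_{-2}-2g_{-4}g_{-1}+2g_{-1}^2g_{-2}\right)\cdot v_\lambda\end{aligned}$$ are linearly independent $\bar{\mathfrak b}$-singular vectors. Moreover, for $x_1\notin\{-1,-7/2,-6\}$, the $\mathrm{Lie}\,G_2$-submodules generated by the $v_{\lambda,i}$ have pairwise zero intersections. **2.** Suppose $\lambda=x_1\omega_1+\omega_3$. Then $$\begin{aligned}v_{\lambda,0}&:=v_\lambda\\ v_{\lambda,1}&:=\left(-x_1g_{-3}+g_{-1}\right)\cdot v_\lambda\\ v_{\lambda,2}&:=\left((2x_1+5)g_{-3}g_{-2}g_{-3}-g_{-6}+2g_{-4}g_{-3}-2g_{-1}g_{-2}g_{-3}\right)\cdot v_\lambda\end{aligned}$$ are linearly independent $\bar{\mathfrak b}$-singular vectors. Moreover, for $x_1\notin\{-5,-3,-1\}$, the $\mathrm{Lie}\,G_2$-submodules generated by the $v_{\lambda,i}$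 have pairwise zero intersections. **3.** Suppose $\lambda=x_1\omega_1+2\omega_2$. Then $$\begin{aligned} v_{\lambda,0}:={}&v_\lambda\\ v_{\lambda,1}:={}&\big(-4g_{-4}+(-x_1-3)g_{-3}g_{-2}+2g_{-1}g_{-2}\big)\cdot v_\lambda\\ v_{\lambda,2}:={}&\big((4x_1-4)g_{-6}-8g_{-4}g_{-1}+(2x_1^2+6x_1)g_{-3}^2g_{-2}\\&+(-4x_1-4)g_{-1}g_{-3}g_{-2}+4g_{-1}^2g_{-2}\big)\cdot v_\lambda\\ v_{\lambda,3}:={}&\big((-10x_1-20)g_{-4}g_{-3}g_{-2}+20g_{-4}g_{-1}g_{-2}-20g_{-4}^2\\&+(-x_1^2-5x_1-6)g_{-3}^2g_{-2}^2+(x_1^2+5x_1+6)g_{-2}g_{-3}^2g_{-2}\\&+(5x_1+10)g_{-1}g_{-3}g_{-2}^2-10g_{-1}^2g_{-2}^2\big)\cdot v_\lambda\\ v_{\lambda,4}:={}&\big((12x_1^2+48x_1+48)g_{-9}+(6x_1^2+24x_1+24)g_{-8}g_{-2}+(12x_1^2+60x_1-168)g_{-6}g_{-4}\\&+(3x_1^3+24x_1^2-72)g_{-6}g_{-3}g_{-2}+(-6x_1^2-30x_1+84)g_{-6}g_{-1}g_{-2}\\&+(6x_1^3+51x_1^2+72x_1-12)g_{-4}g_{-3}^2g_{-2}+(-18x_1^2-138x_1-84)g_{-4}g_{-1}g_{-3}g_{-2}\\&+(24x_1+168)g_{-4}g_{-1}^2g_{-2}+(-24x_1-168)g_{-4}^2g_{-1}\\&+(\tfrac12x_1^4+6x_1^3+\tfrac{41}2x_1^2+21x_1)g_{-3}^3g_{-2}^2+(-3x_1^3-\tfrac{57}2x_1^2-54x_1-18)g_{-1}g_{-3}^2g_{-2}^2\\&+(3x_1^2+18x_1+24)g_{-1}g_{-2}g_{-3}^2g_{-2}+(-12x_1-84)g_{-1}^3g_{-2}^2\\&+(9x_1^2+69x_1+42)g_{-1}^2g_{-3}g_{-2}^2\big)\cdot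 v_\lambda\\ v_{\lambda,5}:={}&\big((8x_1^2+24x_1+16)g_{-9}g_{-1}+(-24x_1^2-72x_1+112)g_{-8}g_{-4}\\&+(-8x_1^3-36x_1^2-12x_1+56)g_{-8}g_{-3}g_{-2}+(16x_1^2+48x_1-48)g_{-8}g_{-1}g_{-2}\\&+(16x_1^2+8x_1-168)g_{-6}g_{-4}g_{-1}+(-4x_1^4-14x_1^3+12x_1^2+34x_1-28)g_{-6}g_{-3}^2g_{-2}\\&+(8x_1^3+12x_1^2-60x_1-24)g_{-6}g_{-1}g_{-3}g_{-2}+(-8x_1^2-4x_1+84)g_{-6}g_{-1}^2g_{-2}\\&+(-4x_1^3+28x_1-56)g_{-6}^2+(8x_1^3+28x_1^2-12x_1-32)g_{-4}g_{-1}g_{-3}^2g_{-2}\\&+(16x_1+56)g_{-4}g_{-1}^3g_{-2}+(-16x_1^2-48x_1+28)g_{-4}g_{-1}^2g_{-3}g_{-2}\\&+(-16x_1-56)g_{-4}^2g_{-1}^2+(-\tfrac13x_1^5-\tfrac52x_1^4-5x_1^3+\tfrac56x_1^2+7x_1)g_{-3}^4g_{-2}^2\\&+(\tfrac43x_1^4+\tfrac{20}3x_1^3+5x_1^2-\tfrac{25}3x_1-\tfrac{14}3)g_{-1}g_{-3}^3g_{-2}^2+(-8x_1-28)g_{-1}^4g_{-2}^2\\&+(8x_1^2+24x_1-14)g_{-1}^3g_{-3}g_{-2}^2+(-4x_1^3-14x_1^2+2x_1+8)g_{-1}^2g_{-3}^2g_{-2}^2\\&+(4x_1+8)g_{-1}^2g_{-2}g_{-3}^2g_{-2}\big)\cdot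 v_\lambda \end{aligned}$$ are linearly independent $\bar{\mathfrak b}$-singular vectors. Moreover, for $x_1\notin\{0,-1,-4,-3,-9/2,-2,-8,-6,-7,-5,-9\}$, the $\mathrm{Lie}\,G_2$-submodules generated by the $v_{\lambda,i}$ have pairwise zero intersections. **4.** Suppose $\lambda=x_1\omega_1+\omega_2+\omega_3$. Then $$\begin{aligned} v_{\lambda,0}:={}&v_\lambda\\ v_{\lambda,1}:={}&\big(-x_1g_{-3}+g_{-1}\big)\cdot v_\lambda\\ v_{\lambda,2}:={}&\big(5g_{-1}g_{-2}+(-2x_1-4)g_{-3}g_{-2}+(x_1+2)g_{-2}g_{-3}-5g_{-4}\big)\cdot v_\lambda\\ v_{\lambda,3}:={}&\big((\tfrac16x_1^3+\tfrac53x_1^2+\tfrac83x_1)g_{-3}^2g_{-2}+(-\tfrac12x_1^2-x_1)g_{-3}g_{-2}g_{-3}\\&+(\tfrac16x_1^2+\tfrac43x_1-3)g_{-6}+(\tfrac23x_1^2+\tfrac{10}3x_1-1)g_{-4}g_{-3}\\&+(-\tfrac23x_1^2-\tfrac{16}3x_1-3)g_{-1}g_{-3}g_{-2}+(-x_1-7)g_{-4}g_{-1}\\&+(x_1+7)g_{-1}^2g_{-2}+(x_1+2)g_{-1}g_{-2}g_{-3}\big)\cdot v_\lambda\\ v_{\lambda,4}:={}&\big((\tfrac16x_1^3+\tfrac53x_1^2+\tfrac{17}3x_1+6)g_{-3}g_{-2}g_{-3}+(-\tfrac18x_1^2-\tfrac54x_1-2)g_{-3}^2g_{-2}\\&+(-\tfrac1{12}x_1^2-\tfrac23x_1-\tfrac94)g_{-6}+(\tfrac12x_1^2+\tfrac{35}{12}x_1+\tfrac{31}{12})g_{-4}g_{-3}\\&+(-\tfrac16x_1^2-\tfrac{11}{12}x_1-\tfrac76)g_{-1}g_{-2}g_{-3}+(-\tfrac16x_1^2-\tfrac{13}{12}x_1-\tfrac14)g_{-1}g_{-3}g_{-2}\\&+(-\tfrac13x_1-\tfrac{23}{12})g_{-4}g_{-1}+(\tfrac13x_1+\tfrac{23}{12})g_{-1}^2g_{-2}\big)\cdot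 v_\lambda\\ v_{\lambda,5}:={}&\big((-x_1^4-\tfrac92x_1^3-\tfrac32x_1^2+7x_1)g_{-3}^3g_{-2}+(-3x_1^3-3x_1^2+18x_1-12)g_{-6}g_{-3}\\&+(3x_1^3+\tfrac{21}2x_1^2-\tfrac92x_1-9)g_{-1}g_{-3}^2g_{-2}+(-3x_1^2-15x_1+18)g_{-8}\\&+(3x_1^2+3x_1-30)g_{-6}g_{-1}+(6x_1^2+12x_1-24)g_{-4}g_{-1}g_{-3}\\&+(-6x_1^2-18x_1+12)g_{-1}^2g_{-3}g_{-2}+(-3x_1^2-3x_1+6)g_{-1}g_{-3}g_{-2}g_{-3}\\&+(-6x_1-21)g_{-4}g_{-1}^2+(6x_1+21)g_{-1}^3g_{-2}+(3x_1+6)g_{-1}^2g_{-2}g_{-3}\big)\cdot v_\lambda\\ v_{\lambda,6}:={}&\big((\tfrac12x_1^4+\tfrac{29}4x_1^3+\tfrac{153}4x_1^2+\tfrac{173}2x_1+70)g_{-3}^2g_{-2}^2g_{-3}\\&+(\tfrac12x_1^3+\tfrac{11}2x_1^2+19x_1+20)g_{-6}g_{-2}g_{-3}+(-x_1^3-11x_1^2-38x_1-40)g_{-6}g_{-3}g_{-2}\\&+(-\tfrac16x_1^4-\tfrac{29}{12}x_1^3-\tfrac{51}4x_1^2-\tfrac{173}6x_1-\tfrac{70}3)g_{-2}g_{-3}^3g_{-2}\\&+(4x_1^3+\tfrac{93}2x_1^2+\tfrac{349}2x_1+210)g_{-4}g_{-3}g_{-2}g_{-3}\\&+(-\tfrac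12x_1^3-\tfrac{27}4x_1^2-\tfrac{121}4x_1-45)g_{-4}g_{-3}^2g_{-2}\\&+(-2x_1^3-\tfrac{93}4x_1^2-\tfrac{349}4x_1-105)g_{-1}g_{-3}g_{-2}^2g_{-3}\\&+(-\tfrac52x_1^2-\tfrac{45}2x_1-50)g_{-9}+(-\tfrac52x_1^2-\tfrac{45}2x_1-50)g_{-8}g_{-2}\\&+(5x_1^2+45x_1+100)g_{-4}^2g_{-3}+(-\tfrac52x_1^2-\tfrac{45}2x_1-50)g_{-6}g_{-4}\\&+(\tfrac52x_1^2+\tfrac{45}2x_1+50)g_{-6}g_{-1}g_{-2}+(-5x_1^2-45x_1-100)g_{-4}g_{-1}g_{-2}g_{-3}\\&+(\tfrac12x_1^3+\tfrac{27}4x_1^2+\tfrac{121}4x_1+45)g_{-1}g_{-2}g_{-3}^2g_{-2}\\&+(\tfrac52x_1^2+\tfrac{45}2x_1+50)g_{-1}^2g_{-2}^2g_{-3}\big)\cdot v_\lambda\\ v_{\lambda,7}:={}&\big((-\tfrac1{24}x_1^6-\tfrac{37}{48}x_1^5-\tfrac{265}{48}x_1^4-\tfrac{115}6x_1^3-\tfrac{129}4x_1^2-21x_1)g_{-3}^3g_{-2}^2g_{-3}\\&+(-\tfrac14x_1^5-\tfrac{15}4x_1^4-\tfrac{77}4x_1^3-\tfrac{147}4x_1^2-6x_1+36)g_{-6}g_{-3}g_{-2}g_{-3}\\&+(\tfrac18x_1^5+\tfrac{15}8x_1^4+10x_1^3+\tfrac{87}4x_1^2+\tfrac{51}4x_1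-9)g_{-6}g_{-3}^2g_{-2}\\&+(-\tfrac1{12}x_1^5-\tfrac76x_1^4-\tfrac{139}{24}x_1^3-\tfrac{287}{24}x_1^2-\tfrac{17}2x_1)g_{-4}g_{-3}^3g_{-2}\\&+(\tfrac18x_1^5+2x_1^4+\tfrac{187}{16}x_1^3+\tfrac{487}{16}x_1^2+33x_1+9)g_{-1}g_{-3}^2g_{-2}^2g_{-3}\\&+(-\tfrac14x_1^4-\tfrac94x_1^3-8x_1^2-\tfrac{33}2x_1-18)g_{-9}g_{-3}\\&+(-\tfrac14x_1^4-3x_1^3-\tfrac{53}4x_1^2-\tfrac{51}2x_1-18)g_{-8}g_{-2}g_{-3}\\&+(\tfrac14x_1^4+\tfrac{15}4x_1^3+\tfrac{37}2x_1^2+\tfrac{69}2x_1+18)g_{-8}g_{-3}g_{-2}\\&+(\tfrac18x_1^4+\tfrac32x_1^3+\tfrac{41}8x_1^2+\tfrac94x_1-9)g_{-6}^2\\&+(-\tfrac14x_1^4-\tfrac{11}4x_1^3-7x_1^2+9x_1+36)g_{-6}g_{-4}g_{-3}\\&+(\tfrac14x_1^4+3x_1^3+\tfrac{21}2x_1^2+\tfrac{25}4x_1-15)g_{-6}g_{-1}g_{-2}g_{-3}\\&+(-\tfrac14x_1^4-\tfrac{13}4x_1^3-14x_1^2-\tfrac{43}2x_1-6)g_{-6}g_{-1}g_{-3}g_{-2}\\&+(-\tfrac14x_1^4-\tfrac{29}8x_1^3-\tfrac{145}8x_1^2-\tfrac{73}2x_1-24)g_{-1}^2g_{-3}g_{-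2}^2g_{-3}\\&+(\tfrac12x_1^4+\tfrac{29}4x_1^3+\tfrac{145}4x_1^2+73x_1+48)g_{-4}g_{-1}g_{-3}g_{-2}g_{-3}\\&+(-\tfrac1{12}x_1^4-x_1^3-\tfrac{25}6x_1^2-\tfrac{27}4x_1-3)g_{-1}g_{-2}g_{-3}^3g_{-2}\\&+(-\tfrac12x_1^3-\tfrac{31}4x_1^2-\tfrac{143}4x_1-51)g_{-8}g_{-1}g_{-2}\\&+(\tfrac14x_1^3+\tfrac{23}8x_1^2+\tfrac{87}8x_1+\tfrac{27}2)g_{-1}^2g_{-2}g_{-3}^2g_{-2}\\&+(\tfrac14x_1^3+\tfrac{13}4x_1^2+\tfrac{27}2x_1+18)g_{-1}^3g_{-2}^2g_{-3}\\&+(\tfrac12x_1^3+\tfrac{13}2x_1^2+27x_1+36)g_{-8}g_{-4}\\&+(-\tfrac14x_1^3-\tfrac{23}8x_1^2-\tfrac{87}8x_1-\tfrac{27}2)g_{-4}g_{-1}g_{-3}^2g_{-2}\\&+(\tfrac14x_1^3+\tfrac{13}4x_1^2+\tfrac{27}2x_1+18)g_{-6}g_{-1}^2g_{-2}\\&+(\tfrac12x_1^3+\tfrac{13}2x_1^2+27x_1+36)g_{-4}^2g_{-1}g_{-3}\\&+(-\tfrac12x_1^3-\tfrac{13}2x_1^2-27x_1-36)g_{-4}g_{-1}^2g_{-2}g_{-3}\\&+(-\tfrac14x_1^3-\tfrac{13}4x_1^2-\tfrac{27}2x_1-18)g_{-6}g_{-4}g_{-1}\\&+(-\tfrac54x_1^2-\tfrac{35}4x_1-15)g_{-9}g_{-1}\big)\cdot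 v_\lambda \end{aligned}$$ are linearly independent $\bar{\mathfrak b}$-singular vectors. **5.** Suppose $\lambda=x_1\omega_1+2\omega_3$. Then $$\begin{aligned} v_{\lambda,0}:={}&v_\lambda\\ v_{\lambda,1}:={}&\big(-x_1g_{-3}+2g_{-1}\big)\cdot v_\lambda\\ v_{\lambda,2}:={}&\big((2x_1^2-2x_1)g_{-3}^2+(-4x_1+4)g_{-1}g_{-3}+4g_{-1}^2\big)\cdot v_\lambda\\ v_{\lambda,3}:={}&\big((-2x_1-8)g_{-6}+(2x_1+8)g_{-4}g_{-3}+(2x_1^2+14x_1+24)g_{-3}g_{-2}g_{-3}\\&+(-x_1^2-7x_1-12)g_{-2}g_{-3}^2+(-2x_1-8)g_{-1}g_{-2}g_{-3}\big)\cdot v_\lambda\\ v_{\lambda,4}:={}&\big((-x_1^2-10x_1-21)g_{-8}+(-\tfrac12x_1^3-\tfrac72x_1^2-\tfrac{15}2x_1-\tfrac92)g_{-6}g_{-3}\\&+(x_1^2+7x_1+12)g_{-6}g_{-1}+(x_1^3+\tfrac{13}2x_1^2+10x_1-\tfrac32)g_{-4}g_{-3}^2\\&+(-x_1^2-7x_1-12)g_{-4}g_{-1}g_{-3}+(\tfrac12x_1^4+5x_1^3+\tfrac{33}2x_1^2+18x_1)g_{-3}^2g_{-2}g_{-3}\\&+(-x_1^3-\tfrac{19}2x_1^2-28x_1-\tfrac{51}2)g_{-1}g_{-3}g_{-2}g_{-3}+(\tfrac32x_1^2+9x_1+\tfrac{27}2)g_{-1}g_{-2}g_{-3}^2\\&+(x_1^2+7x_1+12)g_{-1}^2g_{-2}g_{-3}\big)\cdot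 v_\lambda\\ v_{\lambda,5}:={}&\big((\tfrac43x_1^3+\tfrac{38}3x_1^2+\tfrac{118}3x_1+40)g_{-9}g_{-3}+(-\tfrac43x_1^2-\tfrac{28}3x_1-16)g_{-9}g_{-1}\\&+(-\tfrac43x_1^2-\tfrac{28}3x_1-16)g_{-8}g_{-4}+(\tfrac43x_1^3+\tfrac{38}3x_1^2+\tfrac{118}3x_1+40)g_{-8}g_{-2}g_{-3}\\&+(\tfrac43x_1^3+14x_1^2+\tfrac{146}3x_1+56)g_{-6}g_{-4}g_{-3}\\&+(\tfrac43x_1^4+18x_1^3+90x_1^2+\tfrac{592}3x_1+160)g_{-6}g_{-3}g_{-2}g_{-3}\\&+(-\tfrac23x_1^4-9x_1^3-45x_1^2-\tfrac{296}3x_1-80)g_{-6}g_{-2}g_{-3}^2\\&+(-\tfrac43x_1^3-14x_1^2-\tfrac{146}3x_1-56)g_{-6}g_{-1}g_{-2}g_{-3}\\&+(-\tfrac23x_1^3-\tfrac{22}3x_1^2-\tfrac{80}3x_1-32)g_{-6}^2\\&+(-\tfrac43x_1^4-\tfrac{52}3x_1^3-\tfrac{251}3x_1^2-\tfrac{533}3x_1-140)g_{-4}g_{-3}^2g_{-2}g_{-3}\\&+(\tfrac43x_1^3+14x_1^2+\tfrac{146}3x_1+56)g_{-4}g_{-1}g_{-2}g_{-3}^2\\&+(-\tfrac43x_1^3-14x_1^2-\tfrac{146}3x_1-56)g_{-4}^2g_{-3}^2\\&+(-\tfrac13x_1^5-\tfrac{11}2x_1^4-36x_1^3-\tfrac{701}6x_1^2-188x_1-120)g_{-3}^2g_{-2}^2g_{-3}^2\\&+(\tfrac23x_1^4+\tfrac{26}3x_1^3+\tfrac{251}6x_1^2+\tfrac{533}6x_1+70)g_{-1}g_{-3}g_{-2}^2g_{-3}^2\\&+(-\tfrac23x_1^3-7x_1^2-\tfrac{73}3x_1-28)g_{-1}^2g_{-2}^2g_{-3}^2\big)\cdot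 v_\lambda \end{aligned}$$ are linearly independent $\bar{\mathfrak b}$-singular vectors. Moreover, for $x_1\notin\{-5,-3,-6,-4,-7/2,-1,-7,0,-2\}$, the $\mathrm{Lie}\,G_2$-submodules generated by the $v_{\lambda,i}$ have pairwise zero intersections.
   Context: The base field is $\mathbb C$. Realization of $so(7)$: let $V$ have basis $e_1,e_2,e_3,e_0,e_{-1},e_{-2},e_{-3}$ with dual basis $e_j^*$ and symmetric bilinear form $B(e_i,e_j)=1$ if $i=-j$ and $0$ otherwise; $so(7)$ is the Lie algebra of endomorphisms of $V$ skew with respect to $B$. $\mathfrak h$ is the subalgebra of diagonal matrices, $\varepsilon_i\in\mathfrak h^*$ the weight of $e_i$ ($i=1,2,3$), $\langle\varepsilon_i,\varepsilon_j\rangle=\delta_{ij}$. Positive roots: $\varepsilon_i\pm\varepsilon_j$ ($i<j$) and $\varepsilon_i$; simple roots $\eta_1=\varepsilon_1-\varepsilon_2$, $\eta_2=\varepsilon_2-\varepsilon_3$, $\eta_3=\varepsilon_3$; $\mathfrak b$ is the corresponding Borel subalgebra. Fundamental weights: $\omega_1=\varepsilon_1$, $\omega_2=\varepsilon_1+\varepsilon_2$, $\omega_3=\frac12(\varepsilon_1+\varepsilon_2+\varepsilon_3)$. Root vectors (a Chevalley-Weyl basis, so that $[g_\beta,g_{-\beta}]$ is the coroot of $\beta$): $g_{\varepsilon_i-\varepsilon_j}=e_i\otimes e_j^*-e_{-j}\otimes e_{-i}^*$ for $i\ne j$; for $i<j$, $g_{\varepsilon_i+\varepsilon_j}=e_i\otimes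 e_{-j}^*-e_j\otimes e_{-i}^*$ and $g_{-\varepsilon_i-\varepsilon_j}=-(e_{-i}\otimes e_j^*-e_{-j}\otimes e_i^* )$; $g_{\varepsilon_i}=\sqrt2(e_i\otimes e_0^*-e_0\otimes e_{-i}^* )$ and $g_{-\varepsilon_i}=-\sqrt2(e_{-i}\otimes e_0^*-e_0\otimes e_i^* )$. They are abbreviated $g_{\pm1},\dots,g_{\pm9}$, where $g_{\pm k}$ is the root vector of weight $\pm\beta_k$ with $\beta_1=\varepsilon_1-\varepsilon_2$, $\beta_2=\varepsilon_2-\varepsilon_3$, $\beta_3=\varepsilon_3$, $\beta_4=\varepsilon_1-\varepsilon_3$, $\beta_5=\varepsilon_2$, $\beta_6=\varepsilon_1$, $\beta_7=\varepsilon_2+\varepsilon_3$, $\beta_8=\varepsilon_1+\varepsilon_3$, $\beta_9=\varepsilon_1+\varepsilon_2$. With these signs, for instance, $[g_{-2},g_{-1}]=g_{-4}$, $[g_{-2},g_{-3}]=-g_{-5}$, $[g_{-3},g_{-4}]=g_{-6}$, $[g_{-3},g_{-6}]=-2g_{-8}$, $[g_{-2},g_{-8}]=-g_{-9}$. $\mathrm{Lie}\,G_2$ is the simple complex Lie algebra of type $G_2$ with short simple root $\alpha_1$, long simple root $\alpha_2$, and Chevalley generators $\bar g_{\pm1},\bar g_{\pm2}$ for $\pm\alpha_1,\pm\alpha_2$. The embedding $i:\mathrm{Lie}\,G_2\hookrightarrow so(7)$ is determined by $i(\bar g_{\pm2})=g_{\pm2}$, $i(\bar g_{\pm1})=g_{\pm1}+g_{\pm3}$.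 $\bar{\mathfrak b}$ is the Borel subalgebra of $\mathrm{Lie}\,G_2$ spanned by the Cartan subalgebra $\bar{\mathfrak h}=i^{-1}(\mathfrak h)$ and the positive root spaces (generated by $\bar g_1,\bar g_2$). $so(7)$-modules are regarded as $\mathrm{Lie}\,G_2$-modules via $i$. A vector $v$ is $\bar{\mathfrak b}$-singular if $\mathbb C v$ is preserved by $\bar{\mathfrak b}$. $\mathfrak p_{(1,0,0)}\supset\mathfrak b$ is the parabolic subalgebra of $so(7)$ for which $\eta_1$ is a root of the nilradical and $\eta_2,\eta_3$ are roots of the Levi part $\mathfrak l$ (so $\mathfrak l\simeq\mathbb C\oplus so(5)$). For $\lambda\in\mathfrak h^*$ such that the irreducible $\mathfrak l$-module $V_\lambda(\mathfrak l)$ of highest weight $\lambda$ is finite-dimensional, $M_\lambda(so(7),\mathfrak p_{(1,0,0)})=U(so(7))\otimes_{U(\mathfrak p_{(1,0,0)})}V_\lambda(\mathfrak l)$, with the nilradical acting trivially on $V_\lambda(\mathfrak l)$.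
   Formalization: Linear independence is claimed in part 4 only for x_1 not in {-8,-5,-9/2,-4,-3,-2} and in part 5 only for x_1 not in {-4,-3}; at these values some listed vector is zero or v_{λ,3}, v_{λ,4} are proportional, so the claim as printed fails there. *)

theory Defs
  imports "HOL-Analysis.Analysis" "HOL-Library.Poly_Mapping"
begin

section \<open>Complex vector spaces and complex Lie algebras\<close>

class complex_vector = ab_group_add +
  fixes scaleC :: "complex \<Rightarrow> 'a \<Rightarrow> 'a"  (infixr \<open>*\<^sub>C\<close> 75)
  assumes scaleC_add_right: "c *\<^sub>C (x + y) = c *\<^sub>C x + c *\<^sub>C y"
    and scaleC_add_left: "(c + d) *\<^sub>C x = c *\<^sub>C x + d *\<^sub>C x"
    and scaleC_scaleC: "c *\<^sub>C d *\<^sub>C x = (c * d) *\<^sub>C x"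
    and scaleC_one: "1 *\<^sub>C x = x"

global_interpretation cvec: vector_space "scaleC :: complex \<Rightarrow> 'a \<Rightarrow> 'a::complex_vector"
  by unfold_locales (simp_all add: scaleC_add_right scaleC_add_left scaleC_scaleC scaleC_one)

abbreviation clinear :: "('a::complex_vector \<Rightarrow> 'b::complex_vector) \<Rightarrow> bool" where
  "clinear \<equiv> Vector_Spaces.linear scaleC scaleC"

class complex_lie_algebra = complex_vector +
  fixes lie :: "'a \<Rightarrow> 'a \<Rightarrow> 'a"
  assumes lie_add_left: "lie (x + y) z = lie x z + lie y z"
    and lie_add_right: "lie x (y + z) = lie x y + lie x z"
    and lie_scaleC_left: "lie (c *\<^sub>C x) y = c *\<^sub>C lie x y"
    and lie_scaleC_right: "lie x (c *\<^sub>C y) = c *\<^sub>C lie x y"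
    and lie_self: "lie x x = 0"
    and lie_jacobi: "lie x (lie y z) + lie y (lie z x) + lie z (lie x y) = 0"

definition lie_generated :: "'a::complex_lie_algebra set \<Rightarrow> 'a set" where
  "lie_generated S =
     \<Inter>{L. cvec.subspace L \<and> S \<subseteq> L \<and> (\<forall>x\<in>L. \<forall>y\<in>L. lie x y \<in> L)}"

definition lie_simple :: "'a::complex_lie_algebra itself \<Rightarrow> bool" where
  "lie_simple TYPE('a) \<longleftrightarrow>
     (\<exists>x y :: 'a. lie x y \<noteq> 0) \<and>
     (\<forall>I :: 'a set. cvec.subspace I \<and> (\<forall>x. \<forall>y\<in>I. lie x y \<in> I) \<longrightarrow> I = {0} \<or> I = UNIV)"

definition lie_hom :: "('a::complex_lie_algebra \<Rightarrow> 'b::complex_lie_algebra) \<Rightarrow> bool" where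
  "lie_hom f \<longleftrightarrow> clinear f \<and> (\<forall>x y. f (lie x y) = lie (f x) (f y))"

text \<open>A representation of the subalgebra \<open>L\<close> on a whole vector space; \<open>act x\<close> is
  unconstrained for \<open>x \<notin> L\<close>.\<close>

definition lie_rep_on ::
  "'a::complex_lie_algebra set \<Rightarrow> ('a \<Rightarrow> 'v::complex_vector \<Rightarrow> 'v) \<Rightarrow> bool" where
  "lie_rep_on L act \<longleftrightarrow>
     (\<forall>x\<in>L. clinear (act x)) \<and>
     (\<forall>x\<in>L. \<forall>y\<in>L. \<forall>w. act (x + y) w = act x w + act y w) \<and>
     (\<forall>x\<in>L. \<forall>c w. act (c *\<^sub>C x) w = c *\<^sub>C act x w) \<and>
     (\<forall>x\<in>L. \<forall>y\<in>L. \<forall>w. act (lie x y) w = act x (act y w) - act y (act x w))"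


section \<open>Free vector spaces\<close>

text \<open>\<^typ>\<open>'b \<Rightarrow>\<^sub>0 complex\<close> is the complex vector space with basis \<^typ>\<open>'b\<close>;
  the basis vectors are \<open>Poly_Mapping.single b 1\<close>.\<close>

instantiation complex :: complex_vector
begin
definition scaleC_complex :: "complex \<Rightarrow> complex \<Rightarrow> complex" where
  "scaleC_complex = (*)"
instance
  by standard (simp_all add: scaleC_complex_def algebra_simps)
end

instantiation poly_mapping :: (type, complex_vector) complex_vector
begin
lift_definition scaleC_poly_mapping :: "complex \<Rightarrow> ('a \<Rightarrow>\<^sub>0 'b) \<Rightarrow> ('a \<Rightarrow>\<^sub>0 'b)"
  is "\<lambda>c f k. c *\<^sub>C f k"
  by (erule finite_subset[rotated]) auto
instance
  by standard (transfer; simp add: fun_eq_iff scaleC_add_right scaleC_add_left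
      scaleC_scaleC scaleC_one)+
end

text \<open>The linear extension to the free vector space of a map defined on its basis.\<close>

definition free_extend :: "('b \<Rightarrow> 'm::complex_vector) \<Rightarrow> ('b \<Rightarrow>\<^sub>0 complex) \<Rightarrow> 'm" where
  "free_extend f p = (\<Sum>b\<in>Poly_Mapping.keys p. Poly_Mapping.lookup p b *\<^sub>C f b)"


section \<open>The universal enveloping algebra\<close>

text \<open>Words form a monoid under concatenation (written additively), so
  \<open>'a word \<Rightarrow>\<^sub>0 complex\<close> with its convolution product is the free associative unital
  algebra on \<^typ>\<open>'a\<close>.\<close>

datatype 'a word = Word (letters: "'a list")

instantiation word :: (type) monoid_add
begin
definition zero_word :: "'a word" where "zero_word = Word []"
definition plus_word :: "'a word \<Rightarrow> 'a word \<Rightarrow> 'a word" where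
  "plus_word u w = Word (letters u @ letters w)"
instance
  by standard (simp_all add: zero_word_def plus_word_def)
end

definition free_gen :: "'a \<Rightarrow> ('a word \<Rightarrow>\<^sub>0 complex)" where
  "free_gen x = Poly_Mapping.single (Word [x]) 1"

text \<open>Congruence modulo the two-sided ideal generated by the linear relations of the
  Lie algebra and by \<open>x y - y x - [x, y]\<close>.\<close>

inductive uea_rel :: "('a::complex_lie_algebra word \<Rightarrow>\<^sub>0 complex) \<Rightarrow> ('a word \<Rightarrow>\<^sub>0 complex) \<Rightarrow> bool"
where
  gen_add: "uea_rel (free_gen (x + y)) (free_gen x + free_gen y)"
| gen_scaleC: "uea_rel (free_gen (c *\<^sub>C x)) (c *\<^sub>C free_gen x)"
| gen_lie: "uea_rel (free_gen x * free_gen y - free_gen y * free_gen x) (free_gen (lie x y))"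
| rel_refl: "uea_rel p p"
| rel_sym: "uea_rel p q \<Longrightarrow> uea_rel q p"
| rel_trans: "uea_rel p q \<Longrightarrow> uea_rel q r \<Longrightarrow> uea_rel p r"
| rel_add: "uea_rel p q \<Longrightarrow> uea_rel p' q' \<Longrightarrow> uea_rel (p + p') (q + q')"
| rel_scaleC: "uea_rel p q \<Longrightarrow> uea_rel (c *\<^sub>C p) (c *\<^sub>C q)"
| rel_mult: "uea_rel p q \<Longrightarrow> uea_rel p' q' \<Longrightarrow> uea_rel (p * p') (q * q')"

lemma scaleC_poly_mapping_lookup [simp]:
  "Poly_Mapping.lookup (c *\<^sub>C p) k = c *\<^sub>C Poly_Mapping.lookup p k"
  by transfer simp

lemma scaleC_free_eq: "c *\<^sub>C p = Poly_Mapping.single 0 c * p"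
  for p :: "'a::monoid_add \<Rightarrow>\<^sub>0 complex"
proof (rule poly_mapping_eqI)
  fix k
  have "Poly_Mapping.lookup (Poly_Mapping.single 0 c * p) k
      = (\<Sum>l. (c when 0 = l) * (\<Sum>q. (Poly_Mapping.lookup p q when k = l + q)))"
    by (simp add: times_poly_mapping.rep_eq prod_fun_def lookup_single)
  also have "\<dots> = (\<Sum>l. (c * (\<Sum>q. (Poly_Mapping.lookup p q when k = l + q)) when l = 0))"
    by (rule Sum_any.cong) (auto simp: when_def)
  also have "\<dots> = c * Poly_Mapping.lookup p k"
    by simp
  finally show "Poly_Mapping.lookup (c *\<^sub>C p) k
      = Poly_Mapping.lookup (Poly_Mapping.single 0 c * p) k"
    by (simp add: scaleC_complex_def)
qed

lemma word_add_eq_0_iff: "0 = u + w \<longleftrightarrow> u = 0 \<and> w = 0" for u w :: "'a word"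
  by (cases u; cases w) (auto simp: zero_word_def plus_word_def)

lemma lookup_times_word_0:
  "Poly_Mapping.lookup (p * q) 0 = Poly_Mapping.lookup p 0 * Poly_Mapping.lookup q 0"
  for p q :: "'a word \<Rightarrow>\<^sub>0 complex"
proof -
  have "Poly_Mapping.lookup (p * q) 0
      = (\<Sum>l. Poly_Mapping.lookup p l * (\<Sum>r. (Poly_Mapping.lookup q r when 0 = l + r)))"
    by (simp add: times_poly_mapping.rep_eq prod_fun_def)
  also have "\<dots> = (\<Sum>l. (Poly_Mapping.lookup p l * (\<Sum>r. (Poly_Mapping.lookup q r when r = 0)) when l = 0))"
    by (rule Sum_any.cong) (auto simp: when_def word_add_eq_0_iff)
  also have "\<dots> = Poly_Mapping.lookup p 0 * Poly_Mapping.lookup q 0"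
    by simp
  finally show ?thesis .
qed

lemma uea_rel_lookup_0:
  "uea_rel p q \<Longrightarrow> Poly_Mapping.lookup p 0 = Poly_Mapping.lookup q 0"
proof (induction rule: uea_rel.induct)
  fix x y :: 'a and c
  have z: "Poly_Mapping.lookup (free_gen x) 0 = 0" for x :: 'a
    by (simp add: free_gen_def lookup_single zero_word_def)
  show "Poly_Mapping.lookup (free_gen (x + y)) 0 = Poly_Mapping.lookup (free_gen x + free_gen y) 0"
    "Poly_Mapping.lookup (free_gen (c *\<^sub>C x)) 0 = Poly_Mapping.lookup (c *\<^sub>C free_gen x) 0"
    "Poly_Mapping.lookup (free_gen x * free_gen y - free_gen y * free_gen x) 0
      = Poly_Mapping.lookup (free_gen (lie x y)) 0"
    by (simp_all add: z lookup_times_word_0 lookup_add lookup_minus scaleC_complex_def)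
qed (simp_all add: lookup_times_word_0 lookup_add scaleC_complex_def)

quotient_type (overloaded) 'a uea = "'a::complex_lie_algebra word \<Rightarrow>\<^sub>0 complex" / uea_rel
  by (intro equivpI reflpI sympI transpI) (auto intro: rel_refl rel_sym rel_trans)

lemma uea_rel_uminus: "uea_rel p q \<Longrightarrow> uea_rel (- p) (- q)"
  using rel_scaleC[of p q "- 1"] by (simp add: cvec.scale_minus_left scaleC_one)

lemma uea_rel_minus: "uea_rel p q \<Longrightarrow> uea_rel p' q' \<Longrightarrow> uea_rel (p - p') (q - q')"
  using rel_add[OF _ uea_rel_uminus, of p q p' q'] by simp

instantiation uea :: (complex_lie_algebra) ring_1
begin
lift_definition zero_uea :: "'a uea" is 0 .
lift_definition one_uea :: "'a uea" is 1 .
lift_definition plus_uea :: "'a uea \<Rightarrow> 'a uea \<Rightarrow> 'a uea" is "(+)" by (rule rel_add)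
lift_definition minus_uea :: "'a uea \<Rightarrow> 'a uea \<Rightarrow> 'a uea" is "(-)" by (rule uea_rel_minus)
lift_definition uminus_uea :: "'a uea \<Rightarrow> 'a uea" is uminus by (rule uea_rel_uminus)
lift_definition times_uea :: "'a uea \<Rightarrow> 'a uea \<Rightarrow> 'a uea" is "(*)" by (rule rel_mult)
instance
proof
  show "(0 :: 'a uea) \<noteq> 1"
    by transfer (auto dest: uea_rel_lookup_0)
qed (transfer; simp add: algebra_simps rel_refl)+
end

instantiation uea :: (complex_lie_algebra) complex_vector
begin
lift_definition scaleC_uea :: "complex \<Rightarrow> 'a uea \<Rightarrow> 'a uea" is scaleC by (rule rel_scaleC)
instance
  by standard (transfer; simp add: scaleC_add_right scaleC_add_left scaleC_scaleC scaleC_one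
      rel_refl)+
end

lift_definition uea_incl :: "'a::complex_lie_algebra \<Rightarrow> 'a uea" is free_gen .


section \<open>Induced modules\<close>

text \<open>The subspace of the free vector space on \<open>U(g) \<times> V\<close> by which one divides to obtain
  \<open>U(g) \<otimes>\<^bsub>U(P)\<^esub> V\<close>.  Balancedness over \<open>U(P)\<close> is imposed on the generators \<open>x \<in> P\<close>
  of \<open>U(P)\<close>, so that the \<open>U(P)\<close>-action on \<open>V\<close> enters only through \<open>act\<close>.\<close>

definition tensor_relations ::
  "'a::complex_lie_algebra set \<Rightarrow> ('a \<Rightarrow> 'v::complex_vector \<Rightarrow> 'v) \<Rightarrow> ('a uea \<times> 'v \<Rightarrow>\<^sub>0 complex) set"
where
  "tensor_relations P act = (let \<delta> = (\<lambda>u w. Poly_Mapping.single (u, w) 1) in cvec.span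
     ({\<delta> (u + u') w - \<delta> u w - \<delta> u' w | u u' w. True} \<union>
      {\<delta> u (w + w') - \<delta> u w - \<delta> u w' | u w w'. True} \<union>
      {\<delta> (c *\<^sub>C u) w - c *\<^sub>C \<delta> u w | c u w. True} \<union>
      {\<delta> u (c *\<^sub>C w) - c *\<^sub>C \<delta> u w | c u w. True} \<union>
      {\<delta> (u * uea_incl x) w - \<delta> u (act x w) | u x w. x \<in> P}))"

text \<open>\<^typ>\<open>'m\<close>, with \<open>tens u w\<close> in the role of \<open>u \<otimes> w\<close> and the \<open>U(g)\<close>-action \<open>uact\<close>, is
  (canonically isomorphic to) the induced module \<open>U(g) \<otimes>\<^bsub>U(P)\<^esub> V\<close>: the map from the free
  vector space onto \<^typ>\<open>'m\<close> has exactly the tensor relations as its kernel.\<close>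

definition is_induced_module ::
  "'a::complex_lie_algebra set \<Rightarrow> ('a \<Rightarrow> 'v::complex_vector \<Rightarrow> 'v) \<Rightarrow>
   ('a uea \<Rightarrow> 'v \<Rightarrow> 'm::complex_vector) \<Rightarrow> ('a uea \<Rightarrow> 'm \<Rightarrow> 'm) \<Rightarrow> bool"
where
  "is_induced_module P act tens uact \<longleftrightarrow>
     surj (free_extend (\<lambda>(u, w). tens u w)) \<and>
     {p. free_extend (\<lambda>(u, w). tens u w) p = 0} = tensor_relations P act \<and>
     (\<forall>u. clinear (uact u)) \<and>
     (\<forall>u u' w. uact u (tens u' w) = tens (u * u') w)"


section \<open>The Lie algebra \<open>so(7)\<close>\<close>

text \<open>The basis of \<open>V\<close> is indexed by the seven-element type \<^typ>\<open>7\<close> of integers modulo 7,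
  whose elements are \<open>1, 2, 3, 0, -1, -2, -3\<close>.\<close>

definition so7_form :: "complex^7 \<Rightarrow> complex^7 \<Rightarrow> complex" where
  "so7_form v w = (\<Sum>i\<in>UNIV. v $ i * w $ (- i))"

definition so7_matrices :: "(complex^7^7) set" where
  "so7_matrices = {A. \<forall>v w. so7_form (A *v v) w + so7_form v (A *v w) = 0}"

typedef so7 = so7_matrices
  by (rule exI[of _ 0]) (simp add: so7_matrices_def so7_form_def)

setup_lifting type_definition_so7

definition mscale :: "complex \<Rightarrow> complex^7^7 \<Rightarrow> complex^7^7" where
  "mscale c A = (\<chi> i j. c * A $ i $ j)"

lemma so7_form_add_left: "so7_form (v + v') w = so7_form v w + so7_form v' w"
  and so7_form_add_right: "so7_form v (w + w') = so7_form v w + so7_form v w'"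
  and so7_form_diff_left: "so7_form (v - v') w = so7_form v w - so7_form v' w"
  and so7_form_diff_right: "so7_form v (w - w') = so7_form v w - so7_form v w'"
  and so7_form_scale_left: "so7_form (c *s v) w = c * so7_form v w"
  and so7_form_scale_right: "so7_form v (c *s w) = c * so7_form v w"
  by (simp_all add: so7_form_def algebra_simps sum.distrib sum_subtractf sum_distrib_left)

lemma mscale_mult_vec: "mscale c A *v v = c *s (A *v v)"
  by (simp add: mscale_def matrix_vector_mult_def vec_eq_iff sum_distrib_left algebra_simps)

lemma so7_matrices_add: "A \<in> so7_matrices \<Longrightarrow> B \<in> so7_matrices \<Longrightarrow> A + B \<in> so7_matrices"
  by (simp add: so7_matrices_def matrix_vector_mult_add_rdistrib so7_form_add_left
      so7_form_add_right add_eq_0_iff)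

lemma so7_matrices_mscale: "A \<in> so7_matrices \<Longrightarrow> mscale c A \<in> so7_matrices"
  by (simp add: so7_matrices_def mscale_mult_vec so7_form_scale_left so7_form_scale_right
      flip: distrib_left)

lemma so7_matrices_uminus: "A \<in> so7_matrices \<Longrightarrow> - A \<in> so7_matrices"
proof -
  have "- A = mscale (- 1) A" by (simp add: mscale_def vec_eq_iff)
  then show "A \<in> so7_matrices \<Longrightarrow> - A \<in> so7_matrices" by (simp add: so7_matrices_mscale)
qed

lemma so7_matrices_diff: "A \<in> so7_matrices \<Longrightarrow> B \<in> so7_matrices \<Longrightarrow> A - B \<in> so7_matrices"
  using so7_matrices_add[OF _ so7_matrices_uminus, of A B] by simp

lemma so7_matrices_lie:
  assumes "A \<in> so7_matrices" "B \<in> so7_matrices"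
  shows "A ** B - B ** A \<in> so7_matrices"
proof -
  have "so7_form (A *v v) w = - so7_form v (A *v w)" "so7_form (B *v v) w = - so7_form v (B *v w)"
    for v w using assms by (simp_all add: so7_matrices_def eq_neg_iff_add_eq_0)
  then show ?thesis
    by (simp add: so7_matrices_def matrix_vector_mult_diff_rdistrib so7_form_diff_left
        so7_form_diff_right flip: matrix_vector_mul_assoc)
qed

instantiation so7 :: complex_lie_algebra
begin
lift_definition zero_so7 :: so7 is 0
  by (simp add: so7_matrices_def so7_form_def)
lift_definition plus_so7 :: "so7 \<Rightarrow> so7 \<Rightarrow> so7" is "(+)" by (rule so7_matrices_add)
lift_definition minus_so7 :: "so7 \<Rightarrow> so7 \<Rightarrow> so7" is "(-)" by (rule so7_matrices_diff)
lift_definition uminus_so7 :: "so7 \<Rightarrow> so7" is uminus by (rule so7_matrices_uminus)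
lift_definition scaleC_so7 :: "complex \<Rightarrow> so7 \<Rightarrow> so7" is mscale by (rule so7_matrices_mscale)
lift_definition lie_so7 :: "so7 \<Rightarrow> so7 \<Rightarrow> so7" is "\<lambda>A B. A ** B - B ** A"
  by (rule so7_matrices_lie)
instance
proof
  fix x y z :: so7 and c d :: complex
  show "x + y + z = x + (y + z)" "x + y = y + x" "0 + x = x" "- x + x = 0" "x - y = x + - y"
    by (transfer; simp)+
  show "c *\<^sub>C (x + y) = c *\<^sub>C x + c *\<^sub>C y" "(c + d) *\<^sub>C x = c *\<^sub>C x + d *\<^sub>C x"
    "c *\<^sub>C d *\<^sub>C x = (c * d) *\<^sub>C x" "1 *\<^sub>C x = x"
    by (transfer; simp add: mscale_def vec_eq_iff algebra_simps)+
  show "lie (c *\<^sub>C x) y = c *\<^sub>C lie x y" "lie x (c *\<^sub>C y) = c *\<^sub>C lie x y"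
    by (transfer; simp add: mscale_def matrix_matrix_mult_def vec_eq_iff sum_distrib_left
        algebra_simps)+
  show "lie (x + y) z = lie x z + lie y z" "lie x (y + z) = lie x y + lie x z" "lie x x = 0"
    by (transfer; simp add: matrix_add_ldistrib matrix_matrix_mult_def vec_eq_iff
        sum.distrib algebra_simps)+
  show "lie x (lie y z) + lie y (lie z x) + lie z (lie x y) = 0"
  proof transfer
    fix A B C :: "complex^7^7"
    have l: "X ** (Y - Z) = X ** Y - X ** Z" and r: "(Y - Z) ** X = Y ** X - Z ** X"
      for X Y Z :: "complex^7^7"
      by (simp_all add: matrix_matrix_mult_def vec_eq_iff sum_subtractf algebra_simps)
    show "(A ** (B ** C - C ** B) - (B ** C - C ** B) ** A) +
      (B ** (C ** A - A ** C) - (C ** A - A ** C) ** B) +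
      (C ** (A ** B - B ** A) - (A ** B - B ** A) ** C) = 0"
      by (simp add: l r matrix_mul_assoc)
  qed
qed
end

text \<open>\<open>mat_unit i j\<close> is \<open>e\<^sub>i \<otimes> e\<^sub>j\<^sup>*\<close>, i.e. it maps \<open>e\<^sub>j\<close> to \<open>e\<^sub>i\<close>.\<close>

definition mat_unit :: "7 \<Rightarrow> 7 \<Rightarrow> complex^7^7" where
  "mat_unit i j = (\<chi> k l. if k = i \<and> l = j then 1 else 0)"

lemma mat_unit_mult_vec: "(mat_unit i j *v v) $ k = (if k = i then v $ j else 0)"
proof -
  have "(mat_unit i j *v v) $ k = (\<Sum>l\<in>UNIV. if l = j then (if k = i then v $ l else 0) else 0)"
    unfolding mat_unit_def matrix_vector_mult_def vec_lambda_beta by (intro sum.cong) auto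
  then show ?thesis by simp
qed

lift_definition skew_unit :: "7 \<Rightarrow> 7 \<Rightarrow> so7" is "\<lambda>i j. mat_unit i j - mat_unit (- j) (- i)"
proof -
  fix i j :: 7
  have l: "so7_form (mat_unit i j *v v) w = v $ j * w $ (- i)" for i j v w
  proof -
    have "so7_form (mat_unit i j *v v) w = (\<Sum>k\<in>UNIV. if k = i then v $ j * w $ (- k) else 0)"
      unfolding so7_form_def mat_unit_mult_vec by (intro sum.cong) auto
    then show ?thesis by simp
  qed
  have r: "so7_form v (mat_unit i j *v w) = v $ (- i) * w $ j" for i j v w
  proof -
    have "so7_form v (mat_unit i j *v w) = (\<Sum>k\<in>UNIV. if k = - i then v $ k * w $ j else 0)"
      unfolding so7_form_def mat_unit_mult_vec by (intro sum.cong) (auto simp: minus_equation_iff)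
    then show ?thesis by simp
  qed
  show "mat_unit i j - mat_unit (- j) (- i) \<in> so7_matrices"
    by (simp add: so7_matrices_def matrix_vector_mult_diff_rdistrib so7_form_diff_left so7_form_diff_right l r)
qed

text \<open>With \<open>\<epsilon>\<^sub>-\<^sub>i = - \<epsilon>\<^sub>i\<close> and \<open>\<epsilon>\<^sub>0 = 0\<close>, \<open>skew_unit i j\<close> has weight \<open>\<epsilon>\<^sub>i - \<epsilon>\<^sub>j\<close>.  The Chevalley--Weyl
  root vector \<open>root_vector (\<plusminus>k)\<close> has weight \<open>\<plusminus>\<beta>\<^sub>k\<close>, where \<open>\<beta>\<^sub>1, \<dots>, \<beta>\<^sub>9\<close> are
  \<open>\<epsilon>\<^sub>1 - \<epsilon>\<^sub>2\<close>, \<open>\<epsilon>\<^sub>2 - \<epsilon>\<^sub>3\<close>, \<open>\<epsilon>\<^sub>3\<close>, \<open>\<epsilon>\<^sub>1 - \<epsilon>\<^sub>3\<close>, \<open>\<epsilon>\<^sub>2\<close>, \<open>\<epsilon>\<^sub>1\<close>, \<open>\<epsilon>\<^sub>2 + \<epsilon>\<^sub>3\<close>, \<open>\<epsilon>\<^sub>1 + \<epsilon>\<^sub>3\<close>,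
  \<open>\<epsilon>\<^sub>1 + \<epsilon>\<^sub>2\<close>.\<close>

definition root_vector :: "int \<Rightarrow> so7" where
  "root_vector k =
    (let s = complex_of_real (sqrt 2) in
     if k = 1 then skew_unit 1 2 else if k = - 1 then skew_unit 2 1
     else if k = 2 then skew_unit 2 3 else if k = - 2 then skew_unit 3 2
     else if k = 3 then s *\<^sub>C skew_unit 3 0 else if k = - 3 then - s *\<^sub>C skew_unit (- 3) 0
     else if k = 4 then skew_unit 1 3 else if k = - 4 then skew_unit 3 1
     else if k = 5 then s *\<^sub>C skew_unit 2 0 else if k = - 5 then - s *\<^sub>C skew_unit (- 2) 0
     else if k = 6 then s *\<^sub>C skew_unit 1 0 else if k = - 6 then - s *\<^sub>C skew_unit (- 1) 0
     else if k = 7 then skew_unit 2 (- 3) else if k = - 7 then - skew_unit (- 2) 3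
     else if k = 8 then skew_unit 1 (- 3) else if k = - 8 then - skew_unit (- 1) 3
     else if k = 9 then skew_unit 1 (- 2) else if k = - 9 then - skew_unit (- 1) 2
     else 0)"


subsection \<open>Weights, roots and the parabolic subalgebra\<close>

text \<open>Weights are given as functions on all of \<^typ>\<open>so7\<close>; only their values on the diagonal
  matrices matter.\<close>

definition cartan :: "so7 set" where
  "cartan = {x. \<forall>i j. i \<noteq> j \<longrightarrow> Rep_so7 x $ i $ j = 0}"

definition \<epsilon> :: "7 \<Rightarrow> so7 \<Rightarrow> complex" where
  "\<epsilon> i x = Rep_so7 x $ i $ i"

definition root_space :: "(so7 \<Rightarrow> complex) \<Rightarrow> so7 set" where
  "root_space \<alpha> = {x. \<forall>h\<in>cartan. lie h x = \<alpha> h *\<^sub>C x}"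

definition positive_roots :: "(so7 \<Rightarrow> complex) set" where
  "positive_roots =
     {(\<lambda>h. \<epsilon> i h - \<epsilon> j h) | i j. (i, j) \<in> {(1, 2), (1, 3), (2, 3)}} \<union>
     {(\<lambda>h. \<epsilon> i h + \<epsilon> j h) | i j. (i, j) \<in> {(1, 2), (1, 3), (2, 3)}} \<union>
     {\<epsilon> i | i. i \<in> {1, 2, 3}}"

definition levi_positive_roots :: "(so7 \<Rightarrow> complex) set" where
  "levi_positive_roots =
     {\<alpha> \<in> positive_roots. \<exists>a b :: nat.
        \<alpha> = (\<lambda>h. of_nat a * (\<epsilon> 2 h - \<epsilon> 3 h) + of_nat b * \<epsilon> 3 h)}"

definition levi :: "so7 set" where
  "levi = cvec.span (cartan \<union>
     (\<Union>\<alpha>\<in>levi_positive_roots. root_space \<alpha> \<union> root_space (\<lambda>h. - \<alpha> h)))"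

definition nilradical :: "so7 set" where
  "nilradical = cvec.span (\<Union>\<alpha>\<in>positive_roots - levi_positive_roots. root_space \<alpha>)"

definition parabolic :: "so7 set" where
  "parabolic = cvec.span (levi \<union> nilradical)"

definition \<omega>1 :: "so7 \<Rightarrow> complex" where "\<omega>1 h = \<epsilon> 1 h"
definition \<omega>2 :: "so7 \<Rightarrow> complex" where "\<omega>2 h = \<epsilon> 1 h + \<epsilon> 2 h"
definition \<omega>3 :: "so7 \<Rightarrow> complex" where "\<omega>3 h = (\<epsilon> 1 h + \<epsilon> 2 h + \<epsilon> 3 h) / 2"

text \<open>\<^typ>\<open>'v\<close> is the finite-dimensional irreducible module \<open>V\<^sub>\<lambda>\<close> of the Levi part, with highest
  weight vector \<open>w\<close>, on which the nilradical of the parabolic subalgebra acts by zero.\<close>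

definition is_levi_module ::
  "(so7 \<Rightarrow> complex) \<Rightarrow> (so7 \<Rightarrow> 'v::complex_vector \<Rightarrow> 'v) \<Rightarrow> 'v \<Rightarrow> bool"
where
  "is_levi_module lam act w \<longleftrightarrow>
     lie_rep_on parabolic act \<and>
     (\<forall>x\<in>nilradical. \<forall>u. act x u = 0) \<and>
     (\<exists>B :: 'v set. finite B \<and> cvec.span B = UNIV) \<and>
     (\<forall>W :: 'v set. cvec.subspace W \<and> (\<forall>x\<in>levi. \<forall>u\<in>W. act x u \<in> W) \<longrightarrow> W = {0} \<or> W = UNIV) \<and>
     w \<noteq> 0 \<and>
     (\<forall>h\<in>cartan. act h w = lam h *\<^sub>C w) \<and>
     (\<forall>\<alpha>\<in>levi_positive_roots. \<forall>x\<in>root_space \<alpha>. act x w = 0)"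


section \<open>The Lie algebra of type \<open>G\<^sub>2\<close> and its embedding\<close>

text \<open>\<open>g2_cartan j k\<close> is the value of the simple root \<open>\<alpha>\<^sub>k\<close> on the simple coroot of \<open>\<alpha>\<^sub>j\<close>;
  \<open>\<alpha>\<^sub>1\<close> is short and \<open>\<alpha>\<^sub>2\<close> is long.\<close>

definition g2_cartan :: "int \<Rightarrow> int \<Rightarrow> complex" where
  "g2_cartan j k = (if j = k then 2 else if j = 1 then - 3 else - 1)"

text \<open>\<^typ>\<open>'g\<close> is the simple Lie algebra of type \<open>G\<^sub>2\<close> and \<open>gb k\<close>, \<open>k = \<plusminus>1, \<plusminus>2\<close>, are
  Chevalley generators: the Chevalley--Serre relations.\<close>

definition is_G2_chevalley :: "(int \<Rightarrow> 'g::complex_lie_algebra) \<Rightarrow> bool" where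
  "is_G2_chevalley gb \<longleftrightarrow> (let h = (\<lambda>j. lie (gb j) (gb (- j))) in
     lie_simple TYPE('g) \<and>
     lie_generated {gb 1, gb (- 1), gb 2, gb (- 2)} = UNIV \<and>
     lie (h 1) (h 2) = 0 \<and>
     (\<forall>j\<in>{1, 2}. \<forall>k\<in>{1, 2}.
        lie (h j) (gb k) = g2_cartan j k *\<^sub>C gb k \<and>
        lie (h j) (gb (- k)) = - g2_cartan j k *\<^sub>C gb (- k)) \<and>
     lie (gb 1) (gb (- 2)) = 0 \<and> lie (gb 2) (gb (- 1)) = 0 \<and>
     (lie (gb 1) ^^ 4) (gb 2) = 0 \<and> (lie (gb 2) ^^ 2) (gb 1) = 0 \<and>
     (lie (gb (- 1)) ^^ 4) (gb (- 2)) = 0 \<and> (lie (gb (- 2)) ^^ 2) (gb (- 1)) = 0)"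

definition is_G2_embedding ::
  "(int \<Rightarrow> 'g::complex_lie_algebra) \<Rightarrow> ('g \<Rightarrow> so7) \<Rightarrow> bool"
where
  "is_G2_embedding gb \<iota> \<longleftrightarrow> lie_hom \<iota> \<and> inj \<iota> \<and>
     \<iota> (gb 2) = root_vector 2 \<and> \<iota> (gb (- 2)) = root_vector (- 2) \<and>
     \<iota> (gb 1) = root_vector 1 + root_vector 3 \<and>
     \<iota> (gb (- 1)) = root_vector (- 1) + root_vector (- 3)"

text \<open>The sum of the positive root spaces is the subalgebra generated by the simple root
  vectors.\<close>

definition g2_borel :: "(int \<Rightarrow> 'g::complex_lie_algebra) \<Rightarrow> ('g \<Rightarrow> so7) \<Rightarrow> 'g set" where
  "g2_borel gb \<iota> = cvec.span (\<iota> -` cartan \<union> lie_generated {gb 1, gb 2})"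

text \<open>The \<open>G\<^sub>2\<close>-action, through \<open>\<iota>\<close>, on a \<open>U(so(7))\<close>-module.\<close>

definition g2_act ::
  "('g \<Rightarrow> so7) \<Rightarrow> (so7 uea \<Rightarrow> 'm \<Rightarrow> 'm) \<Rightarrow> 'g \<Rightarrow> 'm \<Rightarrow> 'm"
where
  "g2_act \<iota> uact x m = uact (uea_incl (\<iota> x)) m"

text \<open>By this definition the zero vector is singular; nonvanishing is part of linear
  independence.\<close>

definition singular_vector ::
  "'g set \<Rightarrow> ('g \<Rightarrow> 'm::complex_vector \<Rightarrow> 'm) \<Rightarrow> 'm \<Rightarrow> bool"
where
  "singular_vector b \<rho> m \<longleftrightarrow> (\<forall>x\<in>b. \<forall>u\<in>cvec.span {m}. \<rho> x u \<in> cvec.span {m})"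

definition generated_submodule ::
  "('g \<Rightarrow> 'm::complex_vector \<Rightarrow> 'm) \<Rightarrow> 'm \<Rightarrow> 'm set"
where
  "generated_submodule \<rho> m =
     \<Inter>{W. cvec.subspace W \<and> m \<in> W \<and> (\<forall>x. \<forall>u\<in>W. \<rho> x u \<in> W)}"

definition linearly_independent :: "'m::complex_vector list \<Rightarrow> bool" where
  "linearly_independent vs \<longleftrightarrow> distinct vs \<and> cvec.independent (set vs)"

definition pairwise_zero_intersections :: "('g \<Rightarrow> 'm::complex_vector \<Rightarrow> 'm) \<Rightarrow> 'm list \<Rightarrow> bool" where
  "pairwise_zero_intersections \<rho> vs \<longleftrightarrow>
     (\<forall>i<length vs. \<forall>j<length vs. i \<noteq> j \<longrightarrow>
        generated_submodule \<rho> (vs ! i) \<inter> generated_submodule \<rho> (vs ! j) = {0})"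


section \<open>The elements of \<open>U(so(7))\<close> producing the singular vectors\<close>

definition g :: "int \<Rightarrow> so7 uea" where
  "g k = uea_incl (root_vector k)"

definition singular_elements1 :: "complex \<Rightarrow> so7 uea list" where
  "singular_elements1 x1 =
    [1,
     (- x1 - 2) *\<^sub>C (g (-3) * g (-2)) + (- 4) *\<^sub>C g (-4) + 2 *\<^sub>C (g (-2) * g (-1)),
     (x1^2 + 2 * x1) *\<^sub>C (g (-3)^2 * g (-2)) + (x1 - 1) *\<^sub>C g (-6)
     + (- 2 * x1 - 1) *\<^sub>C (g (-1) * g (-3) * g (-2)) + (- 2) *\<^sub>C (g (-4) * g (-1))
     + 2 *\<^sub>C (g (-1)^2 * g (-2))]"

definition singular_elements2 :: "complex \<Rightarrow> so7 uea list" where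
  "singular_elements2 x1 =
    [1,
     (- x1) *\<^sub>C g (-3) + g (-1),
     (2 * x1 + 5) *\<^sub>C (g (-3) * g (-2) * g (-3)) + (- 1) *\<^sub>C g (-6)
     + 2 *\<^sub>C (g (-4) * g (-3)) + (- 2) *\<^sub>C (g (-1) * g (-2) * g (-3))]"

definition singular_elements3 :: "complex \<Rightarrow> so7 uea list" where
  "singular_elements3 x1 =
    [1,
     (- 4) *\<^sub>C g (-4) + (- x1 - 3) *\<^sub>C (g (-3) * g (-2)) + 2 *\<^sub>C (g (-1) * g (-2)),
     (4 * x1 - 4) *\<^sub>C g (-6) + (- 8) *\<^sub>C (g (-4) * g (-1))
     + (2 * x1^2 + 6 * x1) *\<^sub>C (g (-3)^2 * g (-2))
     + (- 4 * x1 - 4) *\<^sub>C (g (-1) * g (-3) * g (-2)) + 4 *\<^sub>C (g (-1)^2 * g (-2)),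
     (- 10 * x1 - 20) *\<^sub>C (g (-4) * g (-3) * g (-2)) + 20 *\<^sub>C (g (-4) * g (-1) * g (-2))
     + (- 20) *\<^sub>C (g (-4)^2) + (- (x1^2) - 5 * x1 - 6) *\<^sub>C (g (-3)^2 * g (-2)^2)
     + (x1^2 + 5 * x1 + 6) *\<^sub>C (g (-2) * g (-3)^2 * g (-2))
     + (5 * x1 + 10) *\<^sub>C (g (-1) * g (-3) * g (-2)^2) + (- 10) *\<^sub>C (g (-1)^2 * g (-2)^2),
     (12 * x1^2 + 48 * x1 + 48) *\<^sub>C g (-9)
     + (6 * x1^2 + 24 * x1 + 24) *\<^sub>C (g (-8) * g (-2))
     + (12 * x1^2 + 60 * x1 - 168) *\<^sub>C (g (-6) * g (-4))
     + (3 * x1^3 + 24 * x1^2 - 72) *\<^sub>C (g (-6) * g (-3) * g (-2))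
     + (- 6 * x1^2 - 30 * x1 + 84) *\<^sub>C (g (-6) * g (-1) * g (-2))
     + (6 * x1^3 + 51 * x1^2 + 72 * x1 - 12) *\<^sub>C (g (-4) * g (-3)^2 * g (-2))
     + (- 18 * x1^2 - 138 * x1 - 84) *\<^sub>C (g (-4) * g (-1) * g (-3) * g (-2))
     + (24 * x1 + 168) *\<^sub>C (g (-4) * g (-1)^2 * g (-2))
     + (- 24 * x1 - 168) *\<^sub>C (g (-4)^2 * g (-1))
     + (1/2 * x1^4 + 6 * x1^3 + 41/2 * x1^2 + 21 * x1) *\<^sub>C (g (-3)^3 * g (-2)^2)
     + (- 3 * x1^3 - 57/2 * x1^2 - 54 * x1 - 18) *\<^sub>C (g (-1) * g (-3)^2 * g (-2)^2)
     + (3 * x1^2 + 18 * x1 + 24) *\<^sub>C (g (-1) * g (-2) * g (-3)^2 * g (-2))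
     + (- 12 * x1 - 84) *\<^sub>C (g (-1)^3 * g (-2)^2)
     + (9 * x1^2 + 69 * x1 + 42) *\<^sub>C (g (-1)^2 * g (-3) * g (-2)^2),
     (8 * x1^2 + 24 * x1 + 16) *\<^sub>C (g (-9) * g (-1))
     + (- 24 * x1^2 - 72 * x1 + 112) *\<^sub>C (g (-8) * g (-4))
     + (- 8 * x1^3 - 36 * x1^2 - 12 * x1 + 56) *\<^sub>C (g (-8) * g (-3) * g (-2))
     + (16 * x1^2 + 48 * x1 - 48) *\<^sub>C (g (-8) * g (-1) * g (-2))
     + (16 * x1^2 + 8 * x1 - 168) *\<^sub>C (g (-6) * g (-4) * g (-1))
     + (- 4 * x1^4 - 14 * x1^3 + 12 * x1^2 + 34 * x1 - 28) *\<^sub>C (g (-6) * g (-3)^2 * g (-2))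
     + (8 * x1^3 + 12 * x1^2 - 60 * x1 - 24) *\<^sub>C (g (-6) * g (-1) * g (-3) * g (-2))
     + (- 8 * x1^2 - 4 * x1 + 84) *\<^sub>C (g (-6) * g (-1)^2 * g (-2))
     + (- 4 * x1^3 + 28 * x1 - 56) *\<^sub>C (g (-6)^2)
     + (8 * x1^3 + 28 * x1^2 - 12 * x1 - 32) *\<^sub>C (g (-4) * g (-1) * g (-3)^2 * g (-2))
     + (16 * x1 + 56) *\<^sub>C (g (-4) * g (-1)^3 * g (-2))
     + (- 16 * x1^2 - 48 * x1 + 28) *\<^sub>C (g (-4) * g (-1)^2 * g (-3) * g (-2))
     + (- 16 * x1 - 56) *\<^sub>C (g (-4)^2 * g (-1)^2)
     + (- 1/3 * x1^5 - 5/2 * x1^4 - 5 * x1^3 + 5/6 * x1^2 + 7 * x1) *\<^sub>C (g (-3)^4 * g (-2)^2)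
     + (4/3 * x1^4 + 20/3 * x1^3 + 5 * x1^2 - 25/3 * x1 - 14/3) *\<^sub>C (g (-1) * g (-3)^3 * g (-2)^2)
     + (- 8 * x1 - 28) *\<^sub>C (g (-1)^4 * g (-2)^2)
     + (8 * x1^2 + 24 * x1 - 14) *\<^sub>C (g (-1)^3 * g (-3) * g (-2)^2)
     + (- 4 * x1^3 - 14 * x1^2 + 2 * x1 + 8) *\<^sub>C (g (-1)^2 * g (-3)^2 * g (-2)^2)
     + (4 * x1 + 8) *\<^sub>C (g (-1)^2 * g (-2) * g (-3)^2 * g (-2))]"

text \<open>At \<open>x1 \<in> {- 5, - 4}\<close> all coefficients of \<open>singular_elements4 x1 ! 6\<close> vanish, and at
  \<open>x1 \<in> {- 4, - 3}\<close> all those of \<open>singular_elements4 x1 ! 7\<close>; at \<open>x1 \<in> {- 8, - 9/2, - 2}\<close> the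
  entries 3 and 4 produce proportional vectors.  So the vectors are linearly dependent for
  these \<open>x1\<close>.\<close>

definition singular_elements4 :: "complex \<Rightarrow> so7 uea list" where
  "singular_elements4 x1 =
    [1,
     (- x1) *\<^sub>C g (-3) + g (-1),
     5 *\<^sub>C (g (-1) * g (-2)) + (- 2 * x1 - 4) *\<^sub>C (g (-3) * g (-2))
     + (x1 + 2) *\<^sub>C (g (-2) * g (-3)) + (- 5) *\<^sub>C g (-4),
     (1/6 * x1^3 + 5/3 * x1^2 + 8/3 * x1) *\<^sub>C (g (-3)^2 * g (-2))
     + (- 1/2 * x1^2 - x1) *\<^sub>C (g (-3) * g (-2) * g (-3))
     + (1/6 * x1^2 + 4/3 * x1 - 3) *\<^sub>C g (-6)
     + (2/3 * x1^2 + 10/3 * x1 - 1) *\<^sub>C (g (-4) * g (-3))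
     + (- 2/3 * x1^2 - 16/3 * x1 - 3) *\<^sub>C (g (-1) * g (-3) * g (-2))
     + (- x1 - 7) *\<^sub>C (g (-4) * g (-1)) + (x1 + 7) *\<^sub>C (g (-1)^2 * g (-2))
     + (x1 + 2) *\<^sub>C (g (-1) * g (-2) * g (-3)),
     (1/6 * x1^3 + 5/3 * x1^2 + 17/3 * x1 + 6) *\<^sub>C (g (-3) * g (-2) * g (-3))
     + (- 1/8 * x1^2 - 5/4 * x1 - 2) *\<^sub>C (g (-3)^2 * g (-2))
     + (- 1/12 * x1^2 - 2/3 * x1 - 9/4) *\<^sub>C g (-6)
     + (1/2 * x1^2 + 35/12 * x1 + 31/12) *\<^sub>C (g (-4) * g (-3))
     + (- 1/6 * x1^2 - 11/12 * x1 - 7/6) *\<^sub>C (g (-1) * g (-2) * g (-3))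
     + (- 1/6 * x1^2 - 13/12 * x1 - 1/4) *\<^sub>C (g (-1) * g (-3) * g (-2))
     + (- 1/3 * x1 - 23/12) *\<^sub>C (g (-4) * g (-1))
     + (1/3 * x1 + 23/12) *\<^sub>C (g (-1)^2 * g (-2)),
     (- (x1^4) - 9/2 * x1^3 - 3/2 * x1^2 + 7 * x1) *\<^sub>C (g (-3)^3 * g (-2))
     + (- 3 * x1^3 - 3 * x1^2 + 18 * x1 - 12) *\<^sub>C (g (-6) * g (-3))
     + (3 * x1^3 + 21/2 * x1^2 - 9/2 * x1 - 9) *\<^sub>C (g (-1) * g (-3)^2 * g (-2))
     + (- 3 * x1^2 - 15 * x1 + 18) *\<^sub>C g (-8)
     + (3 * x1^2 + 3 * x1 - 30) *\<^sub>C (g (-6) * g (-1))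
     + (6 * x1^2 + 12 * x1 - 24) *\<^sub>C (g (-4) * g (-1) * g (-3))
     + (- 6 * x1^2 - 18 * x1 + 12) *\<^sub>C (g (-1)^2 * g (-3) * g (-2))
     + (- 3 * x1^2 - 3 * x1 + 6) *\<^sub>C (g (-1) * g (-3) * g (-2) * g (-3))
     + (- 6 * x1 - 21) *\<^sub>C (g (-4) * g (-1)^2) + (6 * x1 + 21) *\<^sub>C (g (-1)^3 * g (-2))
     + (3 * x1 + 6) *\<^sub>C (g (-1)^2 * g (-2) * g (-3)),
     (1/2 * x1^4 + 29/4 * x1^3 + 153/4 * x1^2 + 173/2 * x1 + 70) *\<^sub>C (g (-3)^2 * g (-2)^2 * g (-3))
     + (1/2 * x1^3 + 11/2 * x1^2 + 19 * x1 + 20) *\<^sub>C (g (-6) * g (-2) * g (-3))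
     + (- (x1^3) - 11 * x1^2 - 38 * x1 - 40) *\<^sub>C (g (-6) * g (-3) * g (-2))
     + (- 1/6 * x1^4 - 29/12 * x1^3 - 51/4 * x1^2 - 173/6 * x1 - 70/3) *\<^sub>C (g (-2) * g (-3)^3 * g (-2))
     + (4 * x1^3 + 93/2 * x1^2 + 349/2 * x1 + 210) *\<^sub>C (g (-4) * g (-3) * g (-2) * g (-3))
     + (- 1/2 * x1^3 - 27/4 * x1^2 - 121/4 * x1 - 45) *\<^sub>C (g (-4) * g (-3)^2 * g (-2))
     + (- 2 * x1^3 - 93/4 * x1^2 - 349/4 * x1 - 105) *\<^sub>C (g (-1) * g (-3) * g (-2)^2 * g (-3))
     + (- 5/2 * x1^2 - 45/2 * x1 - 50) *\<^sub>C g (-9)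
     + (- 5/2 * x1^2 - 45/2 * x1 - 50) *\<^sub>C (g (-8) * g (-2))
     + (5 * x1^2 + 45 * x1 + 100) *\<^sub>C (g (-4)^2 * g (-3))
     + (- 5/2 * x1^2 - 45/2 * x1 - 50) *\<^sub>C (g (-6) * g (-4))
     + (5/2 * x1^2 + 45/2 * x1 + 50) *\<^sub>C (g (-6) * g (-1) * g (-2))
     + (- 5 * x1^2 - 45 * x1 - 100) *\<^sub>C (g (-4) * g (-1) * g (-2) * g (-3))
     + (1/2 * x1^3 + 27/4 * x1^2 + 121/4 * x1 + 45) *\<^sub>C (g (-1) * g (-2) * g (-3)^2 * g (-2))
     + (5/2 * x1^2 + 45/2 * x1 + 50) *\<^sub>C (g (-1)^2 * g (-2)^2 * g (-3)),
     (- 1/24 * x1^6 - 37/48 * x1^5 - 265/48 * x1^4 - 115/6 * x1^3 - 129/4 * x1^2 - 21 * x1) *\<^sub>C (g (-3)^3 * g (-2)^2 * g (-3))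
     + (- 1/4 * x1^5 - 15/4 * x1^4 - 77/4 * x1^3 - 147/4 * x1^2 - 6 * x1 + 36) *\<^sub>C (g (-6) * g (-3) * g (-2) * g (-3))
     + (1/8 * x1^5 + 15/8 * x1^4 + 10 * x1^3 + 87/4 * x1^2 + 51/4 * x1 - 9) *\<^sub>C (g (-6) * g (-3)^2 * g (-2))
     + (- 1/12 * x1^5 - 7/6 * x1^4 - 139/24 * x1^3 - 287/24 * x1^2 - 17/2 * x1) *\<^sub>C (g (-4) * g (-3)^3 * g (-2))
     + (1/8 * x1^5 + 2 * x1^4 + 187/16 * x1^3 + 487/16 * x1^2 + 33 * x1 + 9) *\<^sub>C (g (-1) * g (-3)^2 * g (-2)^2 * g (-3))
     + (- 1/4 * x1^4 - 9/4 * x1^3 - 8 * x1^2 - 33/2 * x1 - 18) *\<^sub>C (g (-9) * g (-3))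
     + (- 1/4 * x1^4 - 3 * x1^3 - 53/4 * x1^2 - 51/2 * x1 - 18) *\<^sub>C (g (-8) * g (-2) * g (-3))
     + (1/4 * x1^4 + 15/4 * x1^3 + 37/2 * x1^2 + 69/2 * x1 + 18) *\<^sub>C (g (-8) * g (-3) * g (-2))
     + (1/8 * x1^4 + 3/2 * x1^3 + 41/8 * x1^2 + 9/4 * x1 - 9) *\<^sub>C (g (-6)^2)
     + (- 1/4 * x1^4 - 11/4 * x1^3 - 7 * x1^2 + 9 * x1 + 36) *\<^sub>C (g (-6) * g (-4) * g (-3))
     + (1/4 * x1^4 + 3 * x1^3 + 21/2 * x1^2 + 25/4 * x1 - 15) *\<^sub>C (g (-6) * g (-1) * g (-2) * g (-3))
     + (- 1/4 * x1^4 - 13/4 * x1^3 - 14 * x1^2 - 43/2 * x1 - 6) *\<^sub>C (g (-6) * g (-1) * g (-3) * g (-2))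
     + (- 1/4 * x1^4 - 29/8 * x1^3 - 145/8 * x1^2 - 73/2 * x1 - 24) *\<^sub>C (g (-1)^2 * g (-3) * g (-2)^2 * g (-3))
     + (1/2 * x1^4 + 29/4 * x1^3 + 145/4 * x1^2 + 73 * x1 + 48) *\<^sub>C (g (-4) * g (-1) * g (-3) * g (-2) * g (-3))
     + (- 1/12 * x1^4 - x1^3 - 25/6 * x1^2 - 27/4 * x1 - 3) *\<^sub>C (g (-1) * g (-2) * g (-3)^3 * g (-2))
     + (- 1/2 * x1^3 - 31/4 * x1^2 - 143/4 * x1 - 51) *\<^sub>C (g (-8) * g (-1) * g (-2))
     + (1/4 * x1^3 + 23/8 * x1^2 + 87/8 * x1 + 27/2) *\<^sub>C (g (-1)^2 * g (-2) * g (-3)^2 * g (-2))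
     + (1/4 * x1^3 + 13/4 * x1^2 + 27/2 * x1 + 18) *\<^sub>C (g (-1)^3 * g (-2)^2 * g (-3))
     + (1/2 * x1^3 + 13/2 * x1^2 + 27 * x1 + 36) *\<^sub>C (g (-8) * g (-4))
     + (- 1/4 * x1^3 - 23/8 * x1^2 - 87/8 * x1 - 27/2) *\<^sub>C (g (-4) * g (-1) * g (-3)^2 * g (-2))
     + (1/4 * x1^3 + 13/4 * x1^2 + 27/2 * x1 + 18) *\<^sub>C (g (-6) * g (-1)^2 * g (-2))
     + (1/2 * x1^3 + 13/2 * x1^2 + 27 * x1 + 36) *\<^sub>C (g (-4)^2 * g (-1) * g (-3))
     + (- 1/2 * x1^3 - 13/2 * x1^2 - 27 * x1 - 36) *\<^sub>C (g (-4) * g (-1)^2 * g (-2) * g (-3))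
     + (- 1/4 * x1^3 - 13/4 * x1^2 - 27/2 * x1 - 18) *\<^sub>C (g (-6) * g (-4) * g (-1))
     + (- 5/4 * x1^2 - 35/4 * x1 - 15) *\<^sub>C (g (-9) * g (-1))]"

text \<open>At \<open>x1 = - 4\<close> all coefficients of the entries 3 and 5 below vanish, and at \<open>x1 = - 3\<close> all
  those of the entries 4 and 5.\<close>

definition singular_elements5 :: "complex \<Rightarrow> so7 uea list" where
  "singular_elements5 x1 =
    [1,
     (- x1) *\<^sub>C g (-3) + 2 *\<^sub>C g (-1),
     (2 * x1^2 - 2 * x1) *\<^sub>C (g (-3)^2) + (- 4 * x1 + 4) *\<^sub>C (g (-1) * g (-3))
     + 4 *\<^sub>C (g (-1)^2),
     (- 2 * x1 - 8) *\<^sub>C g (-6) + (2 * x1 + 8) *\<^sub>C (g (-4) * g (-3))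
     + (2 * x1^2 + 14 * x1 + 24) *\<^sub>C (g (-3) * g (-2) * g (-3))
     + (- (x1^2) - 7 * x1 - 12) *\<^sub>C (g (-2) * g (-3)^2)
     + (- 2 * x1 - 8) *\<^sub>C (g (-1) * g (-2) * g (-3)),
     (- (x1^2) - 10 * x1 - 21) *\<^sub>C g (-8)
     + (- 1/2 * x1^3 - 7/2 * x1^2 - 15/2 * x1 - 9/2) *\<^sub>C (g (-6) * g (-3))
     + (x1^2 + 7 * x1 + 12) *\<^sub>C (g (-6) * g (-1))
     + (x1^3 + 13/2 * x1^2 + 10 * x1 - 3/2) *\<^sub>C (g (-4) * g (-3)^2)
     + (- (x1^2) - 7 * x1 - 12) *\<^sub>C (g (-4) * g (-1) * g (-3))
     + (1/2 * x1^4 + 5 * x1^3 + 33/2 * x1^2 + 18 * x1) *\<^sub>C (g (-3)^2 * g (-2) * g (-3))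
     + (- (x1^3) - 19/2 * x1^2 - 28 * x1 - 51/2) *\<^sub>C (g (-1) * g (-3) * g (-2) * g (-3))
     + (3/2 * x1^2 + 9 * x1 + 27/2) *\<^sub>C (g (-1) * g (-2) * g (-3)^2)
     + (x1^2 + 7 * x1 + 12) *\<^sub>C (g (-1)^2 * g (-2) * g (-3)),
     (4/3 * x1^3 + 38/3 * x1^2 + 118/3 * x1 + 40) *\<^sub>C (g (-9) * g (-3))
     + (- 4/3 * x1^2 - 28/3 * x1 - 16) *\<^sub>C (g (-9) * g (-1))
     + (- 4/3 * x1^2 - 28/3 * x1 - 16) *\<^sub>C (g (-8) * g (-4))
     + (4/3 * x1^3 + 38/3 * x1^2 + 118/3 * x1 + 40) *\<^sub>C (g (-8) * g (-2) * g (-3))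
     + (4/3 * x1^3 + 14 * x1^2 + 146/3 * x1 + 56) *\<^sub>C (g (-6) * g (-4) * g (-3))
     + (4/3 * x1^4 + 18 * x1^3 + 90 * x1^2 + 592/3 * x1 + 160) *\<^sub>C (g (-6) * g (-3) * g (-2) * g (-3))
     + (- 2/3 * x1^4 - 9 * x1^3 - 45 * x1^2 - 296/3 * x1 - 80) *\<^sub>C (g (-6) * g (-2) * g (-3)^2)
     + (- 4/3 * x1^3 - 14 * x1^2 - 146/3 * x1 - 56) *\<^sub>C (g (-6) * g (-1) * g (-2) * g (-3))
     + (- 2/3 * x1^3 - 22/3 * x1^2 - 80/3 * x1 - 32) *\<^sub>C (g (-6)^2)
     + (- 4/3 * x1^4 - 52/3 * x1^3 - 251/3 * x1^2 - 533/3 * x1 - 140) *\<^sub>C (g (-4) * g (-3)^2 * g (-2) * g (-3))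
     + (4/3 * x1^3 + 14 * x1^2 + 146/3 * x1 + 56) *\<^sub>C (g (-4) * g (-1) * g (-2) * g (-3)^2)
     + (- 4/3 * x1^3 - 14 * x1^2 - 146/3 * x1 - 56) *\<^sub>C (g (-4)^2 * g (-3)^2)
     + (- 1/3 * x1^5 - 11/2 * x1^4 - 36 * x1^3 - 701/6 * x1^2 - 188 * x1 - 120) *\<^sub>C (g (-3)^2 * g (-2)^2 * g (-3)^2)
     + (2/3 * x1^4 + 26/3 * x1^3 + 251/6 * x1^2 + 533/6 * x1 + 70) *\<^sub>C (g (-1) * g (-3) * g (-2)^2 * g (-3)^2)
     + (- 2/3 * x1^3 - 7 * x1^2 - 73/3 * x1 - 28) *\<^sub>C (g (-1)^2 * g (-2)^2 * g (-3)^2)]"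

end

theory Submission
  imports Defs "HOL-Library.Multiset"
begin

text \<open>The root vectors of weight \<open>\<epsilon>\<^sub>i - \<epsilon>\<^sub>1\<close> span an abelian
    subalgebra complementary to the parabolic
  subalgebra, so the induced module is the space of \<open>V\<close>-valued polynomials in five variables, on which
  \<open>so(7)\<close> acts by differential operators of order at most two.  In the irreducible module \<open>V\<close> a
  vector of lower weight killed by the raising operators is zero; this determines the matrices of
  the Levi part on \<open>V\<close> from their commutators with the raising operators.  Singularity and the weights
  of the vectors then are identities between integer polynomials in \<open>x1\<close>, checked by
  computation.  The vectors have different \<open>G\<^sub>2\<close>-weights (with one exception, a pair), so their
  independence only needs some nonzero coefficient of each.  Each generated submodule lies in one
  eigenspace of the Casimir element of \<open>G\<^sub>2\<close>, and the excluded \<open>x1\<close> are those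
      at which two of
  the eigenvalues agree.\<close>

section \<open>The Lie algebra so(7) in terms of its root vectors\<close>

text \<open>Two opposite needs shape the proof. Singularity and weights are relations and only
  require that the tensor relations hold in the induced module; independence requires that nothing
  beyond them holds, and for this one homomorphism from the induced module to the polynomials is
  enough. Neither V nor x1 is concrete: V is known only through irreducibility and its highest
  weight, and x1 is any complex number. On V, however, x1 enters only through the coroot of the
  simple root outside the Levi part, which acts on each weight vector by x1 plus an integer. Hence a
  fixed integer table describes V for all x1 at once, and the computations stay in integer
  polynomials in x1.

  The Casimir element has to be that of G2: the one of so(7) acts by one scalar on the whole module.
  On a singular vector whose simple coroots have the values x1 + p and q, its eigenvalue is
  quadratic in x1 with a leading term independent of p and q. Two eigenvalues therefore differ by a
  polynomial of degree at most one, and each pair of vectors excludes at most one x1.\<close>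

lemma UNIV_7: "(UNIV :: 7 set) = {1, 2, 3, 0, - 1, - 2, - 3}"
  by (rule sym, rule card_subset_eq) simp_all

lemma forall_7: "(\<forall>i::7. P i) \<longleftrightarrow> P 1 \<and> P 2 \<and> P 3 \<and> P 0 \<and> P (- 1)
    \<and> P (- 2) \<and> P (- 3)"
proof -
  have "(\<forall>i::7. P i) \<longleftrightarrow> (\<forall>i\<in>UNIV. P i)" by simp
  then show ?thesis unfolding UNIV_7 by simp
qed

lemma mat_unit_mult: "mat_unit i j ** mat_unit k l = (if j = k then mat_unit i l else 0)"
proof -
  have "(mat_unit i j ** mat_unit k l) $ a $ b = (if j = k then mat_unit i l else 0) $ a $ b" for a b
  proof -
    have "(mat_unit i j ** mat_unit k l) $ a $ b
        = (\<Sum>m\<in>UNIV. if m = j then (if a = i \<and> j = k \<and> b = l then 1 else 0) else 0)"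
      unfolding matrix_matrix_mult_def mat_unit_def vec_lambda_beta by (intro sum.cong) auto
    then show ?thesis by (simp add: mat_unit_def)
  qed
  then show ?thesis by (simp add: vec_eq_iff)
qed

lemma mat_mult_diff: "(A :: complex^7^7) ** (B - C) = A ** B - A ** C" "(B - C) ** A = B ** A - C ** A"
  by (simp_all add: matrix_matrix_mult_def vec_eq_iff sum_subtractf algebra_simps)

text \<open>The eight products of matrix units combine in pairs into four skew units. The tables of
  structure constants below rest on this formula.\<close>

lemma lie_skew_unit:
  "lie (skew_unit i j) (skew_unit k l) =
     (if j = k then skew_unit i l else 0) - (if i = l then skew_unit k j else 0)
     - (if j = - l then skew_unit i (- k) else 0) + (if i = - k then skew_unit (- l) j else 0)"
proof -
  \<comment> \<open>Each index condition produced by the products is brought into the orientation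
    used on the right-hand side.\<close>
  have eqs: "(- i = k) = (i = - k)" "(- i = - l) = (i = l)" "(l = i) = (i = l)" "(l = - j) = (j = - l)"
    "(- k = i) = (i = - k)" "(- k = - j) = (j = k)"
    by auto
  show ?thesis
    unfolding Rep_so7_inject[symmetric] lie_so7.rep_eq skew_unit.rep_eq plus_so7.rep_eq minus_so7.rep_eq
      if_distrib[of Rep_so7] zero_so7.rep_eq mat_mult_diff mat_unit_mult eqs minus_minus
    by auto
qed

lemma skew_unit_swap: "skew_unit (- j) (- i) = - skew_unit i j"
  by transfer simp

lemma sqrt2_sq: "complex_of_real (sqrt 2) * complex_of_real (sqrt 2) = 2"
  by (metis of_real_mult of_real_numeral real_sqrt_mult_self abs_numeral)

lemma Rep_skew_unit: "Rep_so7 (skew_unit i j) $ k $ l =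
   (if k = i \<and> l = j then 1 else 0) - (if k = - j \<and> l = - i then 1 else 0)"
  by (simp add: skew_unit.rep_eq mat_unit_def)

text \<open>This is the defining skewness, tested on the basis vectors with indices \<open>j\<close>
  and \<open>- i\<close>.\<close>

lemma so7_entry: "Rep_so7 x $ (- j) $ (- i) = - Rep_so7 x $ i $ j"
proof -
  have m: "(Rep_so7 x *v axis j 1) $ k = Rep_so7 x $ k $ j" for j k
    by (simp add: matrix_vector_mult_def axis_def if_distrib cong: if_cong)
  have l: "so7_form v (axis k 1) = v $ (- k)" for v k
  proof -
    have "so7_form v (axis k 1) = (\<Sum>i\<in>UNIV. if i = - k then v $ i else 0)"
      unfolding so7_form_def axis_def by (intro sum.cong) (auto simp: minus_equation_iff)
    then show ?thesis by simp
  qed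
  have r: "so7_form (axis k 1) v = v $ (- k)" for v k
  proof -
    have "so7_form (axis k 1) v = (\<Sum>i\<in>UNIV. if i = k then v $ (- i) else 0)"
      unfolding so7_form_def axis_def by (intro sum.cong) auto
    then show ?thesis by simp
  qed
  have "so7_form (Rep_so7 x *v axis j 1) (axis (- i) 1) + so7_form (axis j 1) (Rep_so7 x *v axis (- i) 1) = 0"
    using Rep_so7[of x] by (simp add: so7_matrices_def)
  then show ?thesis by (simp add: m l r add_eq_0_iff)
qed

lemma skew_unit_anti_diag: "skew_unit i (- i) = 0"
  by transfer simp

text \<open>Of \<open>skew_unit i j\<close> and \<open>- skew_unit (- j) (- i)\<close> one is kept
  for each pair; the general swap rule would loop as a rewrite rule. Those kept are the ones in the
  root vectors and \<open>skew_unit i i\<close> for i = 1, 2, 3.\<close>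

lemma skew_unit_normalize:
  "skew_unit 1 (- 1) = 0"
  "skew_unit 2 (- 1) = - skew_unit 1 (- 2)"
  "skew_unit 2 (- 2) = 0"
  "skew_unit 3 (- 1) = - skew_unit 1 (- 3)"
  "skew_unit 3 (- 2) = - skew_unit 2 (- 3)"
  "skew_unit 3 (- 3) = 0"
  "skew_unit 0 1 = - skew_unit (- 1) 0"
  "skew_unit 0 2 = - skew_unit (- 2) 0"
  "skew_unit 0 3 = - skew_unit (- 3) 0"
  "skew_unit 0 0 = 0"
  "skew_unit 0 (- 1) = - skew_unit 1 0"
  "skew_unit 0 (- 2) = - skew_unit 2 0"
  "skew_unit 0 (- 3) = - skew_unit 3 0"
  "skew_unit (- 1) 1 = 0"
  "skew_unit (- 1) (- 1) = - skew_unit 1 1"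
  "skew_unit (- 1) (- 2) = - skew_unit 2 1"
  "skew_unit (- 1) (- 3) = - skew_unit 3 1"
  "skew_unit (- 2) 1 = - skew_unit (- 1) 2"
  "skew_unit (- 2) 2 = 0"
  "skew_unit (- 2) (- 1) = - skew_unit 1 2"
  "skew_unit (- 2) (- 2) = - skew_unit 2 2"
  "skew_unit (- 2) (- 3) = - skew_unit 3 2"
  "skew_unit (- 3) 1 = - skew_unit (- 1) 3"
  "skew_unit (- 3) 2 = - skew_unit (- 2) 3"
  "skew_unit (- 3) 3 = 0"
  "skew_unit (- 3) (- 1) = - skew_unit 1 3"
  "skew_unit (- 3) (- 2) = - skew_unit 2 3"
  "skew_unit (- 3) (- 3) = - skew_unit 3 3"
  using skew_unit_swap skew_unit_anti_diag by (metis minus_minus neg_0_equal_iff_equal minus_zero)+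

lemma scaleC_two: "2 *\<^sub>C x = x + x" for x :: "'a::complex_vector"
  using scaleC_add_left[of 1 1 x] by (simp add: scaleC_one)

lemma lie_zero [simp]: "lie 0 x = 0" "lie x 0 = 0" for x :: "'a::complex_lie_algebra"
  using lie_scaleC_left[of 0 0 x] lie_scaleC_right[of x 0 0] by simp_all

lemma lie_minus: "lie (- x) y = - lie x y" "lie x (- y) = - lie x y" for x y :: "'a::complex_lie_algebra"
  using lie_add_left[of "- x" x y] lie_add_right[of x "- y" y] by (simp_all add: eq_neg_iff_add_eq_0)

lemma lie_diff: "lie (x - y) z = lie x z - lie y z" "lie z (x - y) = lie z x - lie z y"
  for x y z :: "'a::complex_lie_algebra"
  using lie_add_left[of x "- y" z] lie_add_right[of z x "- y"] by (simp_all add: lie_minus)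

lemmas lie_linear = lie_add_left lie_add_right lie_minus lie_diff lie_scaleC_left lie_scaleC_right

text \<open>The indices 11, 12, 13 stand for the coroots of the simple roots.\<close>

definition op_vector :: "int \<Rightarrow> so7" where
  "op_vector k = (if k > 10 then lie (root_vector (k - 10)) (root_vector (10 - k)) else root_vector k)"

abbreviation (input) "sqrt2 \<equiv> complex_of_real (sqrt 2)"

lemma root_vector_simps:
  "root_vector 1 = skew_unit 1 2"
  "root_vector 2 = skew_unit 2 3"
  "root_vector 3 = sqrt2 *\<^sub>C skew_unit 3 0"
  "root_vector 4 = skew_unit 1 3"
  "root_vector 5 = sqrt2 *\<^sub>C skew_unit 2 0"
  "root_vector 6 = sqrt2 *\<^sub>C skew_unit 1 0"
  "root_vector 7 = skew_unit 2 (- 3)"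
  "root_vector 8 = skew_unit 1 (- 3)"
  "root_vector 9 = skew_unit 1 (- 2)"
  "root_vector (- 1) = skew_unit 2 1"
  "root_vector (- 2) = skew_unit 3 2"
  "root_vector (- 3) = - sqrt2 *\<^sub>C skew_unit (- 3) 0"
  "root_vector (- 4) = skew_unit 3 1"
  "root_vector (- 5) = - sqrt2 *\<^sub>C skew_unit (- 2) 0"
  "root_vector (- 6) = - sqrt2 *\<^sub>C skew_unit (- 1) 0"
  "root_vector (- 7) = - skew_unit (- 2) 3"
  "root_vector (- 8) = - skew_unit (- 1) 3"
  "root_vector (- 9) = - skew_unit (- 1) 2"
  by (simp_all add: root_vector_def)

lemma coroot_simps:
  "op_vector 11 = skew_unit 1 1 - skew_unit 2 2"
  "op_vector 12 = skew_unit 2 2 - skew_unit 3 3"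
  "op_vector 13 = 2 *\<^sub>C skew_unit 3 3"
  by (simp_all add: op_vector_def root_vector_simps lie_skew_unit skew_unit_normalize
    lie_linear scaleC_scaleC sqrt2_sq)

lemma op_vector_root: "k \<le> 10 \<Longrightarrow> op_vector k = root_vector k"
  by (simp add: op_vector_def)

definition root_index :: "int \<Rightarrow> 7 \<times> 7" where
  "root_index k =
    (if k = 1 then (1, 2) else if k = - 1 then (2, 1)
     else if k = 2 then (2, 3) else if k = - 2 then (3, 2)
     else if k = 3 then (3, 0) else if k = - 3 then (- 3, 0)
     else if k = 4 then (1, 3) else if k = - 4 then (3, 1)
     else if k = 5 then (2, 0) else if k = - 5 then (- 2, 0)
     else if k = 6 then (1, 0) else if k = - 6 then (- 1, 0)
     else if k = 7 then (2, - 3) else if k = - 7 then (- 2, 3)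
     else if k = 8 then (1, - 3) else if k = - 8 then (- 1, 3)
     else if k = 9 then (1, - 2) else if k = - 9 then (- 1, 2)
     else (0, 0))"

definition root_scale :: "int \<Rightarrow> complex" where
  "root_scale k =
    (if k = 3 \<or> k = 5 \<or> k = 6 then complex_of_real (sqrt 2)
     else if k = - 3 \<or> k = - 5 \<or> k = - 6 then - complex_of_real (sqrt 2)
     else if k = - 7 \<or> k = - 8 \<or> k = - 9 then - 1 else 1)"

text \<open>At the position \<open>root_index k\<close> the root vector \<open>k\<close> has the
  entry \<open>root_scale k\<close>, while the other root vectors and the diagonal matrices have 0
  there; so a single matrix entry gives the coordinate.\<close>

definition root_coord :: "int \<Rightarrow> so7 \<Rightarrow> complex" where
  "root_coord k x = Rep_so7 x $ fst (root_index k) $ snd (root_index k) / root_scale k"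

definition root_weight :: "int \<Rightarrow> so7 \<Rightarrow> complex" where
  "root_weight k h = \<epsilon> (fst (root_index k)) h - \<epsilon> (snd (root_index k)) h"

definition root_indices :: "int set" where
  "root_indices = {1, 2, 3, 4, 5, 6, 7, 8, 9, - 1, - 2, - 3, - 4, - 5, - 6, - 7, - 8, - 9}"

lemma root_vector_eq: "k \<in> root_indices \<Longrightarrow>
  root_vector k = root_scale k *\<^sub>C skew_unit (fst (root_index k)) (snd (root_index k))"
  by (auto simp: root_indices_def root_vector_simps root_scale_def root_index_def scaleC_one)

lemma root_scale_nonzero: "root_scale k \<noteq> 0"
  by (simp add: root_scale_def)

lemma so7_entry_anti_diag:
  "Rep_so7 x $ i $ (- i) = 0"
proof -
  have "Rep_so7 x $ i $ (- i) = - Rep_so7 x $ i $ (- i)" using so7_entry[of x "- i" i] by simp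
  then show ?thesis by simp
qed

lemma so7_entry_normalize:
  "Rep_so7 x $ 1 $ (- 1) = 0"
  "Rep_so7 x $ 2 $ (- 1) = - Rep_so7 x $ 1 $ (- 2)"
  "Rep_so7 x $ 2 $ (- 2) = 0"
  "Rep_so7 x $ 3 $ (- 1) = - Rep_so7 x $ 1 $ (- 3)"
  "Rep_so7 x $ 3 $ (- 2) = - Rep_so7 x $ 2 $ (- 3)"
  "Rep_so7 x $ 3 $ (- 3) = 0"
  "Rep_so7 x $ 0 $ 1 = - Rep_so7 x $ (- 1) $ 0"
  "Rep_so7 x $ 0 $ 2 = - Rep_so7 x $ (- 2) $ 0"
  "Rep_so7 x $ 0 $ 3 = - Rep_so7 x $ (- 3) $ 0"
  "Rep_so7 x $ 0 $ 0 = 0"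
  "Rep_so7 x $ 0 $ (- 1) = - Rep_so7 x $ 1 $ 0"
  "Rep_so7 x $ 0 $ (- 2) = - Rep_so7 x $ 2 $ 0"
  "Rep_so7 x $ 0 $ (- 3) = - Rep_so7 x $ 3 $ 0"
  "Rep_so7 x $ (- 1) $ 1 = 0"
  "Rep_so7 x $ (- 1) $ (- 1) = - Rep_so7 x $ 1 $ 1"
  "Rep_so7 x $ (- 1) $ (- 2) = - Rep_so7 x $ 2 $ 1"
  "Rep_so7 x $ (- 1) $ (- 3) = - Rep_so7 x $ 3 $ 1"
  "Rep_so7 x $ (- 2) $ 1 = - Rep_so7 x $ (- 1) $ 2"
  "Rep_so7 x $ (- 2) $ 2 = 0"
  "Rep_so7 x $ (- 2) $ (- 1) = - Rep_so7 x $ 1 $ 2"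
  "Rep_so7 x $ (- 2) $ (- 2) = - Rep_so7 x $ 2 $ 2"
  "Rep_so7 x $ (- 2) $ (- 3) = - Rep_so7 x $ 3 $ 2"
  "Rep_so7 x $ (- 3) $ 1 = - Rep_so7 x $ (- 1) $ 3"
  "Rep_so7 x $ (- 3) $ 2 = - Rep_so7 x $ (- 2) $ 3"
  "Rep_so7 x $ (- 3) $ 3 = 0"
  "Rep_so7 x $ (- 3) $ (- 1) = - Rep_so7 x $ 1 $ 3"
  "Rep_so7 x $ (- 3) $ (- 2) = - Rep_so7 x $ 2 $ 3"
  "Rep_so7 x $ (- 3) $ (- 3) = - Rep_so7 x $ 3 $ 3"
  using so7_entry[of x] so7_entry_anti_diag[of x] by (metis minus_minus minus_zero)+

lemma lie_cartan_skew_unit: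
  assumes "h \<in> cartan"
  shows "lie h (skew_unit i j) = (\<epsilon> i h - \<epsilon> j h) *\<^sub>C skew_unit i j"
proof -
  define A where "A = Rep_so7 h"
  have d: "A $ k $ l = (if k = l then \<epsilon> k h else 0)" for k l
    using assms by (auto simp: cartan_def A_def \<epsilon>_def)
  have l: "A ** mat_unit i j = mscale (\<epsilon> i h) (mat_unit i j)" for i j
  proof -
    have "(A ** mat_unit i j) $ a $ b = (\<Sum>k\<in>UNIV. if k = a then (if a = i \<and> b = j then \<epsilon>
        i h else 0) else 0)" for a b
      unfolding matrix_matrix_mult_def mat_unit_def vec_lambda_beta d by (intro sum.cong) auto
    then show ?thesis by (simp add: vec_eq_iff mscale_def mat_unit_def)
  qed
  have r: "mat_unit i j ** A = mscale (\<epsilon> j h) (mat_unit i j)" for i j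
  proof -
    have "(mat_unit i j ** A) $ a $ b = (\<Sum>k\<in>UNIV. if k = b then (if a = i \<and> b = j then \<epsilon>
        j h else 0) else 0)" for a b
      unfolding matrix_matrix_mult_def mat_unit_def vec_lambda_beta d by (intro sum.cong) auto
    then show ?thesis by (simp add: vec_eq_iff mscale_def mat_unit_def)
  qed
  have m: "\<epsilon> (- k) h = - \<epsilon> k h" for k using so7_entry[of h k k] by (simp add: \<epsilon>_def)
  show ?thesis
    unfolding Rep_so7_inject[symmetric] lie_so7.rep_eq skew_unit.rep_eq scaleC_so7.rep_eq mat_mult_diff
    unfolding A_def[symmetric] l r by (simp add: vec_eq_iff mscale_def mat_unit_def m)
qed

lemma lie_cartan_root_vector:
  assumes "h \<in> cartan" "k \<in> root_indices"
  shows "lie h (root_vector k) = root_weight k h *\<^sub>C root_vector k"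
  by (simp add: root_vector_eq[OF assms(2)] lie_scaleC_right lie_cartan_skew_unit[OF assms(1)]
      root_weight_def scaleC_scaleC mult.commute)

lemma root_index_simps:
  "root_index 1 = (1, 2)"
  "root_index 2 = (2, 3)"
  "root_index 3 = (3, 0)"
  "root_index 4 = (1, 3)"
  "root_index 5 = (2, 0)"
  "root_index 6 = (1, 0)"
  "root_index 7 = (2, (- 3))"
  "root_index 8 = (1, (- 3))"
  "root_index 9 = (1, (- 2))"
  "root_index (- 1) = (2, 1)"
  "root_index (- 2) = (3, 2)"
  "root_index (- 3) = ((- 3), 0)"
  "root_index (- 4) = (3, 1)"
  "root_index (- 5) = ((- 2), 0)"
  "root_index (- 6) = ((- 1), 0)"
  "root_index (- 7) = ((- 2), 3)"
  "root_index (- 8) = ((- 1), 3)"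
  "root_index (- 9) = ((- 1), 2)"
  by (simp_all add: root_index_def)

lemma neq_7:
  "1 \<noteq> (2 :: 7)" "1 \<noteq> (3 :: 7)" "1 \<noteq> (0 :: 7)" "1 \<noteq> ((- 1) :: 7)" "1 \<noteq> ((-
      2) :: 7)" "1 \<noteq> ((- 3) :: 7)"
  "2 \<noteq> (1 :: 7)" "2 \<noteq> (3 :: 7)" "2 \<noteq> (0 :: 7)" "2 \<noteq> ((- 1) :: 7)" "2 \<noteq> ((-
      2) :: 7)" "2 \<noteq> ((- 3) :: 7)"
  "3 \<noteq> (1 :: 7)" "3 \<noteq> (2 :: 7)" "3 \<noteq> (0 :: 7)" "3 \<noteq> ((- 1) :: 7)" "3 \<noteq> ((-
      2) :: 7)" "3 \<noteq> ((- 3) :: 7)"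
  "0 \<noteq> (1 :: 7)" "0 \<noteq> (2 :: 7)" "0 \<noteq> (3 :: 7)" "0 \<noteq> ((- 1) :: 7)" "0 \<noteq> ((-
      2) :: 7)" "0 \<noteq> ((- 3) :: 7)"
  "(- 1) \<noteq> (1 :: 7)" "(- 1) \<noteq> (2 :: 7)" "(- 1) \<noteq> (3 :: 7)" "(- 1) \<noteq> (0 :: 7)" "(-
      1) \<noteq> ((- 2) :: 7)" "(- 1) \<noteq> ((- 3) :: 7)"
  "(- 2) \<noteq> (1 :: 7)" "(- 2) \<noteq> (2 :: 7)" "(- 2) \<noteq> (3 :: 7)" "(- 2) \<noteq> (0 :: 7)" "(-
      2) \<noteq> ((- 1) :: 7)" "(- 2) \<noteq> ((- 3) :: 7)"
  "(- 3) \<noteq> (1 :: 7)" "(- 3) \<noteq> (2 :: 7)" "(- 3) \<noteq> (3 :: 7)" "(- 3) \<noteq> (0 :: 7)" "(-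
      3) \<noteq> ((- 1) :: 7)" "(- 3) \<noteq> ((- 2) :: 7)"
  by simp_all

definition cartan_part :: "so7 \<Rightarrow> so7" where
  "cartan_part x = \<epsilon> 1 x *\<^sub>C skew_unit 1 1 + \<epsilon> 2 x *\<^sub>C skew_unit 2 2 + \<epsilon>
      3 x *\<^sub>C skew_unit 3 3"

lemma Rep_so7_sum: "Rep_so7 (sum f A) = (\<Sum>a\<in>A. Rep_so7 (f a))"
  by (induction A rule: infinite_finite_induct) (simp_all add: zero_so7.rep_eq plus_so7.rep_eq)

lemma root_coord_linear:
  "root_coord k (x + y) = root_coord k x + root_coord k y"
  "root_coord k (x - y) = root_coord k x - root_coord k y"
  "root_coord k (c *\<^sub>C x) = c * root_coord k x"
  "root_coord k 0 = 0"
  by (simp_all add: root_coord_def plus_so7.rep_eq minus_so7.rep_eq zero_so7.rep_eq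
      scaleC_so7.rep_eq mscale_def add_divide_distrib diff_divide_distrib)

lemma root_coord_root_vector:
  assumes "k \<in> root_indices" "l \<in> root_indices"
  shows "root_coord k (root_vector l) = (if k = l then 1 else 0)"
proof -
  have "root_coord k (root_vector l) = root_scale l * (Rep_so7 (skew_unit (fst (root_index l)) (snd (root_index l)))
    $ fst (root_index k) $ snd (root_index k)) / root_scale k"
    using assms by (simp add: root_coord_def root_vector_eq scaleC_so7.rep_eq mscale_def)
  moreover have "\<forall>k\<in>root_indices. \<forall>l\<in>root_indices. Rep_so7 (skew_unit (fst (root_index
      l)) (snd (root_index l)))
    $ fst (root_index k) $ snd (root_index k) = (if k = l then 1 else 0)"
    unfolding root_indices_def ball_simps root_index_simps fst_conv snd_conv Rep_skew_unit
    by (simp add: neq_7)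
  ultimately show ?thesis using assms by (simp add: root_scale_nonzero)
qed

lemma cartan_skew_unit: "skew_unit i i \<in> cartan"
  by (auto simp: cartan_def Rep_skew_unit)

lemma root_coord_cartan:
  assumes "h \<in> cartan" "k \<in> root_indices"
  shows "root_coord k h = 0"
proof -
  have "fst (root_index k) \<noteq> snd (root_index k)"
    using assms(2) by (auto simp: root_indices_def root_index_simps)
  then show ?thesis using assms(1) by (simp add: root_coord_def cartan_def)
qed

lemma subspace_cartan: "cvec.subspace cartan"
  by (auto simp: cvec.subspace_def cartan_def zero_so7.rep_eq plus_so7.rep_eq scaleC_so7.rep_eq mscale_def)

lemma cartan_part_cartan: "cartan_part x \<in> cartan"
  unfolding cartan_part_def
  by (intro cvec.subspace_add[OF subspace_cartan] cvec.subspace_scale[OF subspace_cartan] cartan_skew_unit)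

lemma \<epsilon>_minus: "\<epsilon> (- i) x = - \<epsilon> i x"
  using so7_entry[of x i i] by (simp add: \<epsilon>_def)

lemma \<epsilon>_zero: "\<epsilon> 0 x = 0"
  using \<epsilon>_minus[of 0 x] by simp

lemma root_coord_lie_cartan:
  assumes "h \<in> cartan"
  shows "root_coord k (lie h x) = root_weight k h * root_coord k x"
proof -
  have d: "Rep_so7 h $ i $ j = (if i = j then \<epsilon> i h else 0)" for i j
    using assms by (simp add: cartan_def \<epsilon>_def)
  have l: "(Rep_so7 h ** Rep_so7 x) $ i $ j = \<epsilon> i h * Rep_so7 x $ i $ j" for i j
  proof -
    have "(Rep_so7 h ** Rep_so7 x) $ i $ j = (\<Sum>k\<in>UNIV. if k = i then \<epsilon> i h * Rep_so7 x $ i $ j else 0)"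
      unfolding matrix_matrix_mult_def vec_lambda_beta d by (intro sum.cong) auto
    then show ?thesis by simp
  qed
  have r: "(Rep_so7 x ** Rep_so7 h) $ i $ j = \<epsilon> j h * Rep_so7 x $ i $ j" for i j
  proof -
    have "(Rep_so7 x ** Rep_so7 h) $ i $ j = (\<Sum>k\<in>UNIV. if k = j then \<epsilon> j h * Rep_so7 x $ i $ j else 0)"
      unfolding matrix_matrix_mult_def vec_lambda_beta d by (intro sum.cong) auto
    then show ?thesis by simp
  qed
  show ?thesis by (simp add: root_coord_def lie_so7.rep_eq l r root_weight_def algebra_simps)
qed

text \<open>An element of so(7) is determined by 21 entries, one for each of the 18 roots and three
  on the diagonal; \<open>so7_entry_normalize\<close> expresses the other entries through
  them.\<close>

lemma so7_eq_0I:
  assumes "\<And>k. k \<in> root_indices \<Longrightarrow> root_coord k x = 0" "\<epsilon> 1 x = 0" "\<epsilon>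
      2 x = 0" "\<epsilon> 3 x = 0"
  shows "x = 0"
proof -
  have "\<forall>k\<in>root_indices. Rep_so7 x $ fst (root_index k) $ snd (root_index k) = 0"
    using assms(1) by (simp add: root_coord_def root_scale_nonzero)
  then have "\<forall>i j. Rep_so7 x $ i $ j = 0"
    using assms(2-4) unfolding forall_7 by (simp add: root_indices_def root_index_simps so7_entry_normalize \<epsilon>_def)
  then show ?thesis by (simp add: Rep_so7_inject[symmetric] zero_so7.rep_eq vec_eq_iff)
qed

lemma \<epsilon>_linear:
  "\<epsilon> i (x + y) = \<epsilon> i x + \<epsilon> i y" "\<epsilon> i (x - y) = \<epsilon> i x - \<epsilon>
      i y" "\<epsilon> i (c *\<^sub>C x) = c * \<epsilon> i x"
  "\<epsilon> i (sum f A) = (\<Sum>a\<in>A. \<epsilon> i (f a))"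
  by (simp_all add: \<epsilon>_def plus_so7.rep_eq minus_so7.rep_eq scaleC_so7.rep_eq mscale_def Rep_so7_sum)

lemma \<epsilon>_root_vector:
  assumes "k \<in> root_indices" shows "\<epsilon> i (root_vector k) = 0"
proof -
  have "fst (root_index k) \<noteq> snd (root_index k)"
    using assms by (auto simp: root_indices_def root_index_simps)
  then show ?thesis using root_vector_eq[OF assms]
    by (auto simp: \<epsilon>_linear \<epsilon>_def Rep_skew_unit scaleC_so7.rep_eq mscale_def)
qed

lemma so7_decompose: "x = cartan_part x + (\<Sum>k\<in>root_indices. root_coord k x *\<^sub>C root_vector k)"
proof -
  have fin: "finite root_indices" by (simp add: root_indices_def)
  let ?y = "x - (cartan_part x + (\<Sum>k\<in>root_indices. root_coord k x *\<^sub>C root_vector k))"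
  have "?y = 0"
  proof (rule so7_eq_0I)
    have e: "\<epsilon> i (skew_unit j j) = (if i = j then 1 else 0) - (if i = - j then 1 else 0)" for i j
      by (simp add: \<epsilon>_def Rep_skew_unit)
    have z: "(\<Sum>k\<in>root_indices. root_coord k x * \<epsilon> i (root_vector k)) = 0" for i
      by (simp add: \<epsilon>_root_vector)
    show "\<epsilon> 1 ?y = 0" "\<epsilon> 2 ?y = 0" "\<epsilon> 3 ?y = 0"
      by (simp_all add: \<epsilon>_linear cartan_part_def e z)
    fix k assume k: "k \<in> root_indices"
    have "root_coord k (\<Sum>l\<in>root_indices. root_coord l x *\<^sub>C root_vector l)
        = (\<Sum>l\<in>root_indices. root_coord l x * root_coord k (root_vector l))"
      using sum_comp_morphism[of "root_coord k" "\<lambda>l. root_coord l x *\<^sub>C root_vector l" root_indices]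
      by (simp add: root_coord_linear o_def)
    also have "\<dots> = (\<Sum>l\<in>root_indices. if l = k then root_coord k x else 0)"
      by (intro sum.cong) (auto simp: root_coord_root_vector k)
    also have "\<dots> = root_coord k x" using k fin by simp
    finally show "root_coord k ?y = 0"
      by (simp add: root_coord_linear root_coord_cartan[OF cartan_part_cartan k])
  qed
  then show ?thesis by simp
qed

text \<open>Root spaces are defined by eigenvalues alone. This turns membership into a condition on
  coordinates: only roots that agree with \<alpha> on the Cartan subalgebra can contribute.\<close>

lemma root_space_coord:
  assumes "x \<in> root_space \<alpha>" "h \<in> cartan" "root_coord k x \<noteq> 0"
  shows "root_weight k h = \<alpha> h"
  using assms root_coord_lie_cartan[of h k x] by (simp add: root_space_def root_coord_linear)

section \<open>The grading of so(7) and the parabolic subalgebra\<close>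

definition levi_indices :: "int set" where "levi_indices = {2, 3, 5, 7, - 2, - 3, - 5, - 7}"
definition nil_indices :: "int set" where "nil_indices = {1, 4, 6, 8, 9}"
definition opp_indices :: "int set" where "opp_indices = {- 1, - 4, - 6, - 8, - 9}"

lemma root_indices_split:
  "root_indices = levi_indices \<union> nil_indices \<union> opp_indices"
  "levi_indices \<inter> nil_indices = {}" "(levi_indices \<union> nil_indices) \<inter> opp_indices = {}"
  "levi_indices \<subseteq> root_indices" "nil_indices \<subseteq> root_indices" "opp_indices \<subseteq> root_indices"
  by (auto simp: root_indices_def levi_indices_def nil_indices_def opp_indices_def)

text \<open>The value at \<open>skew_unit 1 1\<close> is the coefficient of
  \<open>\<epsilon> 1\<close> in the root. It grades so(7) by -1, 0 and 1, with the Levi part in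
  degree 0 and the nilradical in degree 1.\<close>

lemma root_weight_grade:
  "k \<in> levi_indices \<Longrightarrow> root_weight k (skew_unit 1 1) = 0"
  "k \<in> nil_indices \<Longrightarrow> root_weight k (skew_unit 1 1) = 1"
  "k \<in> opp_indices \<Longrightarrow> root_weight k (skew_unit 1 1) = - 1"
  by (auto simp: levi_indices_def nil_indices_def opp_indices_def root_weight_def root_index_simps
      \<epsilon>_def Rep_skew_unit)

lemma root_vector_root_space: "k \<in> root_indices \<Longrightarrow> root_vector k \<in> root_space (root_weight k)"
  by (simp add: root_space_def lie_cartan_root_vector)

lemma positive_roots_eq: "positive_roots = root_weight ` {1..9}"
proof -
  have "{1..9} = {1, 2, 3, 4, 5, 6, 7, 8, 9::int}" by auto
  moreover have "root_weight 1 = (\<lambda>h. \<epsilon> 1 h - \<epsilon> 2 h)" "root_weight 2 = (\<lambda>h.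
      \<epsilon> 2 h - \<epsilon> 3 h)" "root_weight 3 = \<epsilon> 3"
    "root_weight 4 = (\<lambda>h. \<epsilon> 1 h - \<epsilon> 3 h)" "root_weight 5 = \<epsilon> 2" "root_weight
        6 = \<epsilon> 1"
    "root_weight 7 = (\<lambda>h. \<epsilon> 2 h + \<epsilon> 3 h)" "root_weight 8 = (\<lambda>h. \<epsilon> 1
        h + \<epsilon> 3 h)" "root_weight 9 = (\<lambda>h. \<epsilon> 1 h + \<epsilon> 2 h)"
    by (simp_all add: fun_eq_iff root_weight_def root_index_simps \<epsilon>_minus \<epsilon>_zero)
  ultimately show ?thesis unfolding positive_roots_def by auto
qed

text \<open>Combinations of the two simple roots of the Levi part vanish at the grading element,
  while the roots of the nilradical have the value 1 there; the former are exhibited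
  explicitly.\<close>

lemma levi_positive_roots_eq: "levi_positive_roots = root_weight ` {2, 3, 5, 7}"
proof
  show "root_weight ` {2, 3, 5, 7} \<subseteq> levi_positive_roots"
  proof -
    have w: "root_weight 2 = (\<lambda>h. of_nat 1 * (\<epsilon> 2 h - \<epsilon> 3 h) + of_nat 0 * \<epsilon> 3 h)"
      "root_weight 3 = (\<lambda>h. of_nat 0 * (\<epsilon> 2 h - \<epsilon> 3 h) + of_nat 1 * \<epsilon> 3 h)"
      "root_weight 5 = (\<lambda>h. of_nat 1 * (\<epsilon> 2 h - \<epsilon> 3 h) + of_nat 1 * \<epsilon> 3 h)"
      "root_weight 7 = (\<lambda>h. of_nat 1 * (\<epsilon> 2 h - \<epsilon> 3 h) + of_nat 2 * \<epsilon> 3 h)"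
      by (simp_all add: fun_eq_iff root_weight_def root_index_simps \<epsilon>_minus \<epsilon>_zero)
    have p: "root_weight k \<in> positive_roots" if "k \<in> {2, 3, 5, 7}" for k
      using that by (auto simp: positive_roots_eq)
    show ?thesis unfolding levi_positive_roots_def using p w by blast
  qed
  show "levi_positive_roots \<subseteq> root_weight ` {2, 3, 5, 7}"
  proof
    fix \<alpha> assume "\<alpha> \<in> levi_positive_roots"
    then obtain k a b where k: "k \<in> {1..9}" "\<alpha> = root_weight k"
      and ab: "\<alpha> = (\<lambda>h. of_nat a * (\<epsilon> 2 h - \<epsilon> 3 h) + of_nat b * \<epsilon> 3 h)"
      by (auto simp: levi_positive_roots_def positive_roots_eq)
    have "root_weight k (skew_unit 1 1) = 0" unfolding k(2)[symmetric] ab by (simp add: \<epsilon>_def Rep_skew_unit)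
    then have "k \<notin> nil_indices" using root_weight_grade(2)[of k] by auto
    then have "k \<in> {2, 3, 5, 7}" using k(1) by (auto simp: nil_indices_def)
    then show "\<alpha> \<in> root_weight ` {2, 3, 5, 7}" using k(2) by blast
  qed
qed

text \<open>The difference is one of sets of roots, not of indices; the grading shows that no
  function is a root of both kinds.\<close>

lemma nil_roots_eq: "positive_roots - levi_positive_roots = root_weight ` nil_indices"
proof -
  have "{1..9} = {2, 3, 5, 7} \<union> nil_indices" by (auto simp: nil_indices_def)
  moreover have "root_weight ` {2, 3, 5, 7} \<inter> root_weight ` nil_indices = {}"
  proof -
    have "root_weight k \<noteq> root_weight l" if "k \<in> {2, 3, 5, 7}" "l \<in> nil_indices" for k l
      using root_weight_grade(1)[of k] root_weight_grade(2)[of l] that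
      by (metis insertE insert_iff levi_indices_def zero_neq_one)
    then show ?thesis by blast
  qed
  ultimately show ?thesis unfolding positive_roots_eq levi_positive_roots_eq by auto
qed

lemma root_vector_levi: "k \<in> levi_indices \<Longrightarrow> root_vector k \<in> levi"
proof -
  assume k: "k \<in> levi_indices"
  have neg: "root_weight (- l) = (\<lambda>h. - root_weight l h)" if "l \<in> {2, 3, 5, 7}" for l
    using that by (auto simp: fun_eq_iff root_weight_def root_index_simps \<epsilon>_minus \<epsilon>_zero)
  have "root_vector k \<in> root_space (root_weight k)"
    using k root_indices_split(4) root_vector_root_space by blast
  then have "root_vector k \<in> (\<Union>\<alpha>\<in>levi_positive_roots. root_space \<alpha> \<union>
      root_space (\<lambda>h. - \<alpha> h))"
    using k unfolding levi_positive_roots_eq levi_indices_def using neg by fastforce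
  then show ?thesis unfolding levi_def by (intro cvec.span_base) blast
qed

lemma cartan_levi: "cartan \<subseteq> levi"
  unfolding levi_def using cvec.span_superset by blast

lemma root_vector_nilradical: "k \<in> nil_indices \<Longrightarrow> root_vector k \<in> nilradical"
  unfolding nilradical_def nil_roots_eq
  using root_vector_root_space root_indices_split(5) by (intro cvec.span_base) blast

lemma subspace_coords: "cvec.subspace {x. \<forall>k\<in>K. root_coord k x = 0}"
  by (auto simp: cvec.subspace_def root_coord_linear)

lemma levi_coord_zero:
  assumes "x \<in> levi" "k \<in> nil_indices \<union> opp_indices"
  shows "root_coord k x = 0"
proof -
  have "levi \<subseteq> {x. \<forall>k\<in>nil_indices \<union> opp_indices. root_coord k x = 0}"
    unfolding levi_def
  proof (rule cvec.span_minimal[OF _ subspace_coords])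
    have h: "skew_unit 1 1 \<in> cartan" by (rule cartan_skew_unit)
    have zero: "root_coord k x = 0" if "k \<in> nil_indices \<union> opp_indices" "x \<in> root_space \<beta>"
        "\<beta> (skew_unit 1 1) = 0" for k x \<beta>
      using root_space_coord[OF that(2) h, of k] that(1,3) root_weight_grade(2,3)[of k] by fastforce
    have grade: "\<alpha> (skew_unit 1 1) = 0" if "\<alpha> \<in> levi_positive_roots" for \<alpha>
      using that root_weight_grade(1) by (auto simp: levi_positive_roots_eq levi_indices_def)
    have "root_coord k x = 0"
      if "k \<in> nil_indices \<union> opp_indices" "\<alpha> \<in> levi_positive_roots" "x \<in> root_space
          \<alpha> \<or> x \<in> root_space (\<lambda>h. - \<alpha> h)" for k x \<alpha>
      using that(3) zero[OF that(1), of x \<alpha>] zero[OF that(1), of x "\<lambda>h. - \<alpha> h"] grade[OF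
          that(2)] by auto
    moreover have "root_coord k x = 0" if "x \<in> cartan" "k \<in> nil_indices \<union> opp_indices" for k x
      using root_coord_cartan[OF that(1)] that(2) root_indices_split(5,6) by blast
    ultimately show "cartan \<union> (\<Union>\<alpha>\<in>levi_positive_roots. root_space \<alpha> \<union>
        root_space (\<lambda>h. - \<alpha> h))
        \<subseteq> {x. \<forall>k\<in>nil_indices \<union> opp_indices. root_coord k x = 0}"
      by blast
  qed
  then show ?thesis using assms by blast
qed

lemma levi_decompose:
  assumes "x \<in> levi"
  shows "x = cartan_part x + (\<Sum>k\<in>levi_indices. root_coord k x *\<^sub>C root_vector k)"
proof -
  have "(\<Sum>k\<in>root_indices. root_coord k x *\<^sub>C root_vector k) = (\<Sum>k\<in>levi_indices.
      root_coord k x *\<^sub>C root_vector k)"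
    using levi_coord_zero[OF assms]
    by (intro sum.mono_neutral_right) (auto simp: root_indices_split(1) levi_indices_def nil_indices_def opp_indices_def)
  then show ?thesis using so7_decompose[of x] by simp
qed

text \<open>This description by vanishing coordinates is the form in which the model on polynomials
  takes a subalgebra with a complement.\<close>

lemma parabolic_iff: "x \<in> parabolic \<longleftrightarrow> (\<forall>k\<in>opp_indices. root_coord k x = 0)"
proof
  have "parabolic \<subseteq> {x. \<forall>k\<in>opp_indices. root_coord k x = 0}"
    unfolding parabolic_def
  proof (rule cvec.span_minimal[OF _ subspace_coords])
    have h: "skew_unit 1 1 \<in> cartan" by (rule cartan_skew_unit)
    have "root_coord k x = 0" if "k \<in> opp_indices" "x \<in> root_space (root_weight l)" "l \<in> nil_indices" for k l x
      using root_space_coord[OF that(2) h, of k] that(1,3) root_weight_grade(2)[of l] root_weight_grade(3)[of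
          k] by fastforce
    then have "nilradical \<subseteq> {x. \<forall>k\<in>opp_indices. root_coord k x = 0}"
      unfolding nilradical_def nil_roots_eq
      by (intro cvec.span_minimal[OF _ subspace_coords]) auto
    then show "levi \<union> nilradical \<subseteq> {x. \<forall>k\<in>opp_indices. root_coord k x = 0}"
      using levi_coord_zero by auto
  qed
  then show "\<forall>k\<in>opp_indices. root_coord k x = 0" if "x \<in> parabolic" using that by blast
next
  assume z: "\<forall>k\<in>opp_indices. root_coord k x = 0"
  have "root_vector k \<in> parabolic" if "k \<in> levi_indices \<union> nil_indices" for k
    using that root_vector_levi root_vector_nilradical unfolding parabolic_def by (auto intro: cvec.span_base)
  moreover have "cartan_part x \<in> parabolic"
    using cartan_part_cartan cartan_levi unfolding parabolic_def by (auto intro: cvec.span_base)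
  moreover have "(\<Sum>k\<in>root_indices. root_coord k x *\<^sub>C root_vector k)
      = (\<Sum>k\<in>levi_indices \<union> nil_indices. root_coord k x *\<^sub>C root_vector k)"
    using z by (intro sum.mono_neutral_right) (auto simp: root_indices_split(1) levi_indices_def
        nil_indices_def opp_indices_def)
  moreover have sub: "cvec.subspace parabolic"
    unfolding parabolic_def by (rule cvec.subspace_span)
  ultimately have "cartan_part x + (\<Sum>k\<in>root_indices. root_coord k x *\<^sub>C root_vector k) \<in> parabolic"
    by (metis (no_types, lifting) cvec.subspace_add[OF sub] cvec.subspace_sum[OF sub] cvec.subspace_scale[OF sub])
  then show "x \<in> parabolic" using so7_decompose[of x] by simp
qed

lemma lie_anticommute: "lie x y = - lie y x" for x y :: "'a::complex_lie_algebra"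
proof -
  have "lie x y + lie y x = 0"
    using lie_add_left[of x y "x + y"] lie_add_right[of x x y] lie_add_right[of y x y] lie_self[of "x + y"]
    by (simp add: lie_self)
  then show ?thesis by (simp add: eq_neg_iff_add_eq_0)
qed

lemma lie_derivation: "lie h (lie x y) = lie (lie h x) y + lie x (lie h y)"
  for x y :: "'a::complex_lie_algebra"
  using lie_jacobi[of h x y] lie_anticommute[of y "lie h x"] lie_anticommute[of h y]
  by (simp add: lie_minus add_eq_0_iff2 eq_diff_eq)

abbreviation (input) grading :: so7 where "grading \<equiv> skew_unit 1 1"

lemma grading_cartan: "grading \<in> cartan" by (rule cartan_skew_unit)

lemma \<epsilon>_lie_cartan: "h \<in> cartan \<Longrightarrow> \<epsilon> i (lie h x) = 0"
proof -
  assume h: "h \<in> cartan"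
  have d: "Rep_so7 h $ i $ j = (if i = j then \<epsilon> i h else 0)" for i j
    using h by (simp add: cartan_def \<epsilon>_def)
  have "(Rep_so7 h ** Rep_so7 x) $ i $ i = (\<Sum>k\<in>UNIV. if k = i then \<epsilon> i h * Rep_so7 x $ i $ i else 0)"
    "(Rep_so7 x ** Rep_so7 h) $ i $ i = (\<Sum>k\<in>UNIV. if k = i then \<epsilon> i h * Rep_so7 x $ i $ i else 0)"
    unfolding matrix_matrix_mult_def vec_lambda_beta d by (intro sum.cong refl; simp)+
  then show ?thesis unfolding \<epsilon>_def[of i "lie h x"] lie_so7.rep_eq by simp
qed

text \<open>The grading element is diagonalizable on so(7) with no eigenvalues besides -1, 0 and 1,
  so a homogeneous element of any other degree vanishes.\<close>

lemma grade_eq_0I: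
  assumes "lie grading x = c *\<^sub>C x" "c \<noteq> - 1" "c \<noteq> 0" "c \<noteq> 1"
  shows "x = 0"
proof (rule so7_eq_0I)
  have "\<epsilon> i x = 0" for i
    using \<epsilon>_lie_cartan[OF grading_cartan, of i x] assms(1,3) by (simp add: \<epsilon>_linear)
  then show "\<epsilon> 1 x = 0" "\<epsilon> 2 x = 0" "\<epsilon> 3 x = 0" by auto
  fix k assume "k \<in> root_indices"
  then have "root_weight k grading \<noteq> c"
    using root_weight_grade[of k] root_indices_split(1) assms(2-4) by auto
  moreover have "root_weight k grading * root_coord k x = c * root_coord k x"
    unfolding root_coord_lie_cartan[OF grading_cartan, of k x, symmetric] assms(1) by (simp add: root_coord_linear)
  ultimately show "root_coord k x = 0" by simp
qed

lemma lie_grading_opp: "a \<in> opp_indices \<Longrightarrow> lie grading (root_vector a) = - root_vector a"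
  using lie_cartan_root_vector[OF grading_cartan, of a] root_weight_grade(3)[of a] root_indices_split(6)
  by (auto simp: cvec.scale_minus_left scaleC_one)

lemma lie_grading_decrease:
  assumes "lie grading x = c *\<^sub>C x" "a \<in> opp_indices"
  shows "lie grading (lie x (root_vector a)) = (c - 1) *\<^sub>C lie x (root_vector a)"
  by (simp add: lie_derivation assms lie_grading_opp lie_scaleC_left lie_minus cvec.scale_left_diff_distrib scaleC_one)

lemma opp_commute:
  assumes "a \<in> opp_indices" "b \<in> opp_indices"
  shows "lie (root_vector a) (root_vector b) = 0"
proof (rule grade_eq_0I)
  have "lie grading (root_vector a) = (- 1) *\<^sub>C root_vector a"
    by (simp add: lie_grading_opp assms cvec.scale_minus_left scaleC_one)
  from lie_grading_decrease[OF this assms(2)]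
  show "lie grading (lie (root_vector a) (root_vector b)) = (- 2) *\<^sub>C lie (root_vector a) (root_vector b)" by simp
qed simp_all

text \<open>Three brackets lower the degree by three, hence from at most 1 to at most -2. It is
  enough to look at homogeneous \<open>x\<close>, since root vectors and diagonal matrices
  span.\<close>

lemma opp_triple:
  assumes "a \<in> opp_indices" "b \<in> opp_indices" "c \<in> opp_indices"
  shows "lie (lie (lie x (root_vector a)) (root_vector b)) (root_vector c) = 0"
proof -
  let ?T = "\<lambda>x. lie (lie (lie x (root_vector a)) (root_vector b)) (root_vector c)"
  have *: "?T x = 0" if "lie grading x = d *\<^sub>C x" "d = - 1 \<or> d = 0 \<or> d = 1" for d x
    using grade_eq_0I[OF lie_grading_decrease[OF lie_grading_decrease[OF lie_grading_decrease[OF that(1)]]], OF assms]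
      that(2) by auto
  have "?T (root_vector k) = 0" if "k \<in> root_indices" for k
    using *[OF lie_cartan_root_vector[OF grading_cartan that]] root_weight_grade[of k] that root_indices_split(1) by auto
  moreover have "?T (skew_unit i i) = 0" for i
  proof -
    have "lie grading (skew_unit i i) = 0 *\<^sub>C skew_unit i i"
      by (simp add: lie_cartan_skew_unit[OF grading_cartan])
    from *[OF this] show ?thesis by simp
  qed
  moreover have add: "?T (x + y) = ?T x + ?T y" "?T (d *\<^sub>C x) = d *\<^sub>C ?T x" for x y d
    by (simp_all add: lie_linear)
  moreover have "?T (sum f B) = (\<Sum>b\<in>B. ?T (f b))" for f :: "int \<Rightarrow> so7" and B
    by (induction B rule: infinite_finite_induct) (simp_all add: add)
  ultimately have "?T (cartan_part x + (\<Sum>k\<in>root_indices. root_coord k x *\<^sub>C root_vector k)) = 0"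
    unfolding cartan_part_def by (simp only: add) simp
  then show ?thesis using so7_decompose[of x] by simp
qed

text \<open>The parabolic subalgebra is the stabilizer of the line through the first basis vector.
  In this form its closure under brackets is a computation with one column.\<close>

lemma parabolic_column: "x \<in> parabolic \<longleftrightarrow> (\<forall>p. p \<noteq> 1 \<longrightarrow>
    Rep_so7 x $ p $ 1 = 0)"
  unfolding parabolic_iff opp_indices_def forall_7
  by (auto simp: root_coord_def root_scale_nonzero root_index_simps so7_entry_normalize)

lemma parabolic_lie:
  assumes "x \<in> parabolic" "z \<in> parabolic"
  shows "lie x z \<in> parabolic"
proof -
  have "(Rep_so7 x ** Rep_so7 z) $ p $ 1 = 0" if "x \<in> parabolic" "z \<in> parabolic" "p \<noteq> 1" for x z p
  proof -
    have "Rep_so7 x $ p $ q * Rep_so7 z $ q $ 1 = 0" for q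
      using that by (cases "q = 1") (auto simp: parabolic_column)
    then show ?thesis unfolding matrix_matrix_mult_def vec_lambda_beta by (rule sum.neutral[rule_format])
  qed
  then show ?thesis using assms by (simp add: parabolic_column lie_so7.rep_eq)
qed

section \<open>Freeness of modules induced along an abelian complement\<close>

lemma clinear_iff:
  "clinear f \<longleftrightarrow> (\<forall>x y. f (x + y) = f x + f y) \<and> (\<forall>c x. f (c *\<^sub>C
      x) = c *\<^sub>C f x)"
  by (simp add: Vector_Spaces.linear_iff cvec.vector_space_axioms)

lemma clinearD:
  assumes "clinear f"
  shows "f (x + y) = f x + f y" "f (c *\<^sub>C x) = c *\<^sub>C f x" "f 0 = 0" "f (x - y) = f x - f y"
    "f (- x) = - f x" "f (sum f' B) = (\<Sum>b\<in>B. f (f' b))"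
proof -
  show a: "f (x + y) = f x + f y" and s: "f (c *\<^sub>C x) = c *\<^sub>C f x" for x y c
    using assms by (auto simp: clinear_iff)
  show z: "f 0 = 0" using s[of 0 0] by simp
  show m: "f (- x) = - f x" for x using s[of "- 1" x] by (simp add: cvec.scale_minus_left scaleC_one)
  show "f (x - y) = f x - f y" using a[of x "- y"] m[of y] by simp
  show "f (sum f' B) = (\<Sum>b\<in>B. f (f' b))"
    by (induction B rule: infinite_finite_induct) (simp_all add: a z)
qed

lemma clinear_zero_fun: "clinear (\<lambda>x. 0)"
  by (simp add: clinear_iff)

lemma clinear_plus_fun: "clinear f \<Longrightarrow> clinear f' \<Longrightarrow> clinear (\<lambda>x. f x + f' x)"
  by (simp add: clinear_iff scaleC_add_right algebra_simps)

lemma clinear_minus_fun: "clinear f \<Longrightarrow> clinear f' \<Longrightarrow> clinear (\<lambda>x. f x - f' x)"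
  by (simp add: clinearD clinear_iff[of "\<lambda>x. f x - f' x"] cvec.scale_right_diff_distrib)

lemma clinear_scale_fun: "clinear f \<Longrightarrow> clinear (\<lambda>x. c *\<^sub>C f x)"
  by (simp add: clinear_iff scaleC_add_right scaleC_scaleC mult.commute)

lemma clinear_sum_fun: "(\<And>a. a \<in> B \<Longrightarrow> clinear (f a)) \<Longrightarrow> clinear
    (\<lambda>x. \<Sum>a\<in>B. f a x)"
  by (induction B rule: infinite_finite_induct) (simp_all add: clinear_zero_fun clinear_plus_fun)

lemma clinear_compose: "clinear f \<Longrightarrow> clinear f' \<Longrightarrow> clinear (\<lambda>x. f (f' x))"
  by (simp add: clinear_iff)

lemmas clinear_intros = clinear_zero_fun clinear_plus_fun clinear_minus_fun clinear_scale_fun clinear_sum_fun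

abbreviation (input) "single \<equiv> Poly_Mapping.single"

lemma clinear_single: "clinear (single k :: 'b::complex_vector \<Rightarrow> _)"
proof -
  have "single k (c *\<^sub>C v) = c *\<^sub>C single k v" for c and v :: 'b
    by (rule poly_mapping_eqI) (simp add: lookup_single when_def)
  then show ?thesis by (simp add: clinear_iff single_add)
qed

lemma poly_mapping_sum_singles: "p = (\<Sum>k\<in>Poly_Mapping.keys p. single k (Poly_Mapping.lookup p k))"
  by (rule poly_mapping_eqI) (auto simp: lookup_sum lookup_single when_def in_keys_iff)

lemma clinear_eqI:
  assumes "clinear F" "clinear G"
    and "\<And>k v. F (single k v) = G (single k v)"
  shows "F p = G p"
  by (subst (1 2) poly_mapping_sum_singles) (simp add: clinearD(6)[OF assms(1)] clinearD(6)[OF assms(2)] assms(3))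

text \<open>Here the coefficients lie in a module, so each key supplies a map on coefficients rather
  than a vector; \<open>free_extend\<close> is the case of scalar coefficients.\<close>

definition pm_extend :: "('k \<Rightarrow> 'v \<Rightarrow> 'w) \<Rightarrow> ('k \<Rightarrow>\<^sub>0
    'v::complex_vector) \<Rightarrow> 'w::complex_vector" where
  "pm_extend f p = (\<Sum>k\<in>Poly_Mapping.keys p. f k (Poly_Mapping.lookup p k))"

lemma pm_extend_superset:
  assumes "\<And>k. clinear (f k)" "finite S" "Poly_Mapping.keys p \<subseteq> S"
  shows "pm_extend f p = (\<Sum>k\<in>S. f k (Poly_Mapping.lookup p k))"
  unfolding pm_extend_def
  by (rule sum.mono_neutral_left) (use assms in \<open>auto simp: in_keys_iff clinearD(3)\<close>)

lemma pm_extend_single: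
  assumes "\<And>k. clinear (f k)"
  shows "pm_extend f (single k v) = f k v"
  using pm_extend_superset[OF assms, of "{k}" "single k v"] by simp

lemma clinear_pm_extend:
  assumes "\<And>k. clinear (f k)"
  shows "clinear (pm_extend f)"
  unfolding clinear_iff
proof (intro conjI allI)
  fix p q :: "'a \<Rightarrow>\<^sub>0 'b" and c
  let ?S = "Poly_Mapping.keys p \<union> Poly_Mapping.keys q"
  show "pm_extend f (p + q) = pm_extend f p + pm_extend f q"
    using pm_extend_superset[OF assms, of ?S p] pm_extend_superset[OF assms, of ?S q]
      pm_extend_superset[OF assms, of ?S "p + q"] Poly_Mapping.keys_add[of p q]
    by (simp add: lookup_add clinearD[OF assms] sum.distrib)
  have "Poly_Mapping.keys (c *\<^sub>C p) \<subseteq> Poly_Mapping.keys p"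
    by (auto simp: in_keys_iff)
  then show "pm_extend f (c *\<^sub>C p) = c *\<^sub>C pm_extend f p"
    using pm_extend_superset[OF assms, of "Poly_Mapping.keys p" p]
      pm_extend_superset[OF assms, of "Poly_Mapping.keys p" "c *\<^sub>C p"]
    by (simp add: clinearD[OF assms] cvec.scale_sum_right)
qed

lemma free_extend_eq: "free_extend f = pm_extend (\<lambda>b c. c *\<^sub>C f b)"
  by (simp add: fun_eq_iff free_extend_def pm_extend_def)

lemma clinear_scale_left: "clinear (\<lambda>c. c *\<^sub>C x)"
  by (simp add: clinear_iff scaleC_complex_def scaleC_add_left scaleC_scaleC)

lemma clinear_free_extend: "clinear (free_extend f)"
  unfolding free_extend_eq by (rule clinear_pm_extend) (rule clinear_scale_left)

lemma free_extend_single: "free_extend f (single b c) = c *\<^sub>C f b"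
  unfolding free_extend_eq by (rule pm_extend_single) (rule clinear_scale_left)

text \<open>The complement of \<open>P\<close> has the basis \<open>y a\<close>, \<open>a \<in> A\<close>;
    outside \<open>A\<close> we put \<open>y a = 0\<close>, so that
  arbitrary multisets may serve as monomials.\<close>

locale abelian_complement =
  fixes P :: "'a::complex_lie_algebra set" and act :: "'a \<Rightarrow> 'v::complex_vector \<Rightarrow> 'v"
    and A :: "'i set" and y :: "'i \<Rightarrow> 'a" and \<kappa> :: "'i \<Rightarrow> 'a \<Rightarrow> complex"
  assumes rep: "lie_rep_on P act"
    and P_iff: "x \<in> P \<longleftrightarrow> (\<forall>a\<in>A. \<kappa> a x = 0)"
    and P_lie: "x \<in> P \<Longrightarrow> z \<in> P \<Longrightarrow> lie x z \<in> P"
    and fin: "finite A"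
    and outside: "a \<notin> A \<Longrightarrow> y a = 0"
    and coord_linear: "clinear (\<kappa> a)"
    and dual: "a \<in> A \<Longrightarrow> b \<in> A \<Longrightarrow> \<kappa> a (y b) = (if a = b then 1 else 0)"
    and commute: "lie (y a) (y b) = 0"
    and triple: "lie (lie (lie x (y a)) (y b)) (y c) = 0"
begin

definition proj :: "'a \<Rightarrow> 'a" where
  "proj x = x - (\<Sum>a\<in>A. \<kappa> a x *\<^sub>C y a)"

definition mul_var :: "'i \<Rightarrow> ('i multiset \<Rightarrow>\<^sub>0 'v) \<Rightarrow> ('i multiset
    \<Rightarrow>\<^sub>0 'v)" where
  "mul_var a = pm_extend (\<lambda>m v. single (add_mset a m) v)"

definition deriv_var :: "'i \<Rightarrow> ('i multiset \<Rightarrow>\<^sub>0 'v) \<Rightarrow> ('i multiset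
    \<Rightarrow>\<^sub>0 'v)" where
  "deriv_var a = pm_extend (\<lambda>m v. of_nat (count m a) *\<^sub>C single (m - {#a#}) v)"

text \<open>The effect of \<open>x\<close> once it stands to the right of all variables: its part in
  \<open>P\<close> acts on the coefficient in V, and its part in the complement becomes a further
  variable.\<close>

definition order0 :: "'a \<Rightarrow> ('i multiset \<Rightarrow>\<^sub>0 'v) \<Rightarrow> ('i multiset
    \<Rightarrow>\<^sub>0 'v)" where
  "order0 x = pm_extend (\<lambda>m v. single m (act (proj x) v)
     + (\<Sum>a\<in>A. \<kappa> a x *\<^sub>C single (add_mset a m) v))"

text \<open>Moving \<open>x\<close> to the right through a monomial in the commuting \<open>y a\<close>
    produces brackets with at most
  two of them, because triple brackets vanish.\<close>

definition poly_rep :: "'a \<Rightarrow> ('i multiset \<Rightarrow>\<^sub>0 'v) \<Rightarrow> ('i multiset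
    \<Rightarrow>\<^sub>0 'v)" where
  "poly_rep x F = order0 x F + (\<Sum>a\<in>A. order0 (lie x (y a)) (deriv_var a F))
     + (1 / 2) *\<^sub>C (\<Sum>a\<in>A. \<Sum>b\<in>A. order0 (lie (lie x (y a)) (y b)) (deriv_var a (deriv_var b F)))"

lemma proj_P: "proj x \<in> P"
  unfolding P_iff
proof
  fix a assume a: "a \<in> A"
  have "\<kappa> a (\<Sum>b\<in>A. \<kappa> b x *\<^sub>C y b) = (\<Sum>b\<in>A. if b = a then \<kappa> a x else 0)"
    unfolding clinearD(6)[OF coord_linear]
    by (rule sum.cong) (auto simp: clinearD(2)[OF coord_linear] scaleC_complex_def dual a)
  then show "\<kappa> a (proj x) = 0" using a fin by (simp add: proj_def clinearD(4)[OF coord_linear])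
qed

lemma proj_linear: "proj (x + z) = proj x + proj z" "proj (c *\<^sub>C x) = c *\<^sub>C proj x"
  by (simp_all add: proj_def clinearD[OF coord_linear] scaleC_add_left sum.distrib algebra_simps
      cvec.scale_right_diff_distrib cvec.scale_sum_right scaleC_complex_def)

lemma proj_id: "x \<in> P \<Longrightarrow> proj x = x"
  by (simp add: proj_def P_iff)

lemma act_linear: "x \<in> P \<Longrightarrow> clinear (act x)"
  using rep by (simp add: lie_rep_on_def)

lemma act_add: "x \<in> P \<Longrightarrow> z \<in> P \<Longrightarrow> act (x + z) v = act x v + act z v"
  and act_scale: "x \<in> P \<Longrightarrow> act (c *\<^sub>C x) v = c *\<^sub>C act x v"
  and act_lie: "x \<in> P \<Longrightarrow> z \<in> P \<Longrightarrow> act (lie x z) v = act x (act z v) - act z (act x v)"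
  using rep by (simp_all add: lie_rep_on_def)

lemma clinear_single_fun: "clinear (\<lambda>v. single k v)"
  using clinear_single[of k] by simp

lemmas vlin = clinear_intros clinear_single_fun

lemma mul_var_aux: "clinear (\<lambda>v :: 'v. single (add_mset a m) v)"
  by (rule clinear_single_fun)

lemma deriv_var_aux: "clinear (\<lambda>v :: 'v. of_nat (count m a) *\<^sub>C single (m - {#a#}) v)"
  by (intro vlin)

lemma order0_aux: "clinear (\<lambda>v. single m (act (proj x) v)
     + (\<Sum>a\<in>A. \<kappa> a x *\<^sub>C single (add_mset a m) v))"
  by (intro vlin clinear_compose[OF clinear_single_fun act_linear] proj_P)

lemma mul_var_single: "mul_var a (single m v) = single (add_mset a m) v"
  unfolding mul_var_def by (rule pm_extend_single) (rule mul_var_aux)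

lemma deriv_var_single: "deriv_var a (single m v)
    = of_nat (count m a) *\<^sub>C single (m - {#a#}) v"
  unfolding deriv_var_def by (rule pm_extend_single) (rule deriv_var_aux)

lemma order0_single: "order0 x (single m v) = single m (act (proj x) v)
     + (\<Sum>a\<in>A. \<kappa> a x *\<^sub>C single (add_mset a m) v)"
  unfolding order0_def by (rule pm_extend_single) (rule order0_aux)

lemma clinear_mul_var: "clinear (mul_var a)"
  unfolding mul_var_def by (rule clinear_pm_extend) (rule mul_var_aux)

lemma clinear_deriv_var: "clinear (deriv_var a)"
  unfolding deriv_var_def by (rule clinear_pm_extend) (rule deriv_var_aux)

lemma clinear_order0: "clinear (order0 x)"
  unfolding order0_def by (rule clinear_pm_extend) (rule order0_aux)

lemmas lin = clinear_intros clinear_mul_var clinear_deriv_var clinear_order0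
  clinear_compose[OF clinear_mul_var] clinear_compose[OF clinear_deriv_var] clinear_compose[OF clinear_order0]

lemma clinear_poly_rep: "clinear (poly_rep x)"
proof -
  have "clinear (\<lambda>F. order0 x F + (\<Sum>a\<in>A. order0 (lie x (y a)) (deriv_var a F))
     + (1 / 2) *\<^sub>C (\<Sum>a\<in>A. \<Sum>b\<in>A. order0 (lie (lie x (y a)) (y b)) (deriv_var a (deriv_var b F))))"
    by (intro lin)
  then show ?thesis by (simp add: poly_rep_def[abs_def])
qed

lemma order0_add: "order0 (x + z) F = order0 x F + order0 z F"
proof (rule clinear_eqI[where F = "order0 (x + z)" and G = "\<lambda>F. order0 x F + order0 z F"])
  show "order0 (x + z) (single k v) = order0 x (single k v) + order0 z (single k v)" for k v
    by (simp add: order0_single proj_linear act_add proj_P single_add clinearD[OF coord_linear] scaleC_add_left sum.distrib)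
qed (intro lin)+

lemma order0_scale: "order0 (c *\<^sub>C x) F = c *\<^sub>C order0 x F"
proof (rule clinear_eqI[where F = "order0 (c *\<^sub>C x)" and G = "\<lambda>F. c *\<^sub>C order0 x F"])
  show "order0 (c *\<^sub>C x) (single k v) = c *\<^sub>C order0 x (single k v)" for k v
    by (simp add: order0_single proj_linear act_scale proj_P clinearD[OF clinear_single] clinearD[OF coord_linear]
        scaleC_add_right cvec.scale_sum_right scaleC_complex_def)
qed (intro lin)+

lemma order0_zero: "order0 0 F = 0"
  using order0_scale[of 0 0 F] by simp

lemma deriv_mul: "deriv_var a (mul_var b F) = mul_var b (deriv_var a F) + (if a = b then F else 0)"
proof (rule clinear_eqI[where F = "\<lambda>F. deriv_var a (mul_var b F)"
      and G = "\<lambda>F. mul_var b (deriv_var a F) + (if a = b then F else 0)"])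
  show "clinear (\<lambda>F. mul_var b (deriv_var a F) + (if a = b then F else 0))"
    by (cases "a = b") (simp_all add: clinear_iff clinearD[OF clinear_mul_var] clinearD[OF clinear_deriv_var]
        scaleC_add_right)
  show "deriv_var a (mul_var b (single m v)) = mul_var b (deriv_var a (single m v))
    + (if a = b then single m v else 0)" for m v
  proof (cases "a = b")
    case True
    show ?thesis
    proof (cases "count m b")
      \<comment> \<open>Here \<open>m - {#b#}\<close> is \<open>m\<close> itself, but it occurs with
        the coefficient \<open>count m b\<close>, which is 0.\<close>
      case 0
      then show ?thesis using True
        by (simp add: mul_var_single deriv_var_single clinearD[OF clinear_mul_var] scaleC_one)
    next
      case (Suc n)
      then have "add_mset b (m - {#b#}) = m" by (metis count_inI insert_DiffM nat.distinct(1))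
      then show ?thesis using True
        by (simp add: mul_var_single deriv_var_single clinearD[OF clinear_mul_var] scaleC_add_left scaleC_one)
    qed
  next
    case False
    then have "add_mset b m - {#a#} = add_mset b (m - {#a#})" by (simp add: diff_add_mset_swap)
    then show ?thesis using False
      by (simp add: mul_var_single deriv_var_single clinearD[OF clinear_mul_var])
  qed
qed (intro lin)+

lemma order0_mul: "order0 x (mul_var b F) = mul_var b (order0 x F)"
proof (rule clinear_eqI[where F = "\<lambda>F. order0 x (mul_var b F)" and G = "\<lambda>F. mul_var b (order0 x F)"])
  show "order0 x (mul_var b (single m v)) = mul_var b (order0 x (single m v))" for m v
    by (simp add: order0_single mul_var_single clinearD[OF clinear_mul_var] add_mset_commute[of b])
qed (intro lin)+

lemma poly_rep_add: "poly_rep (x + z) F = poly_rep x F + poly_rep z F"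
  by (simp add: poly_rep_def lie_linear order0_add sum.distrib scaleC_add_right algebra_simps)

lemma poly_rep_scale: "poly_rep (c *\<^sub>C x) F = c *\<^sub>C poly_rep x F"
  by (simp add: poly_rep_def lie_linear order0_scale scaleC_add_right scaleC_scaleC mult.commute
      flip: cvec.scale_sum_right)

lemma clinear_poly_rep_left: "clinear (\<lambda>x. poly_rep x F)"
  by (simp add: clinear_iff poly_rep_add poly_rep_scale)

text \<open>This is the relation x y = y x + [x, y] in operator form. Each derivative of
  \<open>mul_var b F\<close> gives one extra term, and these terms add up to the operator of [x, y];
  its second-order part is absent because triple brackets vanish.\<close>

lemma poly_rep_mul: "poly_rep x (mul_var b F) = mul_var b (poly_rep x F) + poly_rep (lie x (y b)) F"
proof -
  \<comment> \<open>As the \<open>y a\<close> commute, the Jacobi identity makes the double bracket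
    symmetric. The two derivatives therefore meet the new variable with equal results, and the
    factor 1/2 in \<open>poly_rep\<close> becomes 1.\<close>
  have swap: "lie (lie x (y a)) (y b) = lie (lie x (y b)) (y a)" for a
    using lie_derivation[of x "y a" "y b"] commute[of a b] lie_anticommute[of "y a"] by (simp add: eq_neg_iff_add_eq_0)
  have delta: "(\<Sum>a\<in>A. f a (if a = b then G else 0)) = (if b \<in> A then f b G else 0)"
    if "\<And>a. f a 0 = 0" for f :: "'i \<Rightarrow> ('i multiset \<Rightarrow>\<^sub>0 'v) \<Rightarrow> ('i
        multiset \<Rightarrow>\<^sub>0 'v)" and G
  proof -
    have "(\<Sum>a\<in>A. f a (if a = b then G else 0)) = (\<Sum>a\<in>A. if a = b then f b G else 0)"
      by (rule sum.cong) (auto simp: that)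
    then show ?thesis using fin by simp
  qed
  \<comment> \<open>For \<open>b\<close> outside \<open>A\<close> both sides are 0, since then
    \<open>y b = 0\<close>.\<close>
  have out: "(if b \<in> A then order0 (lie z (y b)) G else 0) = order0 (lie z (y b)) G" for z G
    using outside[of b] by (simp add: order0_zero)
  have out': "(if b \<in> A then order0 (lie (lie z (y b)) w) G else 0) = order0 (lie (lie z (y b)) w) G" for z w G
    using outside[of b] by (simp add: order0_zero)
  have first: "(\<Sum>a\<in>A. order0 (lie x (y a)) (deriv_var a (mul_var b F)))
      = mul_var b (\<Sum>a\<in>A. order0 (lie x (y a)) (deriv_var a F)) + order0 (lie x (y b)) F"
    by (simp add: deriv_mul clinearD[OF clinear_order0] order0_mul sum.distrib clinearD(6)[OF clinear_mul_var]
        delta[of "\<lambda>a. order0 (lie x (y a))"] out)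
  have second: "(\<Sum>a\<in>A. \<Sum>c\<in>A. order0 (lie (lie x (y a)) (y c)) (deriv_var a (deriv_var c (mul_var b F))))
      = mul_var b (\<Sum>a\<in>A. \<Sum>c\<in>A. order0 (lie (lie x (y a)) (y c)) (deriv_var a (deriv_var c F)))
        + 2 *\<^sub>C (\<Sum>a\<in>A. order0 (lie (lie x (y b)) (y a)) (deriv_var a F))"
  proof -
    have "(\<Sum>a\<in>A. \<Sum>c\<in>A. order0 (lie (lie x (y a)) (y c)) (deriv_var a (deriv_var c (mul_var b F))))
      = mul_var b (\<Sum>a\<in>A. \<Sum>c\<in>A. order0 (lie (lie x (y a)) (y c)) (deriv_var a (deriv_var c F)))
        + (\<Sum>a\<in>A. \<Sum>c\<in>A. order0 (lie (lie x (y a)) (y c)) (if a = b then deriv_var c F else 0))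
        + (\<Sum>a\<in>A. \<Sum>c\<in>A. order0 (lie (lie x (y a)) (y c)) (deriv_var a (if c = b then F else 0)))"
      by (simp add: deriv_mul clinearD[OF clinear_order0] clinearD[OF clinear_deriv_var] order0_mul
          sum.distrib clinearD(6)[OF clinear_mul_var])
    also have "(\<Sum>a\<in>A. \<Sum>c\<in>A. order0 (lie (lie x (y a)) (y c)) (if a = b then deriv_var c F else 0))
      = (\<Sum>a\<in>A. order0 (lie (lie x (y b)) (y a)) (deriv_var a F))"
      by (subst sum.swap) (simp add: delta[of "\<lambda>a. order0 (lie (lie x (y a)) _)"] clinearD[OF clinear_order0] out')
    also have "(\<Sum>a\<in>A. \<Sum>c\<in>A. order0 (lie (lie x (y a)) (y c)) (deriv_var a (if c = b then F else 0)))
      = (\<Sum>a\<in>A. order0 (lie (lie x (y b)) (y a)) (deriv_var a F))"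
      by (simp add: delta[of "\<lambda>c G. order0 (lie (lie x (y _)) (y c)) (deriv_var _ G)"]
          clinearD[OF clinear_order0] clinearD[OF clinear_deriv_var] out swap)
    finally show ?thesis by (simp add: scaleC_two)
  qed
  show ?thesis
    by (simp add: poly_rep_def first second order0_mul triple order0_zero scaleC_add_right
        clinearD[OF clinear_mul_var] scaleC_scaleC scaleC_one algebra_simps)
qed

lemma poly_rep_y: "a \<in> A \<Longrightarrow> poly_rep (y a) F = mul_var a F"
proof -
  assume a: "a \<in> A"
  have p: "proj (y a) = 0"
  proof -
    have "(\<Sum>b\<in>A. \<kappa> b (y a) *\<^sub>C y b) = (\<Sum>b\<in>A. if b = a then y a else 0)"
      by (rule sum.cong) (auto simp: dual a scaleC_one)
    then show ?thesis using a fin by (simp add: proj_def)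
  qed
  have act0: "act 0 v = 0" for v
    using act_scale[OF proj_P, of 0 0 v] by simp
  have "order0 (y a) F = mul_var a F"
  proof (rule clinear_eqI[where F = "order0 (y a)" and G = "mul_var a"])
    fix m and v :: 'v
    have "(\<Sum>b\<in>A. \<kappa> b (y a) *\<^sub>C single (add_mset b m) v)
       = (\<Sum>b\<in>A. if b = a then single (add_mset a m) v else 0)"
      by (rule sum.cong) (auto simp: dual a scaleC_one)
    then show "order0 (y a) (single m v) = mul_var a (single m v)"
      using a fin by (simp add: order0_single mul_var_single p act0)
  qed (intro lin)+
  then show ?thesis by (simp add: poly_rep_def commute order0_zero)
qed

lemma poly_rep_const: "x \<in> P \<Longrightarrow> poly_rep x (single {#} v) = single {#} (act x v)"
  by (simp add: poly_rep_def deriv_var_single order0_single proj_id P_iff clinearD[OF clinear_order0]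
      clinearD[OF clinear_deriv_var])

text \<open>The defect of the bracket relation vanishes on constants, and commuting it with a variable
  produces defects again; so it vanishes by induction on the degree.\<close>

definition defect :: "'a \<Rightarrow> 'a \<Rightarrow> ('i multiset \<Rightarrow>\<^sub>0 'v) \<Rightarrow>
    ('i multiset \<Rightarrow>\<^sub>0 'v)" where
  "defect x z F = poly_rep x (poly_rep z F) - poly_rep z (poly_rep x F) - poly_rep (lie x z) F"

lemma clinear_defect: "clinear (defect x z)"
proof -
  have "clinear (\<lambda>F. poly_rep x (poly_rep z F) - poly_rep z (poly_rep x F) - poly_rep (lie x z) F)"
    by (intro clinear_intros clinear_poly_rep clinear_compose[OF clinear_poly_rep clinear_poly_rep])
  then show ?thesis by (simp add: defect_def[abs_def])
qed

lemma defect_swap: "defect z x F = - defect x z F"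
  using lie_anticommute[of z x] clinearD(5)[OF clinear_poly_rep_left, of "lie x z" F]
  by (simp add: defect_def)

lemma clinear_defect_left: "clinear (\<lambda>x. defect x z F)"
  by (simp add: clinear_iff defect_def poly_rep_add poly_rep_scale clinearD[OF clinear_poly_rep] lie_linear
      algebra_simps cvec.scale_right_diff_distrib)

lemma defect_y: "a \<in> A \<Longrightarrow> defect x (y a) F = 0"
  by (simp add: defect_def poly_rep_y poly_rep_mul)

text \<open>Components along the variables contribute nothing, by \<open>defect_y\<close> and
  antisymmetry. What remains are two elements of \<open>P\<close>, and on constants these act as on
  V, where the bracket relation is given.\<close>

lemma defect_const: "defect x z (single {#} v) = 0"
proof -
  have dec: "x = proj x + (\<Sum>a\<in>A. \<kappa> a x *\<^sub>C y a)" for x by (simp add: proj_def)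
  have left: "defect x z F = defect (proj x) z F" for x z F
  proof -
    have "defect (y a) z F = 0" if "a \<in> A" for a
      using defect_swap[of "y a" z F] defect_y[OF that] by simp
    then have "defect (\<Sum>a\<in>A. \<kappa> a x *\<^sub>C y a) z F = 0"
      by (simp add: clinearD(6)[OF clinear_defect_left] clinearD(2)[OF clinear_defect_left])
    then show ?thesis using clinearD(1)[OF clinear_defect_left, of "proj x" "\<Sum>a\<in>A. \<kappa> a x
        *\<^sub>C y a" z F] dec[of x] by simp
  qed
  have right: "defect x z F = defect x (proj z) F" for x z F
    using left[of z x F] defect_swap[of x z F] defect_swap[of x "proj z" F] by simp
  have "defect (proj x) (proj z) (single {#} v) = 0"
    using P_lie[OF proj_P proj_P, of x z]
    by (simp add: defect_def poly_rep_const proj_P act_lie single_diff)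
  then show ?thesis using left right by metis
qed

lemma defect_mul: "defect x z (mul_var a F) = mul_var a (defect x z F) + defect (lie x (y a)) z F + defect x
    (lie z (y a)) F"
proof -
  have "lie (lie x z) (y a) = lie (lie x (y a)) z + lie x (lie z (y a))"
    unfolding lie_anticommute[of "lie x z" "y a"] lie_derivation[of "y a" x z]
    by (simp add: lie_anticommute[of "y a" x] lie_anticommute[of "y a" z] lie_minus)
  then show ?thesis
    by (simp add: defect_def poly_rep_mul clinearD[OF clinear_poly_rep] clinearD[OF clinear_mul_var] poly_rep_add)
qed

lemma defect_zero: "defect x z F = 0"
proof (rule clinear_eqI[where F = "defect x z" and G = "\<lambda>F. 0"])
  show "defect x z (single m v) = 0" for m v
  proof (induction m arbitrary: x z)
    case empty then show ?case by (rule defect_const)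
  next
    case (add a m)
    then show ?case unfolding mul_var_single[symmetric] defect_mul by (simp add: clinearD[OF clinear_mul_var])
  qed
qed (intro clinear_defect clinear_zero_fun)+

lemma poly_rep_lie: "poly_rep (lie x z) F = poly_rep x (poly_rep z F) - poly_rep z (poly_rep x F)"
  using defect_zero[of x z F] by (simp add: defect_def)

end

section \<open>The universal enveloping algebra and the map from the induced module to the
  polynomials\<close>

lemma uea_incl_add: "uea_incl (x + z) = uea_incl x + uea_incl z"
  by transfer (rule gen_add)

lemma uea_incl_scale: "uea_incl (c *\<^sub>C x) = c *\<^sub>C uea_incl x"
  by transfer (rule gen_scaleC)

lemma uea_incl_lie: "uea_incl (lie x z) = uea_incl x * uea_incl z - uea_incl z * uea_incl x"
  by transfer (rule rel_sym, rule gen_lie)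

lemma scaleC_mult_free: "(c *\<^sub>C p) * q = c *\<^sub>C (p * q)" "p * (c *\<^sub>C q) = c *\<^sub>C (p * q)"
  for p q :: "'a word \<Rightarrow>\<^sub>0 complex"
proof -
  show "(c *\<^sub>C p) * q = c *\<^sub>C (p * q)" by (simp add: scaleC_free_eq mult.assoc)
  have "p * single 0 c = single 0 c * p"
  proof -
    have "(\<lambda>p. p * single 0 c) p = (\<lambda>p. single 0 c * p) p"
    proof (rule clinear_eqI[where F = "\<lambda>p. p * single 0 c" and G = "\<lambda>p. single 0 c * p"])
      have s: "single 0 c * (d *\<^sub>C p) = d *\<^sub>C (single 0 c * p)" for d and p :: "'a word
          \<Rightarrow>\<^sub>0 complex"
        unfolding scaleC_free_eq mult.assoc[symmetric] mult_single by (simp add: mult.commute)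
      show "clinear (\<lambda>p :: 'a word \<Rightarrow>\<^sub>0 complex. single 0 c * p)"
        unfolding clinear_iff by (simp add: s distrib_left)
      show "clinear (\<lambda>p :: 'a word \<Rightarrow>\<^sub>0 complex. p * single 0 c)"
        unfolding clinear_iff by (simp add: scaleC_free_eq mult.assoc distrib_right)
    qed (simp add: mult_single mult.commute)
    then show ?thesis by simp
  qed
  then show "p * (c *\<^sub>C q) = c *\<^sub>C (p * q)" by (simp add: scaleC_free_eq flip: mult.assoc)
qed

lemma uea_scale_mult: "(c *\<^sub>C u) * w = c *\<^sub>C (u * w)" "u * (c *\<^sub>C w) = c *\<^sub>C (u * w)"
  for u w :: "'a::complex_lie_algebra uea"
  by (transfer; simp add: scaleC_mult_free rel_refl)+

context abelian_complement
begin

definition word_rep :: "'a list \<Rightarrow> ('i multiset \<Rightarrow>\<^sub>0 'v) \<Rightarrow> ('i multiset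
    \<Rightarrow>\<^sub>0 'v)" where
  "word_rep ws F = foldr poly_rep ws F"

definition free_rep :: "('a word \<Rightarrow>\<^sub>0 complex) \<Rightarrow> ('i multiset
    \<Rightarrow>\<^sub>0 'v) \<Rightarrow> ('i multiset \<Rightarrow>\<^sub>0 'v)" where
  "free_rep p F = free_extend (\<lambda>w. word_rep (letters w) F) p"

lemma clinear_word_rep: "clinear (word_rep ws)"
proof (induction ws)
  case (Cons x ws)
  then show ?case using clinear_compose[OF clinear_poly_rep Cons] by (simp add: word_rep_def[abs_def])
qed (simp add: word_rep_def[abs_def] clinear_iff)

lemma clinear_free_rep_left: "clinear (\<lambda>p. free_rep p F)"
  unfolding free_rep_def using clinear_free_extend .

lemma free_rep_single: "free_rep (single w c) F = c *\<^sub>C word_rep (letters w) F"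
  by (simp add: free_rep_def free_extend_single)

lemma clinear_free_rep: "clinear (free_rep p)"
  unfolding free_rep_def[abs_def] free_extend_def
  by (intro clinear_intros clinear_word_rep)

lemma free_rep_mult: "free_rep (p * q) F = free_rep p (free_rep q F)"
proof -
  have "(\<lambda>p. free_rep (p * q) F) p = (\<lambda>p. free_rep p (free_rep q F)) p"
  proof (rule clinear_eqI[where F = "\<lambda>p. free_rep (p * q) F" and G = "\<lambda>p. free_rep p (free_rep q F)"])
    show "clinear (\<lambda>p. free_rep (p * q) F)"
      by (simp add: clinear_iff distrib_right scaleC_mult_free clinearD[OF clinear_free_rep_left])
    fix u c
    have "(\<lambda>q. free_rep (single u c * q) F) q = (\<lambda>q. free_rep (single u c) (free_rep q F)) q"
    proof (rule clinear_eqI[where F = "\<lambda>q. free_rep (single u c * q) F"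
          and G = "\<lambda>q. free_rep (single u c) (free_rep q F)"])
      show "clinear (\<lambda>q. free_rep (single u c * q) F)"
        by (simp add: clinear_iff distrib_left scaleC_mult_free clinearD[OF clinear_free_rep_left])
      show "clinear (\<lambda>q. free_rep (single u c) (free_rep q F))"
        by (rule clinear_compose[OF clinear_free_rep clinear_free_rep_left])
      show "free_rep (single u c * single w d) F
         = free_rep (single u c) (free_rep (single w d) F)" for w d
        by (simp add: mult_single free_rep_single plus_word_def word_rep_def scaleC_scaleC
            clinearD[OF clinear_word_rep, unfolded word_rep_def])
    qed
    then show "free_rep (single u c * q) F = free_rep (single u c) (free_rep q F)" by simp
  qed (rule clinear_free_rep_left)
  then show ?thesis by simp
qed

lemma free_rep_gen: "free_rep (free_gen x) F = poly_rep x F"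
  by (simp add: free_gen_def free_rep_single word_rep_def scaleC_one)

lemma uea_rel_free_rep: "uea_rel p q \<Longrightarrow> free_rep p F = free_rep q F"
proof (induction arbitrary: F rule: uea_rel.induct)
  case (gen_lie x z)
  then show ?case by (simp add: clinearD[OF clinear_free_rep_left] free_rep_mult free_rep_gen poly_rep_lie)
qed (simp_all add: clinearD[OF clinear_free_rep_left] free_rep_mult free_rep_gen poly_rep_add poly_rep_scale)

lift_definition uea_rep :: "'a uea \<Rightarrow> ('i multiset \<Rightarrow>\<^sub>0 'v) \<Rightarrow> ('i
    multiset \<Rightarrow>\<^sub>0 'v)" is free_rep
  using uea_rel_free_rep by (simp add: fun_eq_iff)

lemma clinear_uea_rep: "clinear (uea_rep u)"
  by transfer (rule clinear_free_rep)

lemma clinear_uea_rep_left: "clinear (\<lambda>u. uea_rep u F)"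
  unfolding clinear_iff by (intro conjI allI; transfer; simp add: clinearD[OF clinear_free_rep_left])

lemma uea_rep_mult: "uea_rep (u * w) F = uea_rep u (uea_rep w F)"
  by transfer (rule free_rep_mult)

lemma uea_rep_incl: "uea_rep (uea_incl x) F = poly_rep x F"
  by transfer (rule free_rep_gen)

lemma uea_rep_one: "uea_rep 1 F = F"
proof transfer
  fix F :: "'i multiset \<Rightarrow>\<^sub>0 'v"
  have "free_rep 1 F = free_rep (single 0 1) F" by simp
  also have "\<dots> = F" unfolding free_rep_single by (simp add: word_rep_def zero_word_def scaleC_one)
  finally show "free_rep 1 F = F" .
qed

definition tensor_poly :: "('a uea \<times> 'v \<Rightarrow>\<^sub>0 complex) \<Rightarrow> ('i multiset
    \<Rightarrow>\<^sub>0 'v)" where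
  "tensor_poly = free_extend (\<lambda>(u, v). uea_rep u (single {#} v))"

text \<open>Bilinearity is formal; the balancing relation over \<open>P\<close> is respected because
  on constants an element of \<open>P\<close> acts through V alone.\<close>

lemma tensor_poly_relations: "p \<in> tensor_relations P act \<Longrightarrow> tensor_poly p = 0"
proof -
  have sub: "cvec.subspace {p. tensor_poly p = 0}"
    unfolding cvec.subspace_def tensor_poly_def by (simp add: clinearD[OF clinear_free_extend])
  have "tensor_relations P act \<subseteq> {p. tensor_poly p = 0}"
    unfolding tensor_relations_def Let_def
    by (rule cvec.span_minimal[OF _ sub])
      (auto simp: tensor_poly_def clinearD[OF clinear_free_extend] free_extend_single scaleC_one
        clinearD[OF clinear_uea_rep_left] clinearD[OF clinear_uea_rep] single_add clinearD[OF clinear_single]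
        uea_rep_mult uea_rep_incl poly_rep_const)
  then show "p \<in> tensor_relations P act \<Longrightarrow> tensor_poly p = 0" by blast
qed

text \<open>Since the kernel consists of tensor relations only, u (x) v can be sent to u applied to
  the constant v. Monomials in the \<open>y a\<close> then become monomials in the variables, so
  their coefficients in V can be read off.\<close>

lemma induced_module_to_poly:
  assumes "is_induced_module P act tens uact"
  obtains \<Psi> :: "'m::complex_vector \<Rightarrow> ('i multiset \<Rightarrow>\<^sub>0 'v)"
  where "clinear \<Psi>" "\<And>v. \<Psi> (tens 1 v) = single {#} v"
    "\<And>a m. a \<in> A \<Longrightarrow> \<Psi> (uact (uea_incl (y a)) m) = mul_var a (\<Psi> m)"
proof -
  let ?q = "free_extend (\<lambda>(u, w). tens u w)"
  have surj: "surj ?q" and ker: "{p. ?q p = 0} = tensor_relations P act"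
    and ulin: "\<And>u. clinear (uact u)" and uact: "\<And>u u' w. uact u (tens u' w) = tens (u * u') w"
    using assms by (auto simp: is_induced_module_def)
  \<comment> \<open>Two preimages of a vector differ by an element of the kernel, on which
    \<open>tensor_poly\<close> vanishes, so the choice has no effect.\<close>
  define \<Psi> where "\<Psi> m = tensor_poly (SOME p. ?q p = m)" for m
  have \<Psi>: "\<Psi> (?q p) = tensor_poly p" for p
  proof -
    have "?q (SOME p'. ?q p' = ?q p) = ?q p" by (rule someI[of _ p]) simp
    then have "?q ((SOME p'. ?q p' = ?q p) - p) = 0" by (simp add: clinearD[OF clinear_free_extend])
    then have "tensor_poly ((SOME p'. ?q p' = ?q p) - p) = 0" using ker tensor_poly_relations by blast
    then show ?thesis by (simp add: \<Psi>_def tensor_poly_def clinearD[OF clinear_free_extend])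
  qed
  have lin: "clinear \<Psi>"
    unfolding clinear_iff
  proof (intro conjI allI)
    fix m m' c
    obtain p p' where "m = ?q p" "m' = ?q p'" using surj by (metis surjD)
    then show "\<Psi> (m + m') = \<Psi> m + \<Psi> m'" "\<Psi> (c *\<^sub>C m) = c *\<^sub>C \<Psi> m"
      by (simp_all add: \<Psi> tensor_poly_def clinearD[OF clinear_free_extend] flip: clinearD(1,2)[OF clinear_free_extend])
  qed
  have tens: "\<Psi> (tens u v) = uea_rep u (single {#} v)" for u v
    using \<Psi>[of "single (u, v) 1"] by (simp add: tensor_poly_def free_extend_single scaleC_one)
  have hom: "\<Psi> (uact u m) = uea_rep u (\<Psi> m)" for u m
  proof -
    obtain p where p: "m = ?q p" using surj by (metis surjD)
    have "(\<lambda>p. \<Psi> (uact u (?q p))) p = (\<lambda>p. uea_rep u (\<Psi> (?q p))) p"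
    proof (rule clinear_eqI[where F = "\<lambda>p. \<Psi> (uact u (?q p))" and G = "\<lambda>p. uea_rep u (\<Psi> (?q p))"])
      show "clinear (\<lambda>p. \<Psi> (uact u (?q p)))"
        by (intro clinear_compose[OF lin] clinear_compose[OF ulin] clinear_free_extend)
      show "clinear (\<lambda>p. uea_rep u (\<Psi> (?q p)))"
        by (intro clinear_compose[OF lin] clinear_compose[OF clinear_uea_rep] clinear_free_extend)
      show "\<Psi> (uact u (?q (single k c))) = uea_rep u (\<Psi> (?q (single k c)))" for k c
        by (cases k) (simp add: free_extend_single clinearD[OF ulin] clinearD[OF lin] uact tens uea_rep_mult
            clinearD[OF clinear_uea_rep])
    qed
    then show ?thesis using p by simp
  qed
  show ?thesis
  proof (rule that[of \<Psi>])
    show "\<Psi> (tens 1 v) = single {#} v" for v by (simp add: tens uea_rep_one)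
    show "\<Psi> (uact (uea_incl (y a)) m) = mul_var a (\<Psi> m)" if "a \<in> A" for a m
      by (simp add: hom uea_rep_incl poly_rep_y that)
  qed (rule lin)
qed

end

text \<open>These facts use the other inclusion of the kernel condition: the tensor relations become
  equations between the \<open>tens u w\<close>, and surjectivity carries them to the whole
  module.\<close>

lemma
  fixes tens :: "'a::complex_lie_algebra uea \<Rightarrow> 'v::complex_vector \<Rightarrow> 'm::complex_vector"
  assumes "is_induced_module P act tens uact"
  shows induced_uact_linear: "clinear (uact u)"
    and induced_uact_linear_left: "clinear (\<lambda>u. uact u m)"
    and induced_uact_mult: "uact (u * u') m = uact u (uact u' m)"
    and induced_uact_one: "uact 1 m = m"
    and induced_tens_linear: "clinear (tens u)"
    and induced_balanced: "x \<in> P \<Longrightarrow> uact (uea_incl x) (tens 1 w) = tens 1 (act x w)"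
proof -
  let ?q = "free_extend (\<lambda>(u, w). tens u w)"
  have surj: "surj ?q" and ker: "{p. ?q p = 0} = tensor_relations P act"
    and ulin: "\<And>u. clinear (uact u)" and uact: "\<And>u u' w. uact u (tens u' w) = tens (u * u') w"
    using assms by (auto simp: is_induced_module_def)
  have tens: "tens u w = ?q (single (u, w) 1)" for u w by (simp add: free_extend_single scaleC_one)
  have rel: "r \<in> tensor_relations P act \<Longrightarrow> ?q r = 0" for r using ker by blast
  have rels:
    "single (u + u', w) 1 - single (u, w) 1 - single (u', w) 1 \<in> tensor_relations P act"
    "single (u, w + w') 1 - single (u, w) 1 - single (u, w') 1 \<in> tensor_relations P act"
    "single (c *\<^sub>C u, w) 1 - c *\<^sub>C single (u, w) 1 \<in> tensor_relations P act"
    "single (u, c *\<^sub>C w) 1 - c *\<^sub>C single (u, w) 1 \<in> tensor_relations P act"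
    "x \<in> P \<Longrightarrow> single (u * uea_incl x, w) 1 - single (u, act x w) 1 \<in> tensor_relations P act"
    for u u' w w' c x
    unfolding tensor_relations_def Let_def by (rule cvec.span_base, blast)+
  have bilin: "tens (u + u') w = tens u w + tens u' w" "tens u (w + w') = tens u w + tens u w'"
    "tens (c *\<^sub>C u) w = c *\<^sub>C tens u w" "tens u (c *\<^sub>C w) = c *\<^sub>C tens u w"
    "x \<in> P \<Longrightarrow> tens (u * uea_incl x) w = tens u (act x w)" for u u' w w' c x
    using rel[OF rels(1)[of u u' w]] rel[OF rels(2)[of u w w']] rel[OF rels(3)[of c u w]]
      rel[OF rels(4)[of u c w]] rel[OF rels(5)[of x u w]]
    by (simp_all add: clinearD[OF clinear_free_extend] free_extend_single scaleC_one algebra_simps)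
  show "clinear (uact u)" by (rule ulin)
  show "clinear (tens u)" by (simp add: clinear_iff bilin)
  \<comment> \<open>Linear maps that agree on the pure tensors are equal, because these span the
    module.\<close>
  have ext: "F m = G m" if "clinear F" "clinear G" "\<And>u w. F (tens u w) = G (tens u w)" for F G :: "'m
      \<Rightarrow> 'm" and m
  proof -
    obtain p where p: "m = ?q p" using surj by (metis surjD)
    have "F (?q p) = G (?q p)"
    proof (rule clinear_eqI[where F = "\<lambda>p. F (?q p)" and G = "\<lambda>p. G (?q p)"])
      show "F (?q (single k c)) = G (?q (single k c))" for k c
        by (cases k) (simp add: free_extend_single clinearD[OF that(1)] clinearD[OF that(2)] that(3))
    qed (intro clinear_compose[OF _ clinear_free_extend] that)+
    then show ?thesis using p by simp
  qed
  have "uact (u + u') m = uact u m + uact u' m" for u u' m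
    by (rule ext) (auto intro!: clinear_intros ulin simp: uact distrib_right bilin)
  moreover have "uact (c *\<^sub>C u) m = c *\<^sub>C uact u m" for c u m
    by (rule ext) (auto intro!: clinear_intros ulin simp: uact uea_scale_mult bilin)
  ultimately show "clinear (\<lambda>u. uact u m)" by (simp add: clinear_iff)
  show "uact (u * u') m = uact u (uact u' m)"
    by (rule ext) (auto intro!: clinear_compose[OF ulin] ulin simp: uact mult.assoc)
  show "uact 1 m = m"
  proof (rule ext[of "uact 1" "\<lambda>m. m"])
    show "clinear (\<lambda>m :: 'm. m)" by (simp add: clinear_iff)
  qed (simp_all add: ulin uact)
  show "x \<in> P \<Longrightarrow> uact (uea_incl x) (tens 1 w) = tens 1 (act x w)"
    using bilin(5)[of x 1 w] by (simp add: uact)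
qed

section \<open>Irreducible modules of the Levi part\<close>

lemma root_vector_parabolic: "k \<in> levi_indices \<union> nil_indices \<Longrightarrow> root_vector k \<in> parabolic"
  unfolding parabolic_def using root_vector_levi root_vector_nilradical by (auto intro: cvec.span_base)

lemma levi_parabolic: "levi \<subseteq> parabolic"
  unfolding parabolic_def by (meson Un_upper1 cvec.span_superset order_trans)

lemma cartan_parabolic: "cartan \<subseteq> parabolic"
  using cartan_levi levi_parabolic by blast

lemma subspace_parabolic: "cvec.subspace parabolic"
  unfolding parabolic_def by (rule cvec.subspace_span)

lemma root_vector_bracket_levi:
  "lie (root_vector 2) (root_vector 3) = root_vector 5"
  "lie (root_vector 3) (root_vector 5) = 2 *\<^sub>C root_vector 7"
  "lie (root_vector (- 2)) (root_vector (- 3)) = - root_vector (- 5)"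
  "lie (root_vector (- 3)) (root_vector (- 5)) = - (2 *\<^sub>C root_vector (- 7))"
  "lie (root_vector 2) (root_vector (- 3)) = 0"
  "lie (root_vector 3) (root_vector (- 2)) = 0"
  by (simp_all add: root_vector_simps lie_skew_unit skew_unit_normalize lie_linear scaleC_scaleC sqrt2_sq scaleC_two)

lemma coroot_cartan: "op_vector 11 \<in> cartan" "op_vector 12 \<in> cartan" "op_vector 13 \<in> cartan"
  unfolding coroot_simps
  by (intro cvec.subspace_diff[OF subspace_cartan] cvec.subspace_scale[OF subspace_cartan] cartan_skew_unit)+

lemma coroot_eq:
  "lie (root_vector 1) (root_vector (- 1)) = op_vector 11"
  "lie (root_vector 2) (root_vector (- 2)) = op_vector 12"
  "lie (root_vector 3) (root_vector (- 3)) = op_vector 13"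
  by (simp_all add: op_vector_def)

lemma coroot_weights:
  "root_weight (- 2) (op_vector 11) = 1" "root_weight (- 2) (op_vector 12) = - 2" "root_weight (- 2) (op_vector 13) = 2"
  "root_weight (- 3) (op_vector 11) = 0" "root_weight (- 3) (op_vector 12) = 1" "root_weight (- 3) (op_vector 13) = - 2"
  by (simp_all add: coroot_simps root_weight_def root_index_simps \<epsilon>_linear, simp_all add:
      \<epsilon>_def Rep_skew_unit)

text \<open>The coefficients 2 and 1 solve the condition that both simple roots of the Levi part
  take the value 1. Each simple lowering operator thus lowers the eigenvalue by exactly one.\<close>

definition height_element :: so7 where
  "height_element = 2 *\<^sub>C skew_unit 2 2 + skew_unit 3 3"

lemma height_element_cartan: "height_element \<in> cartan"
  unfolding height_element_def
  by (intro cvec.subspace_add[OF subspace_cartan] cvec.subspace_scale[OF subspace_cartan] cartan_skew_unit)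

lemma height_element_weight: "root_weight (- 2) height_element = - 1" "root_weight (- 3) height_element = - 1"
  by (simp_all add: height_element_def root_weight_def root_index_simps \<epsilon>_linear, simp_all add:
      \<epsilon>_def Rep_skew_unit)

lemma span_invariant:
  assumes "clinear f" "\<And>z. z \<in> S \<Longrightarrow> f z \<in> cvec.span S" "z \<in> cvec.span S"
  shows "f z \<in> cvec.span S"
proof -
  have "cvec.subspace {z. f z \<in> cvec.span S}"
    by (simp add: cvec.subspace_def clinearD[OF assms(1)] cvec.span_zero cvec.span_add cvec.span_scale)
  then show ?thesis using cvec.span_minimal[of S "{z. f z \<in> cvec.span S}"] assms(2,3) by blast
qed

locale levi_module =
  fixes lam :: "so7 \<Rightarrow> complex" and act :: "so7 \<Rightarrow> 'v::complex_vector \<Rightarrow> 'v" and w :: 'v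
  assumes levi_module: "is_levi_module lam act w"
begin

lemma rep: "lie_rep_on parabolic act"
  and nil_zero: "x \<in> nilradical \<Longrightarrow> act x u = 0"
  and w_nonzero: "w \<noteq> 0"
  and w_weight: "h \<in> cartan \<Longrightarrow> act h w = lam h *\<^sub>C w"
  using levi_module by (simp_all add: is_levi_module_def)

lemma irreducible:
  assumes "cvec.subspace W" "\<And>x u. x \<in> levi \<Longrightarrow> u \<in> W \<Longrightarrow> act x u \<in> W"
  shows "W = {0} \<or> W = UNIV"
proof -
  have "\<forall>W. cvec.subspace W \<and> (\<forall>x\<in>levi. \<forall>u\<in>W. act x u \<in> W)
      \<longrightarrow> W = {0} \<or> W = UNIV"
    using levi_module unfolding is_levi_module_def by (elim conjE)
  then show ?thesis using assms by simp
qed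

lemma w_raise: "k \<in> {2, 3} \<Longrightarrow> act (root_vector k) w = 0"
proof -
  assume k: "k \<in> {2, 3}"
  have "root_vector k \<in> root_space (root_weight k)"
    using k by (intro root_vector_root_space) (auto simp: root_indices_def)
  moreover have "root_weight k \<in> levi_positive_roots" using k by (auto simp: levi_positive_roots_eq)
  moreover have "\<forall>\<alpha>\<in>levi_positive_roots. \<forall>x\<in>root_space \<alpha>. act x w = 0"
    using levi_module unfolding is_levi_module_def by (elim conjE)
  ultimately show ?thesis by simp
qed

lemma act_clinear: "x \<in> parabolic \<Longrightarrow> clinear (act x)"
  and act_add: "x \<in> parabolic \<Longrightarrow> z \<in> parabolic \<Longrightarrow> act (x + z) v = act x v + act z v"
  and act_scale: "x \<in> parabolic \<Longrightarrow> act (c *\<^sub>C x) v = c *\<^sub>C act x v"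
  and act_lie: "x \<in> parabolic \<Longrightarrow> z \<in> parabolic \<Longrightarrow> act (lie x z) v = act x
      (act z v) - act z (act x v)"
  using rep by (simp_all add: lie_rep_on_def)

lemma act_zero: "act 0 v = 0"
  using act_scale[OF cvec.subspace_0[OF subspace_parabolic], of 0 v] by simp

lemma act_minus: "x \<in> parabolic \<Longrightarrow> act (- x) v = - act x v"
  using act_scale[of x "- 1" v] by (simp add: cvec.scale_minus_left scaleC_one)

lemma act_sum: "(\<And>i. i \<in> I \<Longrightarrow> f i \<in> parabolic) \<Longrightarrow> act (sum f I) v =
    (\<Sum>i\<in>I. act (f i) v)"
  by (induction I rule: infinite_finite_induct)
    (simp_all add: act_zero act_add cvec.subspace_sum[OF subspace_parabolic])

lemma simple_parabolic: "k \<in> {2, 3, 5, 7, - 2, - 3, - 5, - 7} \<Longrightarrow> root_vector k \<in> parabolic"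
  by (rule root_vector_parabolic, rule UnI1) (simp add: levi_indices_def)

text \<open>The Levi part is spanned by the Cartan subalgebra and eight root vectors; those with
  indices 5, 7, -5 and -7 are multiples of brackets of the simple ones.\<close>

lemma levi_invariant:
  assumes W: "cvec.subspace W"
    and cartan: "\<And>h u. h \<in> cartan \<Longrightarrow> u \<in> W \<Longrightarrow> act h u \<in> W"
    and simple: "\<And>k u. k \<in> {2, 3, - 2, - 3} \<Longrightarrow> u \<in> W \<Longrightarrow> act
        (root_vector k) u \<in> W"
    and x: "x \<in> levi" and u: "u \<in> W"
  shows "act x u \<in> W"
proof -
  have bracket: "act (root_vector k) u \<in> W"
    if br: "lie (root_vector i) (root_vector j) = c *\<^sub>C root_vector k" "c \<noteq> 0"
      and p: "root_vector i \<in> parabolic" "root_vector j \<in> parabolic" "root_vector k \<in> parabolic"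
      and inv: "\<And>u. u \<in> W \<Longrightarrow> act (root_vector i) u \<in> W" "\<And>u. u \<in> W
          \<Longrightarrow> act (root_vector j) u \<in> W"
      and u: "u \<in> W" for i j k c u
  proof -
    have "act (root_vector k) u = (1 / c) *\<^sub>C act (lie (root_vector i) (root_vector j)) u"
      by (simp add: br act_scale p scaleC_scaleC scaleC_one)
    also have "\<dots> \<in> W"
      by (simp add: act_lie p inv u cvec.subspace_diff[OF W] cvec.subspace_scale[OF W])
    finally show ?thesis .
  qed
  have 5: "act (root_vector 5) u \<in> W" if "u \<in> W" for u
    by (rule bracket[of 2 3 1]) (simp_all add: simple_parabolic simple that root_vector_bracket_levi scaleC_one)
  have m5: "act (root_vector (- 5)) u \<in> W" if "u \<in> W" for u
    by (rule bracket[of "- 2" "- 3" "- 1"])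
      (simp_all add: simple_parabolic simple that root_vector_bracket_levi scaleC_one cvec.scale_minus_left)
  have 7: "act (root_vector 7) u \<in> W" if "u \<in> W" for u
    by (rule bracket[of 3 5 2]) (simp_all add: simple_parabolic simple that root_vector_bracket_levi 5)
  have m7: "act (root_vector (- 7)) u \<in> W" if "u \<in> W" for u
    by (rule bracket[of "- 3" "- 5" "- 2"])
      (simp_all add: simple_parabolic simple that root_vector_bracket_levi m5 cvec.scale_minus_left)
  have k: "act (root_vector k) u \<in> W" if "k \<in> levi_indices" for k
    using that 5[OF u] m5[OF u] 7[OF u] m7[OF u] simple[OF _ u, of k] unfolding levi_indices_def by blast
  have rp: "root_vector k \<in> parabolic" if "k \<in> levi_indices" for k
    using that root_vector_parabolic by blast
  let ?z = "\<Sum>k\<in>levi_indices. root_coord k x *\<^sub>C root_vector k"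
  have cp: "cartan_part x \<in> parabolic" using cartan_part_cartan cartan_parabolic by blast
  have zp: "?z \<in> parabolic"
    by (intro cvec.subspace_sum[OF subspace_parabolic] cvec.subspace_scale[OF subspace_parabolic] rp)
  have "act x u = act (cartan_part x + ?z) u" using levi_decompose[OF x] by simp
  also have "\<dots> = act (cartan_part x) u + act ?z u" by (rule act_add[OF cp zp])
  also have "act (\<Sum>k\<in>levi_indices. root_coord k x *\<^sub>C root_vector k) u =
      (\<Sum>k\<in>levi_indices. root_coord k x *\<^sub>C act (root_vector k) u)"
    by (subst act_sum) (auto simp: cvec.subspace_scale[OF subspace_parabolic] rp act_scale intro!: sum.cong)
  finally show ?thesis
    using cartan[OF cartan_part_cartan u] k
    by (simp add: cvec.subspace_add[OF W] cvec.subspace_sum[OF W] cvec.subspace_scale[OF W])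
qed

lemma act_cartan_root:
  assumes "h \<in> cartan" "k \<in> {2, 3, - 2, - 3}" "act h u = c *\<^sub>C u"
  shows "act h (act (root_vector k) u) = (c + root_weight k h) *\<^sub>C act (root_vector k) u"
proof -
  have k: "k \<in> root_indices" using assms(2) by (auto simp: root_indices_def)
  have p: "root_vector k \<in> parabolic" using assms(2) by (intro simple_parabolic) auto
  have "act (lie h (root_vector k)) u = root_weight k h *\<^sub>C act (root_vector k) u"
    by (simp add: lie_cartan_root_vector[OF assms(1) k] act_scale p)
  moreover have "act (lie h (root_vector k)) u = act h (act (root_vector k) u) - c *\<^sub>C act (root_vector k) u"
    using act_lie[of h "root_vector k" u] assms(1) cartan_parabolic p
    by (auto simp: assms(3) clinearD[OF act_clinear[OF p]])
  ultimately show ?thesis by (simp add: scaleC_add_left algebra_simps)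
qed

definition lower_word :: "'v \<Rightarrow> int list \<Rightarrow> 'v" where
  "lower_word u ks = foldr (\<lambda>k. act (root_vector k)) ks u"

text \<open>A product of factors \<open>height_element - (c - k)\<close>.  A large enough one kills any
    combination of vectors of
  height below that of \<open>w\<close>, but none kills \<open>w\<close>.\<close>

fun eigen_prod :: "complex \<Rightarrow> nat \<Rightarrow> 'v \<Rightarrow> 'v" where
  "eigen_prod c 0 z = z"
| "eigen_prod c (Suc n) z = act height_element (eigen_prod c n z) - (c - of_nat n) *\<^sub>C eigen_prod c n z"

lemma clinear_height: "clinear (act height_element)"
  using height_element_cartan cartan_parabolic by (intro act_clinear) blast

lemma clinear_eigen_prod: "clinear (eigen_prod c n)"
proof (induction n)
  case (Suc n)
  have "clinear (\<lambda>z. act height_element (eigen_prod c n z) - (c - of_nat n) *\<^sub>C eigen_prod c n z)"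
    by (intro clinear_intros clinear_compose[OF clinear_height] Suc)
  then show ?case by (simp add: clinear_iff)
qed (simp add: clinear_iff)

lemma eigen_prod_eigen:
  "act height_element z = d *\<^sub>C z \<Longrightarrow> eigen_prod c n z = (\<Prod>k<n. d - c + of_nat k) *\<^sub>C z"
  by (induction n)
    (simp_all add: scaleC_one clinearD[OF clinear_height] scaleC_scaleC algebra_simps
      flip: cvec.scale_left_diff_distrib scaleC_add_left)

lemma eigen_prod_mono: "eigen_prod c n z = 0 \<Longrightarrow> n \<le> m \<Longrightarrow> eigen_prod c m z = 0"
  by (induction m) (auto simp: le_Suc_eq clinearD[OF clinear_height])

text \<open>Words in the lowering operators applied to \<open>u\<close> span a submodule: a raising
  operator commutes past the letters up to Cartan elements and then kills \<open>u\<close>. The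
  heights in it are those of \<open>u\<close> minus natural numbers, so it misses \<open>w\<close>,
  and irreducibility makes it zero.\<close>

lemma no_lower_singular:
  assumes wt: "\<And>h. h \<in> cartan \<Longrightarrow> act h u = \<mu> h *\<^sub>C u"
    and sing: "act (root_vector 2) u = 0" "act (root_vector 3) u = 0"
    and lower: "\<And>n. \<mu> height_element - of_nat n \<noteq> lam height_element"
  shows "u = 0"
proof -
  define S where "S = {lower_word u ks | ks. set ks \<subseteq> {- 2, - 3}}"
  have wts: "act h (lower_word u ks) = (\<mu> h + (\<Sum>k\<leftarrow>ks. root_weight k h)) *\<^sub>C lower_word u ks"
    if "h \<in> cartan" "set ks \<subseteq> {- 2, - 3}" for h ks
    using that(2)
  proof (induction ks)
    case Nil then show ?case by (simp add: lower_word_def wt that(1))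
  next
    case (Cons k ks)
    then have k: "k \<in> {2, 3, - 2, - 3}" and ks: "set ks \<subseteq> {- 2, - 3}" by auto
    from act_cartan_root[OF that(1) k Cons.IH[OF ks]] show ?case by (simp add: lower_word_def algebra_simps)
  qed
  have par: "k \<in> {- 2, - 3, 2, 3} \<Longrightarrow> root_vector k \<in> parabolic" for k
    by (rule simple_parabolic) auto
  have span_lower: "act (root_vector k) z \<in> cvec.span S" if k: "k \<in> {- 2, - 3}" and z: "z \<in> cvec.span S" for k z
  proof (rule span_invariant[OF act_clinear _ z])
    show "root_vector k \<in> parabolic" using k by (intro par) auto
    fix z assume "z \<in> S"
    then obtain ks where ks: "set ks \<subseteq> {- 2, - 3}" "z = lower_word u ks" by (auto simp: S_def)
    then have "act (root_vector k) z = lower_word u (k # ks)" "set (k # ks) \<subseteq> {- 2, - 3}"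
      using k by (auto simp: lower_word_def)
    then have "act (root_vector k) z \<in> S" unfolding S_def by blast
    then show "act (root_vector k) z \<in> cvec.span S" by (rule cvec.span_base)
  qed
  have span_cartan: "act h z \<in> cvec.span S" if h: "h \<in> cartan" and z: "z \<in> cvec.span S" for h z
  proof (rule span_invariant[OF act_clinear _ z])
    show "h \<in> parabolic" using h cartan_parabolic by blast
    fix z assume z: "z \<in> S"
    then obtain ks where "set ks \<subseteq> {- 2, - 3}" "z = lower_word u ks" by (auto simp: S_def)
    then show "act h z \<in> cvec.span S" using wts[OF h] cvec.span_scale[OF cvec.span_base[OF z]] by simp
  qed
  have raise_word: "act (root_vector j) (lower_word u ks) \<in> cvec.span S" if j: "j \<in> {2, 3}" and ks:
      "set ks \<subseteq> {- 2, - 3}" for j ks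
    using ks
  proof (induction ks)
    case Nil then show ?case using sing j by (auto simp: lower_word_def cvec.span_zero)
  next
    case (Cons k ks)
    have k: "k \<in> {- 2, - 3}" and ks: "set ks \<subseteq> {- 2, - 3}" using Cons.prems by auto
    have jp: "root_vector j \<in> parabolic" and kp: "root_vector k \<in> parabolic" using j k by (auto intro!: par)
    have z: "lower_word u ks \<in> cvec.span S" using ks unfolding S_def by (intro cvec.span_base) blast
    have "act (lie (root_vector j) (root_vector k)) (lower_word u ks) \<in> cvec.span S"
      using j k span_cartan[OF _ z] coroot_cartan
      by (auto simp: coroot_eq root_vector_bracket_levi act_zero cvec.span_zero)
    moreover have "act (root_vector k) (act (root_vector j) (lower_word u ks)) \<in> cvec.span S"
      by (rule span_lower[OF k Cons.IH[OF ks]])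
    moreover have "act (root_vector j) (lower_word u (k # ks))
       = act (root_vector k) (act (root_vector j) (lower_word u ks)) + act (lie (root_vector j) (root_vector
           k)) (lower_word u ks)"
      by (simp add: lower_word_def act_lie jp kp)
    ultimately show ?case by (simp add: cvec.span_add)
  qed
  have span_raise: "act (root_vector j) z \<in> cvec.span S" if j: "j \<in> {2, 3}" and z: "z \<in> cvec.span S" for j z
  proof (rule span_invariant[OF act_clinear _ z])
    show "root_vector j \<in> parabolic" using j by (intro par) auto
  qed (use raise_word[OF j] in \<open>auto simp: S_def\<close>)
  have "cvec.span S = {0} \<or> cvec.span S = UNIV"
  proof (rule irreducible)
    show "act x z \<in> cvec.span S" if "x \<in> levi" "z \<in> cvec.span S" for x z
      by (rule levi_invariant[OF cvec.subspace_span span_cartan _ that]) (use span_raise span_lower in blast)+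
  qed (rule cvec.subspace_span)
  moreover have "w \<notin> cvec.span S"
  proof
    assume "w \<in> cvec.span S"
    define c where "c = \<mu> height_element"
    \<comment> \<open>No single \<open>n\<close> serves all of \<open>S\<close>, so the subspace
      consists of the vectors killed by some \<open>eigen_prod c n\<close>.\<close>
    have sub: "cvec.subspace {z. \<exists>n. eigen_prod c n z = 0}"
      unfolding cvec.subspace_def
    proof (intro conjI ballI allI)
      show "0 \<in> {z. \<exists>n. eigen_prod c n z = 0}" using clinearD(3)[OF clinear_eigen_prod] by auto
      fix p q d assume "p \<in> {z. \<exists>n. eigen_prod c n z = 0}"
      then obtain n where n: "eigen_prod c n p = 0" by auto
      then show "d *\<^sub>C p \<in> {z. \<exists>n. eigen_prod c n z = 0}"
        by (auto simp: clinearD[OF clinear_eigen_prod] intro!: exI[of _ n])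
      assume "q \<in> {z. \<exists>n. eigen_prod c n z = 0}"
      then obtain m where "eigen_prod c m q = 0" by auto
      then have "eigen_prod c (max n m) (p + q) = 0"
        using n eigen_prod_mono[of c n p "max n m"] eigen_prod_mono[of c m q "max n m"]
        by (simp add: clinearD[OF clinear_eigen_prod])
      then show "p + q \<in> {z. \<exists>n. eigen_prod c n z = 0}" by blast
    qed
    have "S \<subseteq> {z. \<exists>n. eigen_prod c n z = 0}"
    proof
      fix z assume "z \<in> S"
      then obtain ks where ks: "set ks \<subseteq> {- 2, - 3}" "z = lower_word u ks" by (auto simp: S_def)
      have "(\<Sum>k\<leftarrow>ks. root_weight k height_element) = - of_nat (length ks)"
        using ks(1) by (induction ks) (auto simp: height_element_weight)
      then have "act height_element z = (c - of_nat (length ks)) *\<^sub>C z"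
        using wts[OF height_element_cartan ks(1)] ks(2) by (simp add: c_def)
      from eigen_prod_eigen[OF this, of c "Suc (length ks)"] have "eigen_prod c (Suc (length ks)) z = 0" by simp
      then show "z \<in> {z. \<exists>n. eigen_prod c n z = 0}" by blast
    qed
    then have "w \<in> {z. \<exists>n. eigen_prod c n z = 0}"
      using cvec.span_minimal[OF _ sub] \<open>w \<in> cvec.span S\<close> by blast
    then obtain n where "eigen_prod c n w = 0" by blast
    then have "(\<Prod>k<n. lam height_element - c + of_nat k) = 0"
      using eigen_prod_eigen[OF w_weight[OF height_element_cartan], of c n] w_nonzero by simp
    then obtain k where "lam height_element - c + of_nat k = 0" by auto
    then have "\<mu> height_element - of_nat k = lam height_element" by (simp add: c_def algebra_simps)
    then show False using lower by blast
  qed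
  moreover have "u \<in> S" unfolding S_def lower_word_def by (auto intro!: exI[of _ "[]"])
  ultimately show ?thesis using cvec.span_base by blast
qed

end

section \<open>Linear combinations with polynomial coefficients\<close>

fun poly_add :: "int list \<Rightarrow> int list \<Rightarrow> int list" where
  "poly_add [] q = q"
| "poly_add p [] = p"
| "poly_add (a # p) (b # q) = (a + b) # poly_add p q"

fun poly_mult :: "int list \<Rightarrow> int list \<Rightarrow> int list" where
  "poly_mult [] q = []"
| "poly_mult (a # p) q = poly_add (map ((*) a) q) (0 # poly_mult p q)"

text \<open>Coefficients are polynomials in \<open>x1\<close>, lowest coefficient first.  Trailing zeros and
    repeated keys are
  allowed.\<close>

type_synonym 'k lincomb = "(int list \<times> 'k) list"

fun lc_insert :: "int list \<Rightarrow> 'k \<Rightarrow> 'k lincomb \<Rightarrow> 'k lincomb" where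
  "lc_insert p k [] = [(p, k)]"
| "lc_insert p k ((q, l) # L) =
     (if k = l then (poly_add p q, l) # L else (q, l) # lc_insert p k L)"

fun lc_add_scaled :: "int list \<Rightarrow> 'k lincomb \<Rightarrow> 'k lincomb \<Rightarrow> 'k lincomb" where
  "lc_add_scaled p [] acc = acc"
| "lc_add_scaled p ((q, k) # L) acc = lc_insert (poly_mult p q) k (lc_add_scaled p L acc)"

fun lc_bind :: "('k \<Rightarrow> 'l lincomb) \<Rightarrow> 'k lincomb \<Rightarrow> 'l lincomb" where
  "lc_bind f [] = []"
| "lc_bind f ((p, k) # L) = lc_add_scaled p (f k) (lc_bind f L)"

definition lc_zero :: "'k lincomb \<Rightarrow> bool" where
  "lc_zero L \<longleftrightarrow> list_all (\<lambda>(p, k). list_all (\<lambda>a. a = 0) p) L"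

text \<open>A basis of \<open>V\<close> consisting of multiples of words in \<open>g\<^sub>-\<^sub>2,
    g\<^sub>-\<^sub>3\<close> applied to \<open>w = v\<^sub>0\<close>.  Vector \<open>b\<close> has
  weight \<open>\<lambda> - m \<eta>\<^sub>2 - n \<eta>\<^sub>3\<close> for its depth \<open>(m, n)\<close>,
      and is proportional to \<open>g\<^sub>-\<^sub>i v\<^sub>a\<close> for its parent \<open>(i, a)\<close>
  (a dummy if \<open>b = 0\<close>).  Entry \<open>b\<close> of a table lists the coefficients and indices of
      the image of \<open>v\<^sub>b\<close>.\<close>

datatype levi_data = Levi_Data
  (highest: "int \<times> int")
  (depths: "(int \<times> int) list")
  (parents: "(int \<times> nat) list")
  (raise2: "(int \<times> nat) list list") (raise3: "(int \<times> nat) list list")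
  (lower2: "(int \<times> nat) list list") (lower3: "(int \<times> nat) list list")
  (lower5: "(int \<times> nat) list list") (lower7: "(int \<times> nat) list list")

definition consts_lc :: "(int \<times> nat) list \<Rightarrow> nat lincomb" where
  "consts_lc = map (\<lambda>(c, k). ([c], k))"

text \<open>The coroots act diagonally by the highest weight minus the depth times Cartan integers;
  x1 appears in coroot 11 only. Unlisted indices give the zero map, among them 1, whose root vector
  lies in the nilradical and annihilates V.\<close>

definition levi_table :: "levi_data \<Rightarrow> int \<Rightarrow> nat \<Rightarrow> nat lincomb" where
  "levi_table D r b =
     (if r = 2 then consts_lc (raise2 D ! b)
      else if r = 3 then consts_lc (raise3 D ! b)
      else if r = - 2 then consts_lc (lower2 D ! b)
      else if r = - 3 then consts_lc (lower3 D ! b)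
      else if r = - 5 then consts_lc (lower5 D ! b)
      else if r = - 7 then consts_lc (lower7 D ! b)
      else if r = 11 then [([fst (depths D ! b), 1], b)]
      else if r = 12 then [([fst (highest D) - 2 * fst (depths D ! b) + snd (depths D ! b)], b)]
      else if r = 13 then [([snd (highest D) + 2 * fst (depths D ! b) - 2 * snd (depths D ! b)], b)]
      else [])"

text \<open>Operators of degree 0 send opposite root vectors to multiples of opposite root vectors.
  Root vector 1 sends them to lowering operators of the Levi part, to coroot 11 or to 0; this is
  where the indices -5 and -7 enter.\<close>

definition bracket_table :: "int \<Rightarrow> int \<Rightarrow> (int list \<times> int) list" where
  "bracket_table r y =
    (if r = 1 then
       (if y = - 1 then [([1], 11)] else if y = - 4 then [([- 1], - 2)]
        else if y = - 6 then [([- 1], - 5)] else if y = - 8 then [([- 1], - 7)] else [])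
     else if r = 2 then (if y = - 4 then [([1], - 1)] else if y = - 9 then [([- 1], - 8)] else [])
     else if r = 3 then (if y = - 6 then [([2], - 4)] else if y = - 8 then [([- 1], - 6)] else [])
     else if r = - 2 then (if y = - 1 then [([1], - 4)] else if y = - 8 then [([- 1], - 9)] else [])
     else if r = - 3 then (if y = - 4 then [([1], - 6)] else if y = - 6 then [([- 2], - 8)] else [])
     else if r = - 5 then (if y = - 1 then [([1], - 6)] else if y = - 6 then [([- 2], - 9)] else [])
     else if r = - 7 then (if y = - 1 then [([1], - 8)] else if y = - 4 then [([- 1], - 9)] else [])
     else if r = 11 then (if y = - 1 then [([- 2], - 1)] else if y = - 9 then [] else [([- 1], y)])
     else if r = 12 then
       (if y = - 1 \<or> y = - 8 then [([1], y)] else if y = - 6 then [] else [([- 1], y)])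
     else if r = 13 then (if y = - 4 then [([2], y)] else if y = - 8 then [([- 2], y)] else [])
     else [])"

definition is_nil_op :: "int \<Rightarrow> bool" where
  "is_nil_op k \<longleftrightarrow> k = - 1 \<or> k = - 4 \<or> k = - 6 \<or> k = - 8 \<or> k = - 9"

definition lc_shift :: "int \<Rightarrow> (int list \<times> nat) lincomb \<Rightarrow> (int list \<times> nat)
    lincomb" where
  "lc_shift y = map (\<lambda>(p, ks, b). (p, insort y ks, b))"

text \<open>The opposite root vectors commute, so a sorted list is a normal form of a monomial. Any
  other operator moves to the right by the Leibniz rule, its bracket with a letter acting on the
  letters that follow.\<close>

fun act_mono :: "levi_data \<Rightarrow> int \<Rightarrow> int list \<Rightarrow> nat \<Rightarrow> (int list
    \<times> nat) lincomb" where
  "act_mono D r [] b =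
     (if is_nil_op r then [([1], [r], b)] else map (\<lambda>(p, c). (p, [], c)) (levi_table D r b))"
| "act_mono D r (y # ks) b =
     (if is_nil_op r then [([1], insort r (y # ks), b)]
      else lc_bind (\<lambda>r'. act_mono D r' ks b) (bracket_table r y) @ lc_shift y (act_mono D r ks b))"

definition act_lc :: "levi_data \<Rightarrow> int \<Rightarrow> (int list \<times> nat) lincomb \<Rightarrow>
    (int list \<times> nat) lincomb" where
  "act_lc D r = lc_bind (\<lambda>(ks, b). act_mono D r ks b)"

fun act_word :: "levi_data \<Rightarrow> int list \<Rightarrow> (int list \<times> nat) lincomb" where
  "act_word D [] = [([1], [], 0)]"
| "act_word D (r # ws) = act_lc D r (act_word D ws)"

definition act_elem :: "levi_data \<Rightarrow> (int list \<times> int list) list \<Rightarrow> (int list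
    \<times> nat) lincomb" where
  "act_elem D = lc_bind (act_word D)"

text \<open>The simple root vectors of G2 are the sum of the root vectors 1 and 3 and the root
  vector 2, with coroots 11 + 13 and 12. The first two combinations express annihilation, the others
  the eigenvalues x1 + n1 and n2.\<close>

definition singular_check ::
  "levi_data \<Rightarrow> (int list \<times> nat) lincomb \<Rightarrow> int \<Rightarrow> int \<Rightarrow> bool" where
  "singular_check D v n1 n2 \<longleftrightarrow>
     lc_zero (lc_add_scaled [1] (act_lc D 3 v) (act_lc D 1 v)) \<and>
     lc_zero (act_lc D 2 v) \<and>
     lc_zero (lc_add_scaled [- n1, - 1] v (lc_add_scaled [1] (act_lc D 13 v) (act_lc D 11 v))) \<and>
     lc_zero (lc_add_scaled [- n2] v (act_lc D 12 v))"

definition ht :: "levi_data \<Rightarrow> nat \<Rightarrow> int" where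
  "ht D b = fst (depths D ! b) + snd (depths D ! b)"

text \<open>The integer n such that the lowering operator of the parent creates n times the vector
  \<open>b\<close>. A row of any other shape gives 0, which \<open>parent_check\<close>
  rejects.\<close>

definition parent_scale :: "levi_data \<Rightarrow> nat \<Rightarrow> int" where
  "parent_scale D b = (case parents D ! b of (i, a) \<Rightarrow>
     (case levi_table D (- i) a of [([n], c)] \<Rightarrow> if c = b then n else 0 | _ \<Rightarrow> 0))"

definition parent_check :: "levi_data \<Rightarrow> nat \<Rightarrow> bool" where
  "parent_check D b \<longleftrightarrow> (case parents D ! b of (i, a) \<Rightarrow>
     a < b \<and> parent_scale D b \<noteq> 0 \<and>
     (i = 2 \<and> depths D ! b = (fst (depths D ! a) + 1, snd (depths D ! a)) \<or>
      i = 3 \<and> depths D ! b = (fst (depths D ! a), snd (depths D ! a) + 1)))"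

definition shift_check :: "levi_data \<Rightarrow> int \<Rightarrow> int \<Rightarrow> int \<Rightarrow> nat
    \<Rightarrow> bool" where
  "shift_check D r i j a \<longleftrightarrow> list_all (\<lambda>(p, c). c < length (depths D) \<and>
     depths D ! c = (fst (depths D ! a) + i, snd (depths D ! a) + j)) (levi_table D r a)"

text \<open>The Chevalley relation [e_j, f_i] = delta_ij h_i, tested on one vector.\<close>

definition relation_check :: "levi_data \<Rightarrow> int \<Rightarrow> int \<Rightarrow> nat \<Rightarrow> bool" where
  "relation_check D i j a \<longleftrightarrow>
     lc_zero (lc_add_scaled [1] (lc_bind (levi_table D j) (levi_table D (- i) a))
       (lc_add_scaled [- 1] (lc_bind (levi_table D (- i)) (levi_table D j a))
         (lc_add_scaled [- 1] (if i = j then levi_table D (10 + i) a else []) [])))"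

definition commutator_check :: "levi_data \<Rightarrow> int \<Rightarrow> int \<Rightarrow> int \<Rightarrow>
    int \<Rightarrow> nat \<Rightarrow> bool" where
  "commutator_check D n r i j a \<longleftrightarrow>
     lc_zero (lc_add_scaled [n] (levi_table D r a)
       (lc_add_scaled [1] (lc_bind (levi_table D i) (levi_table D j a))
         (lc_add_scaled [- 1] (lc_bind (levi_table D j) (levi_table D i a)) [])))"

text \<open>Weights, the relations between raising and lowering operators, and the brackets defining
  the operators -5 and -7 are tested; irreducibility turns these finite tests into a description of
  the action on V.\<close>

definition levi_check :: "levi_data \<Rightarrow> bool" where
  "levi_check D \<longleftrightarrow> (let d = length (depths D) in
     d > 0 \<and> depths D ! 0 = (0, 0) \<and> parents D ! 0 = (0, 0) \<and> levi_table D 2 0 = [] \<and>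
         levi_table D 3 0 = [] \<and>
     list_all (parent_check D) [1..<d] \<and>
     list_all (\<lambda>a. fst (depths D ! a) \<ge> 0 \<and> snd (depths D ! a) \<ge> 0 \<and>
       shift_check D 2 (- 1) 0 a \<and> shift_check D 3 0 (- 1) a \<and>
       shift_check D (- 2) 1 0 a \<and> shift_check D (- 3) 0 1 a \<and>
       shift_check D (- 5) 1 1 a \<and> shift_check D (- 7) 1 2 a \<and>
       relation_check D 2 2 a \<and> relation_check D 2 3 a \<and> relation_check D 3 2 a \<and> relation_check
           D 3 3 a \<and>
       commutator_check D 1 (- 5) (- 2) (- 3) a \<and> commutator_check D 2 (- 7) (- 3) (- 5) a) [0..<d])"

section \<open>Evaluation of linear combinations at a complex number\<close>

definition poly_eval :: "complex \<Rightarrow> int list \<Rightarrow> complex" where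
  "poly_eval x p = foldr (\<lambda>a r. of_int a + x * r) p 0"

lemma poly_eval_simps [simp]:
  "poly_eval x [] = 0" "poly_eval x (a # p) = of_int a + x * poly_eval x p"
  by (simp_all add: poly_eval_def)

lemma poly_eval_add: "poly_eval x (poly_add p q) = poly_eval x p + poly_eval x q"
  by (induction p q rule: poly_add.induct) (simp_all add: algebra_simps)

lemma poly_eval_scale: "poly_eval x (map ((*) a) q) = of_int a * poly_eval x q"
  by (induction q) (simp_all add: algebra_simps)

lemma poly_eval_mult: "poly_eval x (poly_mult p q) = poly_eval x p * poly_eval x q"
  by (induction p) (simp_all add: poly_eval_add poly_eval_scale algebra_simps)

lemma poly_eval_zero: "list_all (\<lambda>a. a = 0) p \<Longrightarrow> poly_eval x p = 0"
  by (induction p) simp_all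

definition lc_eval :: "complex \<Rightarrow> ('k \<Rightarrow> 'v::complex_vector) \<Rightarrow> 'k lincomb
    \<Rightarrow> 'v" where
  "lc_eval x T L = (\<Sum>(p, k)\<leftarrow>L. poly_eval x p *\<^sub>C T k)"

lemma lc_eval_simps [simp]:
  "lc_eval x T [] = 0" "lc_eval x T ((p, k) # L) = poly_eval x p *\<^sub>C T k + lc_eval x T L"
  "lc_eval x T (L @ L') = lc_eval x T L + lc_eval x T L'"
  by (simp_all add: lc_eval_def)

lemma lc_eval_insert: "lc_eval x T (lc_insert p k L) = poly_eval x p *\<^sub>C T k + lc_eval x T L"
  by (induction p k L rule: lc_insert.induct) (simp_all add: poly_eval_add scaleC_add_left algebra_simps)

lemma lc_eval_add_scaled: "lc_eval x T (lc_add_scaled p L acc) = poly_eval x p *\<^sub>C lc_eval x T L + lc_eval x T acc"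
  by (induction p L acc rule: lc_add_scaled.induct)
    (simp_all add: lc_eval_insert poly_eval_mult scaleC_scaleC scaleC_add_right algebra_simps)

lemma lc_eval_bind: "lc_eval x T (lc_bind f L) = lc_eval x (\<lambda>k. lc_eval x T (f k)) L"
  by (induction f L rule: lc_bind.induct) (simp_all add: lc_eval_add_scaled)

text \<open>The test demands that each coefficient vanish as a polynomial; one successful
  computation therefore serves every \<open>x\<close> and every module.\<close>

lemma lc_eval_zero: "lc_zero L \<Longrightarrow> lc_eval x T L = 0"
  by (induction L) (auto simp: lc_zero_def poly_eval_zero)

lemma lc_eval_cong: "(\<And>p k. (p, k) \<in> set L \<Longrightarrow> T k = T' k) \<Longrightarrow> lc_eval x T
    L = lc_eval x T' L"
  by (induction L) (auto, metis)

lemma lc_eval_linear: "clinear f \<Longrightarrow> f (lc_eval x T L) = lc_eval x (\<lambda>k. f (T k)) L"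
  by (induction L) (auto simp: clinearD)

lemma lc_eval_scale: "lc_eval x (\<lambda>k. c *\<^sub>C T k) L = c *\<^sub>C lc_eval x T L"
  using lc_eval_linear[OF clinear_scale_fun[of "\<lambda>v. v" c], of x T L] by (simp add: clinear_iff)

lemma lc_keys_insert: "snd ` set (lc_insert p k L) \<subseteq> insert k (snd ` set L)"
  by (induction p k L rule: lc_insert.induct) auto

lemma lc_keys_add_scaled: "snd ` set (lc_add_scaled p L acc) \<subseteq> snd ` set L \<union> snd ` set acc"
proof (induction p L acc rule: lc_add_scaled.induct)
  case (2 p q k L acc)
  then show ?case
    unfolding lc_add_scaled.simps by (intro order_trans[OF lc_keys_insert]) auto
qed simp

lemma lc_keys_bind: "snd ` set (lc_bind f L) \<subseteq> (\<Union>k\<in>snd ` set L. snd ` set (f k))"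
proof (induction f L rule: lc_bind.induct)
  case (2 f p k L)
  then show ?case
    unfolding lc_bind.simps by (intro order_trans[OF lc_keys_add_scaled]) auto
qed simp

context levi_module
begin

text \<open>Following the parents writes the vector as a multiple of a word in the lowering
  operators. The test \<open>a < b\<close> ensures termination for arbitrary data; index 0 with its
  dummy parent (0, 0) fails it and yields \<open>w\<close>.\<close>

function levi_basis :: "levi_data \<Rightarrow> nat \<Rightarrow> 'v" where
  "levi_basis D b = (case parents D ! b of (i, a) \<Rightarrow>
     if a < b then (1 / of_int (parent_scale D b)) *\<^sub>C act (root_vector (- i)) (levi_basis D a) else w)"
  by auto
termination by (relation "Wellfounded.measure snd") auto

declare levi_basis.simps [simp del]

definition weight_compatible :: "complex \<Rightarrow> levi_data \<Rightarrow> bool" where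
  "weight_compatible x D \<longleftrightarrow> lam (op_vector 11) = x \<and> lam (op_vector 12) = of_int (fst
      (highest D)) \<and>
     lam (op_vector 13) = of_int (snd (highest D))"

context
  fixes x :: complex and D :: levi_data
  assumes check: "levi_check D" and compat: "weight_compatible x D"
begin

abbreviation "ldim \<equiv> length (depths D)"
abbreviation "T \<equiv> levi_basis D"
abbreviation "ev \<equiv> lc_eval x T"

lemma check_pos: "ldim > 0" "depths D ! 0 = (0, 0)" "parents D ! 0 = (0, 0)" "levi_table D 2 0 = []" "levi_table D 3 0 = []"
  using check by (simp_all add: levi_check_def Let_def)

lemma parentE:
  assumes "b < ldim" "b \<noteq> 0"
  obtains i a where "i \<in> {2, 3}" "parents D ! b = (i, a)" "a < b" "parent_scale D b \<noteq> 0"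
    "levi_table D (- i) a = [([parent_scale D b], b)]"
    "depths D ! b = (fst (depths D ! a) + (if i = 2 then 1 else 0), snd (depths D ! a) + (if i = 3 then 1 else 0))"
proof -
  obtain i a where p: "parents D ! b = (i, a)" by force
  have "parent_check D b" using check assms by (auto simp: levi_check_def Let_def list_all_iff)
  then have *: "a < b" "parent_scale D b \<noteq> 0"
     "i = 2 \<and> depths D ! b = (fst (depths D ! a) + 1, snd (depths D ! a)) \<or>
      i = 3 \<and> depths D ! b = (fst (depths D ! a), snd (depths D ! a) + 1)"
    using p by (auto simp: parent_check_def)
  have "levi_table D (- i) a = [([parent_scale D b], b)]"
    using *(2) unfolding parent_scale_def p by (auto split: list.splits if_splits prod.splits)
  with * p show ?thesis by (intro that[of i a]) auto
qed

lemma table_checks: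
  assumes "a < ldim"
  shows "0 \<le> fst (depths D ! a)" "0 \<le> snd (depths D ! a)"
    and "shift_check D 2 (- 1) 0 a" "shift_check D 3 0 (- 1) a"
    and "shift_check D (- 2) 1 0 a" "shift_check D (- 3) 0 1 a"
    and "shift_check D (- 5) 1 1 a" "shift_check D (- 7) 1 2 a"
    and "i \<in> {2, 3} \<Longrightarrow> j \<in> {2, 3} \<Longrightarrow> relation_check D i j a"
    and "commutator_check D 1 (- 5) (- 2) (- 3) a" "commutator_check D 2 (- 7) (- 3) (- 5) a"
  using check assms by (auto simp: levi_check_def Let_def list_all_iff)

lemma T0: "T 0 = w"
  by (simp add: levi_basis.simps check_pos)

lemma T_parent:
  assumes "parents D ! b = (i, a)" "a < b" "parent_scale D b \<noteq> 0"
  shows "act (root_vector (- i)) (T a) = of_int (parent_scale D b) *\<^sub>C T b"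
  using levi_basis.simps[of D b] assms by (simp add: scaleC_scaleC scaleC_one)

lemma T_weight:
  assumes "h \<in> cartan" "b < ldim"
  shows "act h (T b) = (lam h + of_int (fst (depths D ! b)) * root_weight (- 2) h
     + of_int (snd (depths D ! b)) * root_weight (- 3) h) *\<^sub>C T b"
  using assms(2)
proof (induction b rule: less_induct)
  case (less b)
  show ?case
  proof (cases "b = 0")
    case True then show ?thesis using w_weight[OF assms(1)] by (simp add: T0 check_pos)
  next
    case False
    obtain i a where p: "i \<in> {2, 3}" "parents D ! b = (i, a)" "a < b" "parent_scale D b \<noteq> 0"
      "levi_table D (- i) a = [([parent_scale D b], b)]"
      "depths D ! b = (fst (depths D ! a) + (if i = 2 then 1 else 0), snd (depths D ! a) + (if i = 3 then 1 else 0))"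
      by (rule parentE[OF less.prems False])
    let ?c = "lam h + of_int (fst (depths D ! a)) * root_weight (- 2) h + of_int (snd (depths D ! a)) * root_weight (- 3) h"
    have IH: "act h (T a) = ?c *\<^sub>C T a" using less.IH[OF p(3)] p(3) less.prems by simp
    have hp: "h \<in> parabolic" using assms(1) cartan_parabolic by blast
    have "act h (act (root_vector (- i)) (T a)) = (?c + root_weight (- i) h) *\<^sub>C act (root_vector (- i)) (T a)"
      using p(1) by (intro act_cartan_root[OF assms(1) _ IH]) auto
    then have e: "of_int (parent_scale D b) *\<^sub>C act h (T b) = of_int (parent_scale D b) *\<^sub>C ((?c +
        root_weight (- i) h) *\<^sub>C T b)"
      unfolding T_parent[OF p(2-4)] by (simp add: clinearD[OF act_clinear[OF hp]] scaleC_scaleC mult.commute)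
    have "act h (T b) = (?c + root_weight (- i) h) *\<^sub>C T b"
      by (rule cvec.scale_left_imp_eq[OF _ e]) (simp add: p(4))
    then show ?thesis using p(1,6) by (auto simp: algebra_simps)
  qed
qed

lemma shiftD:
  assumes "shift_check D r i j a" "(p, c) \<in> set (levi_table D r a)"
  shows "c < ldim" "depths D ! c = (fst (depths D ! a) + i, snd (depths D ! a) + j)"
  using assms by (auto simp: shift_check_def list_all_iff)

lemma levi_table_coroot:
  assumes "a < ldim" "i \<in> {2, 3}"
  shows "act (lie (root_vector i) (root_vector (- i))) (T a) = ev (levi_table D (10 + i) a)"
proof -
  have "lie (root_vector i) (root_vector (- i)) = op_vector (10 + i)" using assms(2) by (auto simp: coroot_eq)
  moreover have "op_vector (10 + i) \<in> cartan" using assms(2) coroot_cartan by auto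
  ultimately show ?thesis using T_weight[OF _ assms(1), of "op_vector (10 + i)"] assms(2) compat
    by (auto simp: levi_table_def weight_compatible_def coroot_weights algebra_simps)
qed

definition table_sound :: "int \<Rightarrow> nat \<Rightarrow> bool" where
  "table_sound r a \<longleftrightarrow> act (root_vector r) (T a) = ev (levi_table D r a)"

lemma act_ev:
  assumes "root_vector r \<in> parabolic" "\<And>p c. (p, c) \<in> set L \<Longrightarrow> table_sound r c"
  shows "act (root_vector r) (ev L) = ev (lc_bind (levi_table D r) L)"
  unfolding lc_eval_linear[OF act_clinear[OF assms(1)]] lc_eval_bind
  by (rule lc_eval_cong) (use assms(2) in \<open>auto simp: table_sound_def\<close>)

text \<open>On one vector, e_j f_i = f_i e_j + [e_j, f_i]. The lowering table is used only on
  vectors occurring in e_j applied to it, so the formula is available before f_i of the vector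
  itself is known.\<close>

lemma commute_raise_lower:
  assumes "a < ldim" "i \<in> {2, 3}" "j \<in> {2, 3}" "table_sound j a" "\<And>p c. (p, c) \<in> set
      (levi_table D j a) \<Longrightarrow> table_sound (- i) c"
  shows "act (root_vector j) (act (root_vector (- i)) (T a)) = ev (lc_bind (levi_table D j) (levi_table D (- i) a))"
proof -
  have ip: "root_vector (- i) \<in> parabolic" and jp: "root_vector j \<in> parabolic"
    using assms(2,3) by (auto intro!: simple_parabolic)
  have "act (root_vector j) (act (root_vector (- i)) (T a))
     = act (root_vector (- i)) (act (root_vector j) (T a)) + act (lie (root_vector j) (root_vector (- i))) (T a)"
    by (simp add: act_lie ip jp)
  also have "act (root_vector (- i)) (act (root_vector j) (T a)) = ev (lc_bind (levi_table D (- i)) (levi_table D j a))"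
    using assms(4) act_ev[OF ip assms(5)] by (simp add: table_sound_def)
  also have "act (lie (root_vector j) (root_vector (- i))) (T a) = ev (if i = j then levi_table D (10 + i) a else [])"
    using levi_table_coroot[OF assms(1,3)] assms(2,3) by (auto simp: root_vector_bracket_levi act_zero)
  finally show ?thesis
    using lc_eval_zero[of _ x T, OF table_checks(9)[OF assms(1-3), unfolded relation_check_def]]
    by (subst eq_iff_diff_eq_0)
      (simp add: lc_eval_add_scaled cvec.scale_minus_left scaleC_one algebra_simps split del: if_split)
qed

lemma ht_shift:
  assumes "a < ldim"
  shows "r \<in> {2, 3} \<Longrightarrow> (p, c) \<in> set (levi_table D r a) \<Longrightarrow> c < ldim \<and>
      ht D c = ht D a - 1"
    "r \<in> {2, 3} \<Longrightarrow> (p, c) \<in> set (levi_table D (- r) a) \<Longrightarrow> c < ldim \<and>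
        ht D c = ht D a + 1"
  using shiftD[OF table_checks(3)[OF assms]] shiftD[OF table_checks(4)[OF assms]]
    shiftD[OF table_checks(5)[OF assms]] shiftD[OF table_checks(6)[OF assms]]
  unfolding ht_def by (auto 4 4)

text \<open>Induction on the height: the raising operators on a vector are found by commuting them past the
  lowering operator that creates it from its parent, and the difference of the two sides for a
  lowering operator is then killed by the raising operators.\<close>

lemma simple_tables_sound:
  "\<forall>a<ldim. (ht D a \<le> int n \<longrightarrow> (\<forall>j\<in>{2, 3}. table_sound j a)) \<and> (ht
      D a < int n \<longrightarrow> (\<forall>i\<in>{2, 3}. table_sound (- i) a))"
proof (induction n)
  case 0
  have "table_sound j a" if a: "a < ldim" "ht D a \<le> 0" "j \<in> {2, 3}" for a j
  proof -
    have "a = 0"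
    proof (rule ccontr)
      assume "a \<noteq> 0"
      then obtain i b where p: "i \<in> {2, 3}" "parents D ! a = (i, b)" "b < a" "parent_scale D a \<noteq> 0"
        "levi_table D (- i) b = [([parent_scale D a], a)]"
        "depths D ! a = (fst (depths D ! b) + (if i = 2 then 1 else 0), snd (depths D ! b) + (if i = 3 then 1 else 0))"
        by (rule parentE[OF a(1)])
      have "b < ldim" using p(3) a(1) by simp
      then show False using table_checks(1,2)[of b] p a(2) by (auto simp: ht_def)
    qed
    then show ?thesis using a(3) w_raise[of j] by (auto simp: table_sound_def T0 check_pos)
  qed
  moreover have "\<not> ht D a < 0" if "a < ldim" for a using table_checks(1,2)[OF that] by (simp add: ht_def)
  ultimately show ?case by auto
next
  case (Suc n)
  have IH: "table_sound j a" if "a < ldim" "ht D a \<le> int n" "j \<in> {2, 3}" for a j using Suc that by blast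
  have IH': "table_sound (- i) a" if "a < ldim" "ht D a < int n" "i \<in> {2, 3}" for a i using Suc that by blast
  have EF: "act (root_vector j) (act (root_vector (- i)) (T a)) = ev (lc_bind (levi_table D j) (levi_table D (- i) a))"
    if "a < ldim" "ht D a \<le> int n" "i \<in> {2, 3}" "j \<in> {2, 3}" for a i j
    using ht_shift(1)[OF that(1,4)] that by (intro commute_raise_lower IH IH') fastforce+
  \<comment> \<open>The raising operators come first: the vector is a multiple of a lowered parent
    of depth at most n, to which \<open>EF\<close> applies.\<close>
  have raise: "table_sound j b" if b: "b < ldim" "ht D b \<le> int (Suc n)" and j: "j \<in> {2, 3}" for b j
  proof (cases "ht D b \<le> int n")
    case True then show ?thesis using IH b j by blast
  next
    case False
    then have "b \<noteq> 0" using check_pos(2) by (intro notI) (simp add: ht_def)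
    then obtain i a where p: "i \<in> {2, 3}" "parents D ! b = (i, a)" "a < b" "parent_scale D b \<noteq> 0"
      "levi_table D (- i) a = [([parent_scale D b], b)]"
      "depths D ! b = (fst (depths D ! a) + (if i = 2 then 1 else 0), snd (depths D ! a) + (if i = 3 then 1 else 0))"
      by (rule parentE[OF b(1)])
    have jp: "root_vector j \<in> parabolic" using j by (auto intro!: simple_parabolic)
    have "ht D a \<le> int n" using p(1,6) b(2) by (auto simp: ht_def split: if_splits)
    then have "act (root_vector j) (of_int (parent_scale D b) *\<^sub>C T b) = ev (lc_bind (levi_table D j)
        [([parent_scale D b], b)])"
      using EF[of a i j] p b(1) j T_parent[OF p(2-4)] by simp
    then have e: "of_int (parent_scale D b) *\<^sub>C act (root_vector j) (T b) = of_int (parent_scale D b)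
        *\<^sub>C ev (levi_table D j b)"
      by (simp add: clinearD[OF act_clinear[OF jp]] lc_eval_add_scaled)
    show ?thesis
      unfolding table_sound_def by (rule cvec.scale_left_imp_eq[OF _ e]) (simp add: p(4))
  qed
  \<comment> \<open>The raising operators are now known up to depth n + 1, where the vectors in the
    row of the lowering operator lie.\<close>
  have lower: "table_sound (- i) a" if a: "a < ldim" "ht D a < int (Suc n)" and i: "i \<in> {2, 3}" for a i
  proof -
    define u where "u = act (root_vector (- i)) (T a) - ev (levi_table D (- i) a)"
    have ip: "root_vector (- i) \<in> parabolic" using i by (auto intro!: simple_parabolic)
    have z: "act (root_vector j) u = 0" if j: "j \<in> {2, 3}" for j
    proof -
      have jp: "root_vector j \<in> parabolic" using j by (auto intro!: simple_parabolic)
      have "act (root_vector j) (ev (levi_table D (- i) a)) = ev (lc_bind (levi_table D j) (levi_table D (- i) a))"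
        using ht_shift(2)[OF a(1) i] a(2) by (intro act_ev[OF jp] raise j) fastforce+
      then show ?thesis using EF[OF a(1) _ i j] a(2) by (simp add: u_def clinearD[OF act_clinear[OF jp]])
    qed
    let ?\<mu> = "\<lambda>h. lam h + of_int (fst (depths D ! a)) * root_weight (- 2) h + of_int (snd (depths D
        ! a)) * root_weight (- 3) h
       + root_weight (- i) h"
    have wt: "act h u = ?\<mu> h *\<^sub>C u" if h: "h \<in> cartan" for h
    proof -
      have hp: "h \<in> parabolic" using h cartan_parabolic by blast
      have "act h (act (root_vector (- i)) (T a)) = ?\<mu> h *\<^sub>C act (root_vector (- i)) (T a)"
        using i by (intro act_cartan_root[OF h _ T_weight[OF h a(1)]]) auto
      moreover have "act h (ev (levi_table D (- i) a)) = ?\<mu> h *\<^sub>C ev (levi_table D (- i) a)"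
        unfolding lc_eval_linear[OF act_clinear[OF hp]] lc_eval_scale[symmetric]
      proof (rule lc_eval_cong)
        fix p c assume c: "(p, c) \<in> set (levi_table D (- i) a)"
        show "act h (T c) = ?\<mu> h *\<^sub>C T c"
          using T_weight[OF h, of c] i shiftD[OF table_checks(5)[OF a(1)], of p c] shiftD[OF table_checks(6)[OF
              a(1)], of p c] c
          by (auto simp: algebra_simps)
      qed
      ultimately show ?thesis by (simp add: u_def clinearD[OF act_clinear[OF hp]] cvec.scale_right_diff_distrib)
    qed
    have "u = 0"
    proof (rule no_lower_singular[OF wt])
      show "act (root_vector 2) u = 0" "act (root_vector 3) u = 0" using z by auto
      fix n
      \<comment> \<open>The weight of \<open>u\<close> lies \<open>ht D a + 1\<close> steps below
        that of \<open>w\<close>, and n further lowerings add to this positive number, so the height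
        of \<open>w\<close> is never reached.\<close>
      have e1: "?\<mu> height_element - of_nat n = lam height_element - of_int (ht D a + 1 + int n)"
        using i by (auto simp: height_element_weight ht_def)
      have "ht D a + 1 + int n \<noteq> 0" using table_checks(1,2)[OF a(1)] by (simp add: ht_def)
      then have "of_int (ht D a + 1 + int n) \<noteq> (0 :: complex)" unfolding of_int_eq_0_iff .
      then show "?\<mu> height_element - of_nat n \<noteq> lam height_element"
        unfolding e1 by (metis cancel_comm_monoid_add_class.diff_zero diff_left_imp_eq)
    qed
    then show ?thesis by (simp add: u_def table_sound_def)
  qed
  show ?case using raise lower by blast
qed

lemma table_sound_simple: "a < ldim \<Longrightarrow> r \<in> {2, 3, - 2, - 3} \<Longrightarrow> table_sound r a"
proof -
  assume a: "a < ldim" and r: "r \<in> {2, 3, - 2, - 3}"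
  have "ht D a < int (Suc (nat (ht D a)))" by linarith
  then show ?thesis using simple_tables_sound[of "Suc (nat (ht D a))"] a r by auto
qed

text \<open>The action is recovered by dividing a bracket of two known operators by - n. Their
  tables are applied one after the other, so the indices in each row have to stay in range.\<close>

lemma table_sound_commutator:
  assumes a: "a < ldim" and comm: "commutator_check D n r i j a" and n: "n \<noteq> 0"
    and p: "root_vector i \<in> parabolic" "root_vector j \<in> parabolic" "root_vector r \<in> parabolic"
    and sound: "\<And>c. c < ldim \<Longrightarrow> table_sound i c \<and> table_sound j c"
    and keys: "\<And>p c. (p, c) \<in> set (levi_table D i a) \<union> set (levi_table D j a) \<Longrightarrow> c < ldim"
    and br: "lie (root_vector i) (root_vector j) = - (of_int n *\<^sub>C root_vector r)"
  shows "table_sound r a"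
proof -
  have s: "act (root_vector k) (act (root_vector l) (T a)) = ev (lc_bind (levi_table D k) (levi_table D l a))"
    if kl: "k = i \<and> l = j \<or> k = j \<and> l = i" for k l
  proof -
    have "table_sound k c" if "(q, c) \<in> set (levi_table D l a)" for q c
      using sound[OF keys, of q c] that kl by auto
    then show ?thesis using act_ev[of k "levi_table D l a"] sound[OF a] kl p by (auto simp: table_sound_def)
  qed
  have "of_int n *\<^sub>C act (root_vector r) (T a) = - act (lie (root_vector i) (root_vector j)) (T a)"
    by (simp add: br act_minus act_scale p cvec.subspace_scale[OF subspace_parabolic])
  also have "\<dots> = of_int n *\<^sub>C ev (levi_table D r a)"
    using lc_eval_zero[of _ x T, OF comm[unfolded commutator_check_def]]
    by (simp add: act_lie p s lc_eval_add_scaled cvec.scale_minus_left scaleC_one algebra_simps eq_neg_iff_add_eq_0)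
  finally have e: "of_int n *\<^sub>C act (root_vector r) (T a) = of_int n *\<^sub>C ev (levi_table D r a)" .
  show ?thesis unfolding table_sound_def by (rule cvec.scale_left_imp_eq[OF _ e]) (simp add: n)
qed

lemma table_sound_5:
  assumes a: "a < ldim"
  shows "table_sound (- 5) a"
proof (rule table_sound_commutator[OF a table_checks(10)[OF a]])
  show "c < ldim" if "(p, c) \<in> set (levi_table D (- 2) a) \<union> set (levi_table D (- 3) a)" for p c
    using that shiftD(1)[OF table_checks(5)[OF a]] shiftD(1)[OF table_checks(6)[OF a]] by auto
qed (auto simp: root_vector_bracket_levi scaleC_one intro: simple_parabolic table_sound_simple)

lemma table_sound_7:
  assumes a: "a < ldim"
  shows "table_sound (- 7) a"
proof (rule table_sound_commutator[OF a table_checks(11)[OF a]])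
  show "c < ldim" if "(p, c) \<in> set (levi_table D (- 3) a) \<union> set (levi_table D (- 5) a)" for p c
    using that shiftD(1)[OF table_checks(6)[OF a]] shiftD(1)[OF table_checks(7)[OF a]] by auto
qed (auto simp: root_vector_bracket_levi intro: simple_parabolic table_sound_simple table_sound_5)

lemma levi_table_sound:
  assumes "a < ldim" "r \<in> {2, 3, - 2, - 3, - 5, - 7, 11, 12, 13}"
  shows "act (op_vector r) (T a) = ev (levi_table D r a)"
proof (cases "r > 10")
  case True
  then have "op_vector r \<in> cartan" using assms(2) coroot_cartan by auto
  from T_weight[OF this assms(1)] True assms(2) compat show ?thesis
    by (auto simp: levi_table_def weight_compatible_def coroot_weights algebra_simps)
next
  case False
  then show ?thesis using assms table_sound_simple[of a] table_sound_5[of a] table_sound_7[of a]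
    by (auto simp: table_sound_def op_vector_root)
qed

lemma levi_table_keys:
  assumes "a < ldim" "r \<in> {2, 3, - 2, - 3, - 5, - 7, 11, 12, 13}" "(p, c) \<in> set (levi_table D r a)"
  shows "c < ldim"
proof (cases "r > 10")
  case True then show ?thesis using assms by (auto simp: levi_table_def split: if_splits)
next
  case False
  then show ?thesis using assms shiftD(1)[OF table_checks(3)[OF assms(1)]] shiftD(1)[OF table_checks(4)[OF assms(1)]]
    shiftD(1)[OF table_checks(5)[OF assms(1)]] shiftD(1)[OF table_checks(6)[OF assms(1)]]
    shiftD(1)[OF table_checks(7)[OF assms(1)]] shiftD(1)[OF table_checks(8)[OF assms(1)]] by auto
qed

end

end

section \<open>The action on the induced module\<close>

definition op_indices :: "int set" where
  "op_indices = {1, 2, 3, - 2, - 3, - 5, - 7, 11, 12, 13}"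

lemma is_nil_op_iff: "is_nil_op r \<longleftrightarrow> r \<in> opp_indices"
  by (simp add: is_nil_op_def opp_indices_def)

lemma bracket_table_sound:
  assumes "r \<in> op_indices" "y \<in> opp_indices"
  shows "lie (op_vector r) (op_vector y) = lc_eval x op_vector (bracket_table r y)"
  using assms unfolding op_indices_def opp_indices_def
  by (elim insertE emptyE; simp add: bracket_table_def op_vector_root root_vector_simps coroot_simps lie_skew_unit
      skew_unit_normalize lie_linear scaleC_scaleC sqrt2_sq scaleC_two scaleC_one cvec.scale_minus_left)

lemma bracket_table_keys:
  assumes "r \<in> op_indices" "y \<in> opp_indices"
  shows "snd ` set (bracket_table r y) \<subseteq> op_indices \<union> opp_indices"
  using assms unfolding op_indices_def opp_indices_def
  by (elim insertE emptyE; simp add: bracket_table_def)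

text \<open>Equality of sorted lists is an executable form of equality of multisets, that is, of
  commutative monomials.\<close>

definition coefficient_lc :: "int list \<Rightarrow> (int list \<times> nat) lincomb \<Rightarrow> nat lincomb" where
  "coefficient_lc m L = map (\<lambda>(p, ks, b). (p, b)) (filter (\<lambda>(p, ks, b). sort ks = sort m) L)"

text \<open>The raising operators \<open>js\<close> bring the coefficient of the monomial \<open>m\<close> back
    to a multiple of \<open>w\<close>.\<close>

definition leading_lc :: "levi_data \<Rightarrow> int list \<Rightarrow> int list \<Rightarrow> (int list
    \<times> nat) lincomb \<Rightarrow> nat lincomb" where
  "leading_lc D m js L = foldr (\<lambda>j. lc_bind (levi_table D j)) js (coefficient_lc m L)"

definition leading_check :: "levi_data \<Rightarrow> (int list \<times> nat) lincomb \<Rightarrow> int list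
    \<Rightarrow> int list \<Rightarrow> int list \<Rightarrow> bool" where
  "leading_check D L m js p \<longleftrightarrow> lc_zero (lc_add_scaled [- 1] [(p, 0)] (leading_lc D m js L))"

locale induced_levi_module = levi_module lam act w
  for lam :: "so7 \<Rightarrow> complex" and act :: "so7 \<Rightarrow> 'v::complex_vector \<Rightarrow> 'v" and w :: 'v +
  fixes tens :: "so7 uea \<Rightarrow> 'v \<Rightarrow> 'm::complex_vector" and uact :: "so7 uea \<Rightarrow>
      'm \<Rightarrow> 'm"
  assumes induced: "is_induced_module parabolic act tens uact"
begin

definition op_act :: "int \<Rightarrow> 'm \<Rightarrow> 'm" where
  "op_act r m = uact (uea_incl (op_vector r)) m"

lemma clinear_uact: "clinear (uact u)"
  and clinear_uact_left: "clinear (\<lambda>u. uact u m)"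
  and uact_mult: "uact (u * u') m = uact u (uact u' m)"
  and uact_one: "uact 1 m = m"
  and clinear_tens: "clinear (tens u)"
  and uact_parabolic: "x \<in> parabolic \<Longrightarrow> uact (uea_incl x) (tens 1 v) = tens 1 (act x v)"
  using induced_uact_linear[OF induced] induced_uact_linear_left[OF induced] induced_uact_mult[OF induced]
    induced_uact_one[OF induced] induced_tens_linear[OF induced] induced_balanced[OF induced] by auto

lemma clinear_op_act: "clinear (op_act r)"
  unfolding op_act_def[abs_def] by (rule clinear_uact)

lemma uact_lie: "uact (uea_incl (lie a b)) m = uact (uea_incl a) (uact (uea_incl b) m) - uact (uea_incl b)
    (uact (uea_incl a) m)"
  by (simp add: uea_incl_lie clinearD[OF clinear_uact_left] uact_mult)

lemma clinear_uact_incl: "clinear (\<lambda>a. uact (uea_incl a) m)"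
  by (simp add: clinear_iff uea_incl_add uea_incl_scale clinearD[OF clinear_uact_left])

lemma op_act_opp_commute:
  assumes "r \<in> opp_indices" "s \<in> opp_indices"
  shows "op_act r (op_act s m) = op_act s (op_act r m)"
proof -
  have "lie (op_vector r) (op_vector s) = 0"
    using assms opp_commute[OF assms] by (auto simp: opp_indices_def op_vector_root)
  then show ?thesis
    using uact_lie[of "op_vector r" "op_vector s" m] clinearD(3)[OF clinear_uact_incl, of m]
    by (simp add: op_act_def)
qed

lemma foldr_insort:
  assumes "y \<in> opp_indices" "set ks \<subseteq> opp_indices"
  shows "foldr op_act (insort y ks) m = op_act y (foldr op_act ks m)"
  using assms(2) by (induction ks) (auto simp: op_act_opp_commute[OF assms(1)])

context
  fixes x :: complex and D :: levi_data
  assumes check: "levi_check D" and compat: "weight_compatible x D"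
begin

definition monomial :: "int list \<times> nat \<Rightarrow> 'm" where
  "monomial = (\<lambda>(ks, b). foldr op_act ks (tens 1 (levi_basis D b)))"

definition valid :: "(int list \<times> nat) set" where
  "valid = {(ks, b). set ks \<subseteq> opp_indices \<and> b < length (depths D)}"

abbreviation "mev \<equiv> lc_eval x monomial"

lemma monomial_insort: "y \<in> opp_indices \<Longrightarrow> (ks, b) \<in> valid \<Longrightarrow> monomial
    (insort y ks, b) = op_act y (monomial (ks, b))"
  by (simp add: monomial_def valid_def foldr_insort)

lemma insort_valid: "y \<in> opp_indices \<Longrightarrow> (ks, b) \<in> valid \<Longrightarrow> (insort y ks,
    b) \<in> valid"
  by (auto simp: valid_def set_insort_key)

lemma lc_shift_sound:
  assumes "y \<in> opp_indices" "snd ` set L \<subseteq> valid"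
  shows "mev (lc_shift y L) = op_act y (mev L)" "snd ` set (lc_shift y L) \<subseteq> valid"
proof -
  show "mev (lc_shift y L) = op_act y (mev L)"
    using assms(2)
  proof (induction L)
    case (Cons a L)
    obtain p ks b where "a = (p, ks, b)" by (cases a) auto
    then show ?case using Cons monomial_insort[OF assms(1), of ks b]
      by (simp add: lc_shift_def clinearD[OF clinear_op_act])
  qed (simp add: lc_shift_def clinearD[OF clinear_op_act])
  show "snd ` set (lc_shift y L) \<subseteq> valid"
    using assms(2) insort_valid[OF assms(1)] by (force simp: lc_shift_def)
qed

lemma op_act_base:
  assumes "r \<in> op_indices" "b < length (depths D)"
  shows "op_act r (tens 1 (levi_basis D b)) = tens 1 (lc_eval x (levi_basis D) (levi_table D r b))"
proof (cases "r = 1")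
  case True
  have "root_vector 1 \<in> nilradical" "root_vector 1 \<in> parabolic"
    using root_vector_nilradical root_vector_parabolic by (auto simp: nil_indices_def)
  then have "op_act 1 (tens 1 (levi_basis D b)) = 0"
    by (simp add: op_act_def op_vector_root uact_parabolic nil_zero clinearD[OF clinear_tens])
  then show ?thesis using True by (simp add: levi_table_def clinearD[OF clinear_tens])
next
  case False
  then have r: "r \<in> {2, 3, - 2, - 3, - 5, - 7, 11, 12, 13}" using assms(1) by (auto simp: op_indices_def)
  have "op_vector r \<in> parabolic"
    using r coroot_cartan cartan_parabolic by (auto simp: op_vector_root intro!: simple_parabolic)
  then show ?thesis by (simp add: op_act_def uact_parabolic levi_table_sound[OF check compat assms(2) r])
qed

text \<open>The operator varies in the induction because a bracket acts on the remaining letters.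
  Validity of the keys is carried along: for valid keys \<open>insort\<close> is multiplication by a
  letter, and the tables describe the action.\<close>

lemma act_mono_sound:
  assumes "r \<in> op_indices \<union> opp_indices" "(ks, b) \<in> valid"
  shows "op_act r (monomial (ks, b)) = mev (act_mono D r ks b) \<and> snd ` set (act_mono D r ks b) \<subseteq> valid"
  using assms
proof (induction ks arbitrary: r)
  case Nil
  show ?case
  proof (cases "r \<in> opp_indices")
    case True then show ?thesis using Nil.prems by (simp add: is_nil_op_iff monomial_def valid_def scaleC_one)
  next
    case False
    then have r: "r \<in> op_indices" using Nil by blast
    have b: "b < length (depths D)" using Nil.prems by (simp add: valid_def)
    have ev: "mev (map (\<lambda>(p, c). (p, [], c)) L) = tens 1 (lc_eval x (levi_basis D) L)" for L
      by (induction L) (auto simp: monomial_def clinearD[OF clinear_tens])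
    have "snd ` set (map (\<lambda>(p, c). (p, [], c)) (levi_table D r b)) \<subseteq> valid"
    proof (cases "r = 1")
      case True then show ?thesis by (simp add: levi_table_def)
    next
      case False
      then have "r \<in> {2, 3, - 2, - 3, - 5, - 7, 11, 12, 13}" using r by (auto simp: op_indices_def)
      from levi_table_keys[OF check compat b this] show ?thesis by (auto simp: valid_def)
    qed
    then show ?thesis using False op_act_base[OF r b] ev by (simp add: is_nil_op_iff monomial_def)
  qed
next
  case (Cons y ks)
  have y: "y \<in> opp_indices" and v: "(ks, b) \<in> valid" using Cons.prems(2) by (auto simp: valid_def)
  show ?case
  proof (cases "r \<in> opp_indices")
    case True
    then show ?thesis using monomial_insort[OF True Cons.prems(2)] insort_valid[OF True Cons.prems(2)]
      by (simp add: is_nil_op_iff scaleC_one)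
  next
    case False
    then have r: "r \<in> op_indices" using Cons.prems by blast
    let ?B = "lc_bind (\<lambda>r'. act_mono D r' ks b) (bracket_table r y)"
    have IHr: "op_act r (monomial (ks, b)) = mev (act_mono D r ks b)" "snd ` set (act_mono D r ks b) \<subseteq> valid"
      using Cons.IH[OF Cons.prems(1) v] by auto
    have keys: "r' \<in> op_indices \<union> opp_indices" if "(p, r') \<in> set (bracket_table r y)" for p r'
      using bracket_table_keys[OF r y] that by force
    have "uact (uea_incl (lie (op_vector r) (op_vector y))) (monomial (ks, b)) = lc_eval x (\<lambda>r'. op_act
        r' (monomial (ks, b))) (bracket_table r y)"
      unfolding bracket_table_sound[OF r y, of x] lc_eval_linear[OF clinear_uact_incl] op_act_def by simp
    also have "\<dots> = mev ?B"
      unfolding lc_eval_bind by (rule lc_eval_cong) (use Cons.IH[OF keys v] in blast)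
    finally have br: "uact (uea_incl (lie (op_vector r) (op_vector y))) (monomial (ks, b)) = mev ?B" .
    have "op_act r (monomial (y # ks, b)) = op_act y (op_act r (monomial (ks, b)))
        + uact (uea_incl (lie (op_vector r) (op_vector y))) (monomial (ks, b))"
      by (simp add: monomial_def op_act_def uact_lie)
    then have "op_act r (monomial (y # ks, b)) = mev (act_mono D r (y # ks) b)"
      using False by (simp add: br IHr(1) is_nil_op_iff lc_shift_sound(1)[OF y IHr(2)] add.commute)
    moreover have "snd ` set ?B \<subseteq> valid"
      using lc_keys_bind[of "\<lambda>r'. act_mono D r' ks b" "bracket_table r y"] Cons.IH[OF keys v] by fastforce
    then have "snd ` set (act_mono D r (y # ks) b) \<subseteq> valid"
      using False lc_shift_sound(2)[OF y IHr(2)] by (simp add: is_nil_op_iff image_Un)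
    ultimately show ?thesis by blast
  qed
qed

lemma act_lc_sound:
  assumes "r \<in> op_indices \<union> opp_indices" "snd ` set L \<subseteq> valid"
  shows "op_act r (mev L) = mev (act_lc D r L)" "snd ` set (act_lc D r L) \<subseteq> valid"
proof -
  have k: "k \<in> valid" if "(p, k) \<in> set L" for p k using assms(2) that by force
  show "op_act r (mev L) = mev (act_lc D r L)"
    unfolding act_lc_def lc_eval_bind lc_eval_linear[OF clinear_op_act]
  proof (rule lc_eval_cong)
    fix p k assume "(p, k) \<in> set L"
    from k[OF this] act_mono_sound[OF assms(1), of "fst k" "snd k"]
    show "op_act r (monomial k) = mev (case k of (ks, b) \<Rightarrow> act_mono D r ks b)" by (cases k) simp
  qed
  have "(\<Union>k\<in>snd ` set L. snd ` set (case k of (ks, b) \<Rightarrow> act_mono D r ks b)) \<subseteq> valid"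
  proof (rule UN_least)
    fix k assume "k \<in> snd ` set L"
    then have "k \<in> valid" using assms(2) by blast
    then show "snd ` set (case k of (ks, b) \<Rightarrow> act_mono D r ks b) \<subseteq> valid"
      using act_mono_sound[OF assms(1), of "fst k" "snd k"] by (cases k) simp
  qed
  then show "snd ` set (act_lc D r L) \<subseteq> valid"
    unfolding act_lc_def using lc_keys_bind by (rule order_trans[rotated])
qed

definition word_act :: "int list \<Rightarrow> 'm" where
  "word_act ws = foldr op_act ws (tens 1 w)"

lemma act_word_sound:
  assumes "set ws \<subseteq> op_indices \<union> opp_indices"
  shows "word_act ws = mev (act_word D ws) \<and> snd ` set (act_word D ws) \<subseteq> valid"
  using assms
proof (induction ws)
  case Nil
  then show ?case using check_pos(1)[OF check compat] T0[OF check compat]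
    by (simp add: word_act_def monomial_def valid_def scaleC_one)
next
  case (Cons r ws)
  then have IH: "word_act ws = mev (act_word D ws)" "snd ` set (act_word D ws) \<subseteq> valid"
    and r: "r \<in> op_indices \<union> opp_indices" by auto
  have "word_act (r # ws) = op_act r (word_act ws)" by (simp add: word_act_def)
  then show ?case using act_lc_sound[OF r IH(2)] IH(1) by simp
qed

definition elem_act :: "(int list \<times> int list) list \<Rightarrow> 'm" where
  "elem_act e = lc_eval x word_act e"

definition elem_ok :: "(int list \<times> int list) list \<Rightarrow> bool" where
  "elem_ok e \<longleftrightarrow> (\<forall>(p, ws)\<in>set e. set ws \<subseteq> op_indices \<union> opp_indices)"

lemma act_elem_sound:
  assumes "elem_ok e"
  shows "elem_act e = mev (act_elem D e)" "snd ` set (act_elem D e) \<subseteq> valid"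
proof -
  have s: "word_act ws = mev (act_word D ws)" "snd ` set (act_word D ws) \<subseteq> valid" if "(p, ws) \<in>
      set e" for p ws
    using act_word_sound[of ws] assms that unfolding elem_ok_def by blast+
  show "elem_act e = mev (act_elem D e)"
    unfolding elem_act_def act_elem_def lc_eval_bind by (rule lc_eval_cong) (use s in blast)
  have "(\<Union>k\<in>snd ` set e. snd ` set (act_word D k)) \<subseteq> valid" using s by fastforce
  then show "snd ` set (act_elem D e) \<subseteq> valid"
    unfolding act_elem_def using lc_keys_bind by (rule order_trans[rotated])
qed

lemma singular_check_sound:
  assumes "singular_check D (act_elem D e) n1 n2" "elem_ok e"
  shows "op_act 1 (elem_act e) + op_act 3 (elem_act e) = 0" "op_act 2 (elem_act e) = 0"
    "op_act 11 (elem_act e) + op_act 13 (elem_act e) = (x + of_int n1) *\<^sub>C elem_act e"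
    "op_act 12 (elem_act e) = of_int n2 *\<^sub>C elem_act e"
proof -
  let ?v = "act_elem D e"
  have v: "elem_act e = mev ?v" "snd ` set ?v \<subseteq> valid" using act_elem_sound[OF assms(2)] .
  have a: "op_act r (elem_act e) = mev (act_lc D r ?v)" if "r \<in> op_indices" for r
    using act_lc_sound(1)[of r ?v] that v by simp
  have z: "mev (lc_add_scaled [1] (act_lc D 3 ?v) (act_lc D 1 ?v)) = 0" "mev (act_lc D 2 ?v) = 0"
    "mev (lc_add_scaled [- n1, - 1] ?v (lc_add_scaled [1] (act_lc D 13 ?v) (act_lc D 11 ?v))) = 0"
    "mev (lc_add_scaled [- n2] ?v (act_lc D 12 ?v)) = 0"
    using assms(1) unfolding singular_check_def by (simp_all only: lc_eval_zero)
  note s = z[unfolded lc_eval_add_scaled]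
  have ops: "1 \<in> op_indices" "2 \<in> op_indices" "3 \<in> op_indices" "11 \<in> op_indices" "12 \<in>
      op_indices" "13 \<in> op_indices"
    by (auto simp: op_indices_def)
  show "op_act 1 (elem_act e) + op_act 3 (elem_act e) = 0" "op_act 2 (elem_act e) = 0"
    using s(1,2) by (simp_all add: a ops scaleC_one add.commute)
  show "op_act 11 (elem_act e) + op_act 13 (elem_act e) = (x + of_int n1) *\<^sub>C elem_act e"
    "op_act 12 (elem_act e) = of_int n2 *\<^sub>C elem_act e"
    unfolding a[OF ops(4)] a[OF ops(5)] a[OF ops(6)] unfolding v(1)
    using s(3,4) by (simp_all add: scaleC_one cvec.scale_left_distrib
        cvec.scale_minus_left cvec.scale_left_diff_distrib eq_neg_iff_add_eq_0 add_eq_0_iff add.commute)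
qed

end

text \<open>The model asks for \<open>y a = 0\<close> outside the complement, whereas
  \<open>root_vector\<close> is nonzero at further indices; hence the case distinction.\<close>

sublocale poly: abelian_complement parabolic act opp_indices "\<lambda>k. if k \<in> opp_indices then
    root_vector k else 0" root_coord
proof (rule abelian_complement.intro)
  show "lie_rep_on parabolic act" by (rule rep)
  show "x \<in> parabolic \<longleftrightarrow> (\<forall>a\<in>opp_indices. root_coord a x = 0)" for x by
      (rule parabolic_iff)
  show "lie x z \<in> parabolic" if "x \<in> parabolic" "z \<in> parabolic" for x z using that by (rule parabolic_lie)
  show "finite opp_indices" by (simp add: opp_indices_def)
  show "clinear (root_coord a)" for a
    unfolding clinear_iff by (simp add: root_coord_linear scaleC_complex_def)
  show "root_coord a (if b \<in> opp_indices then root_vector b else 0) = (if a = b then 1 else 0)"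
    if "a \<in> opp_indices" "b \<in> opp_indices" for a b
    using root_coord_root_vector[of a b] that root_indices_split(6) by (simp add: subset_iff)
qed (auto simp: opp_commute opp_triple)

text \<open>The map to the polynomials is followed by the coefficient of one monomial and by raising
  operators. It depends on \<open>m\<close> and \<open>js\<close> but not on the vector, so that two
  vectors can be compared through it.\<close>

lemma leading_functional:
  assumes check: "levi_check D" and compat: "weight_compatible x D" and js: "set js \<subseteq> {2, 3}"
  obtains \<Phi> :: "'m \<Rightarrow> 'v" where "clinear \<Phi>"
    "\<And>L. snd ` set L \<subseteq> valid D \<Longrightarrow> \<Phi> (lc_eval x (monomial D) L) = lc_eval x
        (levi_basis D) (leading_lc D m js L)"
proof -
  obtain \<Psi> :: "'m \<Rightarrow> int multiset \<Rightarrow>\<^sub>0 'v" where lin: "clinear \<Psi>"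
    and one: "\<And>v. \<Psi> (tens 1 v) = single {#} v"
    and var: "\<And>a m. a \<in> opp_indices \<Longrightarrow> \<Psi> (uact (uea_incl (if a \<in> opp_indices
        then root_vector a else 0)) m) = poly.mul_var a (\<Psi> m)"
    using poly.induced_module_to_poly[OF induced] by metis
  have word: "\<Psi> (foldr op_act ks (tens 1 v)) = single (mset ks) v" if "set ks \<subseteq> opp_indices" for ks v
    using that
  proof (induction ks)
    case (Cons k ks)
    then have k: "k \<in> opp_indices" by simp
    then have "k \<le> 10" by (auto simp: opp_indices_def)
    then show ?case using Cons var[OF k, of "foldr op_act ks (tens 1 v)"]
      by (simp add: op_act_def[of k] op_vector_root poly.mul_var_single)
  qed (simp add: one)
  have lookup_lin: "clinear (\<lambda>F :: int multiset \<Rightarrow>\<^sub>0 'v. Poly_Mapping.lookup F M)" for M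
    by (simp add: clinear_iff lookup_add)
  define \<Phi>0 where "\<Phi>0 z = Poly_Mapping.lookup (\<Psi> z) (mset m)" for z
  have lin0: "clinear \<Phi>0" unfolding \<Phi>0_def[abs_def] by (rule clinear_compose[OF lookup_lin lin])
  have coeff: "\<Phi>0 (lc_eval x (monomial D) L) = lc_eval x (levi_basis D) (coefficient_lc m L)"
    "snd ` set (coefficient_lc m L) \<subseteq> {..<length (depths D)}" if "snd ` set L \<subseteq> valid D" for L
  proof -
    show "\<Phi>0 (lc_eval x (monomial D) L) = lc_eval x (levi_basis D) (coefficient_lc m L)"
      using that
    proof (induction L)
      case (Cons a L)
      obtain p ks b where a: "a = (p, ks, b)" by (cases a) auto
      have "set ks \<subseteq> opp_indices" using Cons.prems a by (simp add: valid_def[OF check compat])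
      then have "\<Phi>0 (monomial D (ks, b)) = (if mset ks = mset m then levi_basis D b else 0)"
        by (simp add: \<Phi>0_def monomial_def[OF check compat] word lookup_single)
      moreover have "mset ks = mset m \<longleftrightarrow> sort ks = sort m"
      proof
        assume "mset ks = mset m"
        then show "sort ks = sort m" by (intro properties_for_sort) auto
      next
        assume "sort ks = sort m"
        then have "mset (sort ks) = mset (sort m)" by simp
        then show "mset ks = mset m" by simp
      qed
      ultimately show ?case using Cons a by (simp add: coefficient_lc_def clinearD[OF lin0])
    qed (simp add: coefficient_lc_def clinearD[OF lin0])
    show "snd ` set (coefficient_lc m L) \<subseteq> {..<length (depths D)}"
      using that by (force simp: coefficient_lc_def valid_def[OF check compat])
  qed
  define \<Phi> where "\<Phi> z = foldr (\<lambda>j. act (root_vector j)) js (\<Phi>0 z)" for z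
  have jp: "clinear (act (root_vector j))" if "j \<in> {2, 3}" for j
    using that by (intro act_clinear simple_parabolic) auto
  have "clinear (\<lambda>z. foldr (\<lambda>j. act (root_vector j)) js (\<Phi>0 z))"
    using js by (induction js) (simp_all add: lin0 clinear_compose[OF jp])
  moreover have "foldr (\<lambda>j. act (root_vector j)) js (lc_eval x (levi_basis D) C)
      = lc_eval x (levi_basis D) (foldr (\<lambda>j. lc_bind (levi_table D j)) js C)
      \<and> snd ` set (foldr (\<lambda>j. lc_bind (levi_table D j)) js C) \<subseteq> {..<length (depths D)}"
    if "snd ` set C \<subseteq> {..<length (depths D)}" for C
    using js
  proof (induction js)
    case (Cons j js)
    let ?C = "foldr (\<lambda>j. lc_bind (levi_table D j)) js C"
    have j: "j \<in> {2, 3}" and IH: "foldr (\<lambda>j. act (root_vector j)) js (lc_eval x (levi_basis D) C) =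
        lc_eval x (levi_basis D) ?C"
      "snd ` set ?C \<subseteq> {..<length (depths D)}" using Cons by auto
    have k: "c < length (depths D)" if "(p, c) \<in> set ?C" for p c using IH(2) that by force
    have jr: "j \<in> {2, 3, - 2, - 3}" "j \<in> {2, 3, - 2, - 3, - 5, - 7, 11, 12, 13}" using j by auto
    have "act (root_vector j) (lc_eval x (levi_basis D) ?C) = lc_eval x (levi_basis D) (lc_bind (levi_table D j) ?C)"
    proof (rule act_ev[OF check compat])
      show "root_vector j \<in> parabolic" using j by (intro simple_parabolic) auto
      show "table_sound x D j c" if "(p, c) \<in> set ?C" for p c
        by (rule table_sound_simple[OF check compat k[OF that] jr(1)])
    qed
    moreover have "(\<Union>c\<in>snd ` set ?C. snd ` set (levi_table D j c)) \<subseteq> {..<length (depths D)}"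
      using levi_table_keys[OF check compat k jr(2)] by fastforce
    ultimately show ?case using IH(1) lc_keys_bind[of "levi_table D j" ?C] by auto
  qed (use that in simp)
  ultimately show ?thesis
    by (intro that[of \<Phi>]) (simp_all add: \<Phi>_def[abs_def] coeff leading_lc_def)
qed

lemma leading_check_sound:
  assumes "levi_check D" "weight_compatible x D" "set js \<subseteq> {2, 3}"
  obtains \<Phi> :: "'m \<Rightarrow> 'v" where "clinear \<Phi>"
    "\<And>e p. elem_ok e \<Longrightarrow> leading_check D (act_elem D e) m js p \<Longrightarrow> \<Phi>
        (elem_act x e) = poly_eval x p *\<^sub>C w"
proof -
  obtain \<Phi> :: "'m \<Rightarrow> 'v" where \<Phi>: "clinear \<Phi>"
    "\<And>L. snd ` set L \<subseteq> valid D \<Longrightarrow> \<Phi> (lc_eval x (monomial D) L) = lc_eval x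
        (levi_basis D) (leading_lc D m js L)"
    using leading_functional[OF assms] by metis
  have "\<Phi> (elem_act x e) = poly_eval x p *\<^sub>C w" if "elem_ok e" "leading_check D (act_elem D e) m js p" for e p
  proof -
    have "lc_eval x (levi_basis D) (lc_add_scaled [- 1] [(p, 0)] (leading_lc D m js (act_elem D e))) = 0"
      using that(2) unfolding leading_check_def by (rule lc_eval_zero)
    then have "lc_eval x (levi_basis D) (leading_lc D m js (act_elem D e)) = poly_eval x p *\<^sub>C w"
      unfolding lc_eval_add_scaled using T0[OF assms(1,2)]
      by (simp add: cvec.scale_minus_left scaleC_one add_eq_0_iff)
    then show ?thesis
      using \<Phi>(2)[OF act_elem_sound(2)[OF assms(1,2) that(1)]] act_elem_sound(1)[OF assms(1,2) that(1)] by simp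
  qed
  then show ?thesis using that \<Phi>(1) by blast
qed

end

section \<open>The subalgebra of type G2 and its Casimir operator\<close>

text \<open>The indices \<open>\<plusminus>1, \<dots>, \<plusminus>6\<close> are root vectors for
    \<open>\<plusminus>\<alpha>\<^sub>1, \<plusminus>\<alpha>\<^sub>2, \<plusminus>(\<alpha>\<^sub>1 +
    \<alpha>\<^sub>2), \<plusminus>(2\<alpha>\<^sub>1 + \<alpha>\<^sub>2),
  \<plusminus>(3\<alpha>\<^sub>1 + \<alpha>\<^sub>2), \<plusminus>(3\<alpha>\<^sub>1 +
      2\<alpha>\<^sub>2)\<close>, and 11, 12 are the simple coroots.\<close>

definition g2_vector :: "int \<Rightarrow> so7" where
  "g2_vector k =
    (if k = 1 then op_vector 1 + op_vector 3
     else if k = 2 then op_vector 2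
     else if k = 3 then - op_vector 4 + op_vector 5
     else if k = 4 then op_vector 6 + op_vector 7
     else if k = 5 then op_vector 8
     else if k = 6 then op_vector 9
     else if k = - 1 then op_vector (- 1) + op_vector (- 3)
     else if k = - 2 then op_vector (- 2)
     else if k = - 3 then op_vector (- 4) - op_vector (- 5)
     else if k = - 4 then op_vector (- 6) + op_vector (- 7)
     else if k = - 5 then - op_vector (- 8)
     else if k = - 6 then op_vector (- 9)
     else if k = 11 then op_vector 11 + op_vector 13
     else if k = 12 then op_vector 12
     else 0)"

text \<open>Only brackets with the four Chevalley generators are listed; arguments by generation use
  no others. In terms of indices, the basis is normalized by [2, 1] = 3, [1, 3] = 2 times 4, [1, 4]
  = 3 times 5, [2, 5] = 6, and likewise for the negative indices, which fixes the signs in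
  \<open>g2_vector\<close>.\<close>

definition g2_table :: "int \<Rightarrow> int \<Rightarrow> int lincomb" where
  "g2_table z k =
    (if z = 1 then (if k = 2 then [([- 1], 3)] else if k = 3 then [([2], 4)] else if k = 4 then [([3], 5)] else
        if k = - 1 then [([1], 11)] else if k = - 3 then [([- 3], - 2)] else if k = - 4 then [([2], - 3)] else
        if k = - 5 then [([1], - 4)] else if k = 11 then [([- 2], 1)] else if k = 12 then [([1], 1)] else [])
     else if z = 2 then (if k = 1 then [([1], 3)] else if k = 5 then [([1], 6)] else if k = - 2 then [([1],
         12)] else if k = - 3 then [([1], - 1)] else if k = - 6 then [([1], - 5)] else if k = 11 then [([3],
         2)] else if k = 12 then [([- 2], 2)] else [])
     else if z = - 1 then (if k = 1 then [([- 1], 11)] else if k = 3 then [([- 3], 2)] else if k = 4 then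
         [([2], 3)] else if k = 5 then [([1], 4)] else if k = - 2 then [([- 1], - 3)] else if k = - 3 then
         [([2], - 4)] else if k = - 4 then [([3], - 5)] else if k = 11 then [([2], - 1)] else if k = 12 then
         [([- 1], - 1)] else [])
     else if z = - 2 then (if k = 2 then [([- 1], 12)] else if k = 3 then [([1], 1)] else if k = 6 then [([1],
         5)] else if k = - 1 then [([1], - 3)] else if k = - 5 then [([1], - 6)] else if k = 11 then [([- 3], -
         2)] else if k = 12 then [([2], - 2)] else [])
     else [])"

text \<open>Six times the sum of products of dual bases with respect to the trace form of the
  seven-dimensional representation.\<close>

definition casimir_tensor :: "(int \<times> int) lincomb" where
  "casimir_tensor =
    [([1], 1, - 1), ([3], 2, - 2), ([- 1], 3, - 3), ([1], 4, - 4), ([- 3], 5, - 5), ([3], 6, - 6), ([1], - 1,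
        1), ([3], - 2, 2), ([- 1], - 3, 3), ([1], - 4, 4), ([- 3], - 5, 5), ([3], - 6, 6), ([2], 11, 11), ([3],
        11, 12), ([3], 12, 11), ([6], 12, 12)]"

definition g2_indices :: "int set" where
  "g2_indices = {1, 2, 3, 4, 5, 6, - 1, - 2, - 3, - 4, - 5, - 6, 11, 12}"

lemma g2_vector_simps:
  "g2_vector 1 = skew_unit 1 2 + sqrt2 *\<^sub>C skew_unit 3 0"
  "g2_vector 2 = skew_unit 2 3"
  "g2_vector 3 = - skew_unit 1 3 + sqrt2 *\<^sub>C skew_unit 2 0"
  "g2_vector 4 = sqrt2 *\<^sub>C skew_unit 1 0 + skew_unit 2 (- 3)"
  "g2_vector 5 = skew_unit 1 (- 3)"
  "g2_vector 6 = skew_unit 1 (- 2)"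
  "g2_vector (- 1) = skew_unit 2 1 - sqrt2 *\<^sub>C skew_unit (- 3) 0"
  "g2_vector (- 2) = skew_unit 3 2"
  "g2_vector (- 3) = skew_unit 3 1 + sqrt2 *\<^sub>C skew_unit (- 2) 0"
  "g2_vector (- 4) = - sqrt2 *\<^sub>C skew_unit (- 1) 0 - skew_unit (- 2) 3"
  "g2_vector (- 5) = skew_unit (- 1) 3"
  "g2_vector (- 6) = - skew_unit (- 1) 2"
  "g2_vector 11 = skew_unit 1 1 - skew_unit 2 2 + 2 *\<^sub>C skew_unit 3 3"
  "g2_vector 12 = skew_unit 2 2 - skew_unit 3 3"
  by (simp_all add: g2_vector_def op_vector_root root_vector_simps coroot_simps cvec.scale_minus_left algebra_simps)

lemma scaleC_three: "3 *\<^sub>C x = x + x + x" for x :: "'a::complex_vector"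
  using scaleC_add_left[of 2 1 x] by (simp add: scaleC_one scaleC_two)

lemma scaleC_double: "(2 * c) *\<^sub>C x = c *\<^sub>C x + c *\<^sub>C x" for x :: "'a::complex_vector"
  unfolding mult_2 by (rule scaleC_add_left)

lemma g2_bracket:
  assumes "z \<in> {1, 2, - 1, - 2}" "k \<in> g2_indices"
  shows "lie (g2_vector z) (g2_vector k) = lc_eval x g2_vector (g2_table z k)"
proof -
  have "\<forall>z\<in>{1, 2, - 1, - 2}. \<forall>k\<in>g2_indices. lie (g2_vector z) (g2_vector k) = lc_eval x
      g2_vector (g2_table z k)"
    unfolding g2_indices_def ball_simps
    by (simp add: g2_table_def g2_vector_simps lie_linear lie_skew_unit neq_7 skew_unit_normalize scaleC_scaleC
        sqrt2_sq scaleC_two scaleC_three cvec.scale_minus_left scaleC_add_right cvec.scale_right_diff_distrib scaleC_one)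
      (simp only: scaleC_double minus_add_distrib diff_conv_add_uminus minus_minus simp_thms)
  then show ?thesis using assms by blast
qed

lemma g2_coroots:
  "lie (g2_vector 1) (g2_vector (- 1)) = g2_vector 11"
  "lie (g2_vector 2) (g2_vector (- 2)) = g2_vector 12"
  "lie (g2_vector 3) (g2_vector (- 3)) = - g2_vector 11 - 3 *\<^sub>C g2_vector 12"
  "lie (g2_vector 4) (g2_vector (- 4)) = 2 *\<^sub>C g2_vector 11 + 3 *\<^sub>C g2_vector 12"
  "lie (g2_vector 5) (g2_vector (- 5)) = - g2_vector 11 - g2_vector 12"
  "lie (g2_vector 6) (g2_vector (- 6)) = g2_vector 11 + 2 *\<^sub>C g2_vector 12"
  by (simp_all add: g2_vector_simps lie_linear lie_skew_unit neq_7 skew_unit_normalize scaleC_scaleC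
        sqrt2_sq scaleC_two scaleC_three cvec.scale_minus_left scaleC_add_right cvec.scale_right_diff_distrib scaleC_one)

text \<open>The derivation ad z applied to both factors of the tensor. That it vanishes is an
  integer computation, and it makes the Casimir operator commute with z in any
  representation.\<close>

definition casimir_derivative :: "int \<Rightarrow> (int \<times> int) lincomb" where
  "casimir_derivative z = lc_bind (\<lambda>(i, j). map (\<lambda>(p, k). (p, k, j)) (g2_table z i) @ map
      (\<lambda>(p, k). (p, i, k)) (g2_table z j))
     casimir_tensor"

lemma casimir_invariant: "list_all (\<lambda>z. lc_zero (casimir_derivative z)) [1, 2, - 1, - 2]"
  by code_simp

text \<open>\<open>\<epsilon> 1 = \<epsilon> 2 + \<epsilon> 3\<close> is the equation of the Cartan
  subalgebra of G2 inside that of so(7); the root vectors satisfy it because their diagonal is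
  zero.\<close>

lemma g2_vector_trace: "k \<in> g2_indices \<Longrightarrow> \<epsilon> 1 (g2_vector k) = \<epsilon> 2
    (g2_vector k) + \<epsilon> 3 (g2_vector k)"
proof -
  have "\<forall>k\<in>g2_indices. \<epsilon> 1 (g2_vector k) = \<epsilon> 2 (g2_vector k) + \<epsilon> 3 (g2_vector k)"
    unfolding g2_indices_def ball_simps g2_vector_simps cvec.scale_minus_left[symmetric] \<epsilon>_linear
    by (simp add: \<epsilon>_linear \<epsilon>_def Rep_skew_unit neq_7 uminus_so7.rep_eq plus_so7.rep_eq
        minus_so7.rep_eq scaleC_so7.rep_eq mscale_def)
  then show "k \<in> g2_indices \<Longrightarrow> \<epsilon> 1 (g2_vector k) = \<epsilon> 2 (g2_vector k) +
      \<epsilon> 3 (g2_vector k)" by blast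
qed

lemma lie_generated_least:
  assumes "cvec.subspace L" "S \<subseteq> L" "\<And>x y. x \<in> L \<Longrightarrow> y \<in> L
      \<Longrightarrow> lie x y \<in> L"
  shows "lie_generated S \<subseteq> L"
  using assms unfolding lie_generated_def by blast

definition g2_span :: "so7 set" where
  "g2_span = cvec.span (g2_vector ` g2_indices)"

lemma g2_span_bracket:
  assumes "z \<in> {1, 2, - 1, - 2}" "x \<in> g2_span"
  shows "lie (g2_vector z) x \<in> g2_span"
proof -
  have sub: "cvec.subspace {x. lie (g2_vector z) x \<in> g2_span}"
    by (simp add: cvec.subspace_def lie_linear g2_span_def cvec.span_zero cvec.span_add cvec.span_scale)
  have keys: "\<forall>z\<in>{1, 2, - 1, - 2}. \<forall>k\<in>g2_indices. list_all (\<lambda>(p, l). l \<in>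
      g2_indices) (g2_table z k)"
    unfolding g2_indices_def ball_simps by (simp add: g2_table_def)
  have ev: "lc_eval x g2_vector L \<in> g2_span" if "list_all (\<lambda>(p, l). l \<in> g2_indices) L" for x L
    using that
  proof (induction L)
    case (Cons a L)
    then show ?case
      unfolding g2_span_def
      by (cases a) (simp add: cvec.span_add[OF cvec.span_scale[OF cvec.span_base]])
  qed (simp add: g2_span_def cvec.span_zero)
  have "lie (g2_vector z) (g2_vector k) \<in> g2_span" if k: "k \<in> g2_indices" for k
    unfolding g2_bracket[OF assms(1) k, of 0] by (rule ev) (rule keys[rule_format, OF assms(1) k])
  then have "g2_vector ` g2_indices \<subseteq> {x. lie (g2_vector z) x \<in> g2_span}" by blast
  then have "g2_span \<subseteq> {x. lie (g2_vector z) x \<in> g2_span}"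
    using cvec.span_minimal[OF _ sub] unfolding g2_span_def by blast
  then show ?thesis using assms(2) by blast
qed

text \<open>The equation leaves \<open>\<epsilon> 1\<close> and \<open>\<epsilon> 2\<close> free.
  For a times the coroot 11 plus b times the coroot 12 they are a and b - a, which gives the
  coefficients.\<close>

lemma g2_span_cartan:
  assumes "x \<in> g2_span" "x \<in> cartan"
  shows "x = \<epsilon> 1 x *\<^sub>C g2_vector 11 + (\<epsilon> 1 x + \<epsilon> 2 x) *\<^sub>C g2_vector 12"
proof -
  have sub: "cvec.subspace {x. \<epsilon> 1 x = \<epsilon> 2 x + \<epsilon> 3 x}"
    by (simp add: cvec.subspace_def \<epsilon>_linear, simp add: \<epsilon>_def zero_so7.rep_eq algebra_simps)
  have "g2_span \<subseteq> {x. \<epsilon> 1 x = \<epsilon> 2 x + \<epsilon> 3 x}"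
    unfolding g2_span_def by (rule cvec.span_minimal[OF _ sub]) (auto simp: g2_vector_trace)
  then have e: "\<epsilon> 3 x = \<epsilon> 1 x - \<epsilon> 2 x" using assms(1) by (auto simp: algebra_simps)
  have "x = cartan_part x"
    using so7_decompose[of x] root_coord_cartan[OF assms(2)] by simp
  also have "\<dots> = \<epsilon> 1 x *\<^sub>C g2_vector 11 + (\<epsilon> 1 x + \<epsilon> 2 x) *\<^sub>C g2_vector 12"
    by (simp add: cartan_part_def e g2_vector_simps algebra_simps scaleC_two scaleC_add_left scaleC_add_right
        cvec.scale_left_diff_distrib cvec.scale_right_diff_distrib)
  finally show ?thesis .
qed

locale g2_embedding =
  fixes gb :: "int \<Rightarrow> 'g::complex_lie_algebra" and \<iota> :: "'g \<Rightarrow> so7"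
  assumes chevalley: "is_G2_chevalley gb" and embedding: "is_G2_embedding gb \<iota>"
begin

lemma generated: "lie_generated {gb 1, gb (- 1), gb 2, gb (- 2)} = UNIV"
  using chevalley unfolding is_G2_chevalley_def Let_def by (elim conjE)

lemma clinear_\<iota>: "clinear \<iota>" and \<iota>_lie: "\<iota> (lie a b) = lie (\<iota> a) (\<iota> b)"
  using embedding by (simp_all add: is_G2_embedding_def lie_hom_def)

lemma \<iota>_gens: "\<iota> (gb 1) = g2_vector 1" "\<iota> (gb 2) = g2_vector 2" "\<iota> (gb (- 1)) =
    g2_vector (- 1)" "\<iota> (gb (- 2)) = g2_vector (- 2)"
  using embedding by (simp_all add: is_G2_embedding_def g2_vector_def op_vector_root)

lemma generator_induct:
  assumes "cvec.subspace L" "\<And>z. z \<in> {1, 2, - 1, - 2} \<Longrightarrow> gb z \<in> L" "\<And>x y. x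
      \<in> L \<Longrightarrow> y \<in> L \<Longrightarrow> lie x y \<in> L"
  shows "x \<in> L"
  using lie_generated_least[OF assms(1), of "{gb 1, gb (- 1), gb 2, gb (- 2)}"] assms(2,3) generated by auto

lemma \<iota>_gen: "z \<in> {1, 2, - 1, - 2} \<Longrightarrow> \<iota> (gb z) = g2_vector z"
  using \<iota>_gens by auto

text \<open>Brackets between arbitrary basis vectors are not tabulated. Instead, the elements whose
  image preserves the span form a subalgebra by the Jacobi identity, and it contains the
  generators.\<close>

lemma stable: "u \<in> g2_span \<Longrightarrow> lie (\<iota> x) u \<in> g2_span"
proof -
  have "x \<in> {x. \<forall>u\<in>g2_span. lie (\<iota> x) u \<in> g2_span}"
  proof (rule generator_induct)
    show "cvec.subspace {x. \<forall>u\<in>g2_span. lie (\<iota> x) u \<in> g2_span}"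
      by (simp add: cvec.subspace_def clinearD[OF clinear_\<iota>] lie_linear g2_span_def cvec.span_zero
          cvec.span_add cvec.span_scale)
    show "gb z \<in> {x. \<forall>u\<in>g2_span. lie (\<iota> x) u \<in> g2_span}" if "z \<in> {1, 2, - 1, - 2}" for z
      using g2_span_bracket[OF that] \<iota>_gen[OF that] by simp
    fix x y assume "x \<in> {x. \<forall>u\<in>g2_span. lie (\<iota> x) u \<in> g2_span}" "y \<in> {x.
        \<forall>u\<in>g2_span. lie (\<iota> x) u \<in> g2_span}"
    moreover have "lie (\<iota> (lie x y)) u = lie (\<iota> x) (lie (\<iota> y) u) - lie (\<iota> y) (lie
        (\<iota> x) u)" for u
      using lie_derivation[of "\<iota> x" "\<iota> y" u] by (simp add: \<iota>_lie)
    ultimately show "lie x y \<in> {x. \<forall>u\<in>g2_span. lie (\<iota> x) u \<in> g2_span}"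
      unfolding g2_span_def by (simp add: cvec.span_diff)
  qed
  then show "u \<in> g2_span \<Longrightarrow> lie (\<iota> x) u \<in> g2_span" by blast
qed

lemma \<iota>_span: "\<iota> x \<in> g2_span"
proof -
  have "x \<in> {x. \<iota> x \<in> g2_span}"
  proof (rule generator_induct)
    show "cvec.subspace {x. \<iota> x \<in> g2_span}"
      by (simp add: cvec.subspace_def clinearD[OF clinear_\<iota>] g2_span_def cvec.span_zero cvec.span_add cvec.span_scale)
    show "gb z \<in> {x. \<iota> x \<in> g2_span}" if "z \<in> {1, 2, - 1, - 2}" for z
      using that \<iota>_gen[OF that] unfolding g2_span_def by (auto intro!: cvec.span_base simp: g2_indices_def)
  qed (simp add: \<iota>_lie stable)
  then show ?thesis by blast
qed

end

locale g2_module = g2_embedding gb \<iota> + induced_levi_module lam act w tens uact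
  for gb :: "int \<Rightarrow> 'g::complex_lie_algebra" and \<iota> :: "'g \<Rightarrow> so7"
    and lam :: "so7 \<Rightarrow> complex" and act :: "so7 \<Rightarrow> 'v::complex_vector \<Rightarrow> 'v" and w :: 'v
    and tens :: "so7 uea \<Rightarrow> 'v \<Rightarrow> 'm::complex_vector" and uact :: "so7 uea \<Rightarrow>
        'm \<Rightarrow> 'm"
begin

section \<open>The Casimir operator and highest weight vectors of G2\<close>

definition so7_act :: "so7 \<Rightarrow> 'm \<Rightarrow> 'm" where
  "so7_act a m = uact (uea_incl a) m"

lemma clinear_so7_act: "clinear (so7_act a)"
  unfolding so7_act_def[abs_def] by (rule clinear_uact)

lemma clinear_so7_act_left: "clinear (\<lambda>a. so7_act a m)"
  unfolding so7_act_def by (rule clinear_uact_incl)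

lemma so7_act_lie: "so7_act (lie a b) m = so7_act a (so7_act b m) - so7_act b (so7_act a m)"
  unfolding so7_act_def by (rule uact_lie)

lemma g2_act_eq: "g2_act \<iota> uact x m = so7_act (\<iota> x) m"
  by (simp add: g2_act_def so7_act_def)

definition casimir :: "'m \<Rightarrow> 'm" where
  "casimir m = lc_eval 0 (\<lambda>(i, j). so7_act (g2_vector i) (so7_act (g2_vector j) m)) casimir_tensor"

lemma clinear_lc_eval: "(\<And>k. clinear (\<lambda>m. f k m)) \<Longrightarrow> clinear (\<lambda>m. lc_eval x
    (\<lambda>k. f k m) L)"
  by (induction L) (auto intro!: clinear_intros)

lemma clinear_casimir: "clinear casimir"
  unfolding casimir_def[abs_def]
proof (rule clinear_lc_eval)
  show "clinear (\<lambda>m. case k of (i, j) \<Rightarrow> so7_act (g2_vector i) (so7_act (g2_vector j) m))" for k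
    by (cases k) (simp add: clinear_compose[OF clinear_so7_act clinear_so7_act])
qed

text \<open>Moving the generator through both factors turns its commutator with the Casimir operator
  into an evaluation of \<open>casimir_derivative z\<close>, which vanishes.\<close>

lemma casimir_commute_generator:
  assumes z: "z \<in> {1, 2, - 1, - 2}"
  shows "so7_act (g2_vector z) (casimir m) = casimir (so7_act (g2_vector z) m)"
proof -
  let ?P = "\<lambda>(i, j). so7_act (g2_vector i) (so7_act (g2_vector j) m)"
  have keys: "\<forall>(p, i, j)\<in>set casimir_tensor. i \<in> g2_indices \<and> j \<in> g2_indices"
    by (simp add: casimir_tensor_def g2_indices_def)
  have br: "so7_act (lie (g2_vector z) (g2_vector i)) m' = lc_eval 0 (\<lambda>k. so7_act (g2_vector k) m') (g2_table z i)"
    if "i \<in> g2_indices" for i m'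
    unfolding g2_bracket[OF z that, of 0] by (rule lc_eval_linear[OF clinear_so7_act_left])
  have m1: "lc_eval 0 ?P (map (\<lambda>(p, k). (p, k, j)) L) = lc_eval 0 (\<lambda>k. so7_act (g2_vector k)
      (so7_act (g2_vector j) m)) L"
    for j L by (induction L) auto
  have m2: "lc_eval 0 ?P (map (\<lambda>(p, k). (p, i, k)) L) = so7_act (g2_vector i) (lc_eval 0 (\<lambda>k.
      so7_act (g2_vector k) m) L)"
    for i L by (induction L) (auto simp: clinearD[OF clinear_so7_act])
  have "lc_eval 0 (\<lambda>(i, j). so7_act (g2_vector z) (so7_act (g2_vector i) (so7_act (g2_vector j) m))
        - so7_act (g2_vector i) (so7_act (g2_vector j) (so7_act (g2_vector z) m))) casimir_tensor
      = lc_eval 0 ?P (casimir_derivative z)"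
    unfolding casimir_derivative_def lc_eval_bind
  proof (rule lc_eval_cong)
    fix p k assume k: "(p, k) \<in> set casimir_tensor"
    obtain i j where ij: "k = (i, j)" by force
    have i: "i \<in> g2_indices" and j: "j \<in> g2_indices" using keys k ij by auto
    show "(case k of (i, j) \<Rightarrow> so7_act (g2_vector z) (so7_act (g2_vector i) (so7_act (g2_vector j) m))
        - so7_act (g2_vector i) (so7_act (g2_vector j) (so7_act (g2_vector z) m)))
      = lc_eval 0 ?P (case k of (i, j) \<Rightarrow> map (\<lambda>(p, k). (p, k, j)) (g2_table z i) @ map
          (\<lambda>(p, k). (p, i, k)) (g2_table z j))"
      using br[OF i, of "so7_act (g2_vector j) m", symmetric] br[OF j, of m, symmetric]
      by (simp add: ij m1 m2 so7_act_lie clinearD[OF clinear_so7_act])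
  qed
  also have "\<dots> = 0" using casimir_invariant z by (auto intro!: lc_eval_zero)
  finally show ?thesis
    unfolding casimir_def lc_eval_linear[OF clinear_so7_act]
    by (subst eq_iff_diff_eq_0) (simp add: casimir_tensor_def clinearD[OF clinear_so7_act] algebra_simps
        cvec.scale_right_diff_distrib)
qed

lemma casimir_commute: "casimir (g2_act \<iota> uact x m) = g2_act \<iota> uact x (casimir m)"
proof -
  have "x \<in> {x. \<forall>m. casimir (so7_act (\<iota> x) m) = so7_act (\<iota> x) (casimir m)}"
  proof (rule generator_induct)
    show "cvec.subspace {x. \<forall>m. casimir (so7_act (\<iota> x) m) = so7_act (\<iota> x) (casimir m)}"
      by (simp add: cvec.subspace_def clinearD[OF clinear_\<iota>] clinearD[OF clinear_so7_act_left]
          clinearD[OF clinear_casimir])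
    show "gb z \<in> {x. \<forall>m. casimir (so7_act (\<iota> x) m) = so7_act (\<iota> x) (casimir m)}" if "z
        \<in> {1, 2, - 1, - 2}" for z
      using casimir_commute_generator[OF that] \<iota>_gen[OF that] by simp
  qed (simp add: \<iota>_lie so7_act_lie clinearD[OF clinear_casimir])
  then show ?thesis by (simp add: g2_act_eq)
qed

definition highest_weight_vector :: "complex \<Rightarrow> complex \<Rightarrow> 'm \<Rightarrow> bool" where
  "highest_weight_vector a b v \<longleftrightarrow> so7_act (g2_vector 1) v = 0 \<and> so7_act (g2_vector 2) v = 0 \<and>
     so7_act (g2_vector 11) v = a *\<^sub>C v \<and> so7_act (g2_vector 12) v = b *\<^sub>C v"

text \<open>The elements annihilating \<open>v\<close> form a subalgebra, which contains the two
  simple root vectors and hence all they generate. A diagonal element of the image is a combination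
  of the two coroots and acts by a scalar.\<close>

lemma highest_weight_singular:
  assumes "highest_weight_vector a b v"
  shows "singular_vector (g2_borel gb \<iota>) (g2_act \<iota> uact) v"
proof -
  have pos: "so7_act (\<iota> x) v = 0" if "x \<in> lie_generated {gb 1, gb 2}" for x
  proof -
    have "lie_generated {gb 1, gb 2} \<subseteq> {x. so7_act (\<iota> x) v = 0}"
    proof (rule lie_generated_least)
      show "cvec.subspace {x. so7_act (\<iota> x) v = 0}"
        by (simp add: cvec.subspace_def clinearD[OF clinear_\<iota>] clinearD[OF clinear_so7_act_left])
      show "{gb 1, gb 2} \<subseteq> {x. so7_act (\<iota> x) v = 0}" using assms by (simp add: \<iota>_gens
          highest_weight_vector_def)
    qed (simp add: \<iota>_lie so7_act_lie clinearD[OF clinear_so7_act])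
    then show ?thesis using that by blast
  qed
  have cart: "so7_act (\<iota> x) v \<in> cvec.span {v}" if "\<iota> x \<in> cartan" for x
  proof -
    have "so7_act (\<iota> x) v = so7_act (\<epsilon> 1 (\<iota> x) *\<^sub>C g2_vector 11 + (\<epsilon> 1
        (\<iota> x) + \<epsilon> 2 (\<iota> x)) *\<^sub>C g2_vector 12) v"
      using g2_span_cartan[OF \<iota>_span that] by simp
    also have "\<dots> = (\<epsilon> 1 (\<iota> x) * a + (\<epsilon> 1 (\<iota> x) + \<epsilon> 2 (\<iota> x))
        * b) *\<^sub>C v"
      using assms by (simp add: clinearD[OF clinear_so7_act_left] highest_weight_vector_def scaleC_scaleC
          scaleC_add_left distrib_right)
    also have "\<dots> \<in> cvec.span {v}" by (intro cvec.span_scale cvec.span_base) simp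
    finally show ?thesis .
  qed
  have "g2_borel gb \<iota> \<subseteq> {x. so7_act (\<iota> x) v \<in> cvec.span {v}}"
    unfolding g2_borel_def
  proof (rule cvec.span_minimal)
    show "cvec.subspace {x. so7_act (\<iota> x) v \<in> cvec.span {v}}"
      by (simp add: cvec.subspace_def clinearD[OF clinear_\<iota>] clinearD[OF clinear_so7_act_left]
          cvec.span_zero cvec.span_add cvec.span_scale)
    show "\<iota> -` cartan \<union> lie_generated {gb 1, gb 2} \<subseteq> {x. so7_act (\<iota> x) v \<in> cvec.span {v}}"
      using cart pos by (auto simp: cvec.span_zero)
  qed
  then show ?thesis
    unfolding singular_vector_def g2_act_eq
    by (auto simp: cvec.span_singleton clinearD[OF clinear_so7_act] intro!: rangeI cvec.span_scale)
qed

text \<open>Six times (mu, mu + 2 rho), where mu has the values a and b on the simple coroots. The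
  quadratic part comes from the last four terms of \<open>casimir_tensor\<close>; 10 a + 18 b
  collects the coroots arising when positive root vectors are moved past negative ones.\<close>

definition casimir_value :: "complex \<Rightarrow> complex \<Rightarrow> complex" where
  "casimir_value a b = 2 * a^2 + 6 * a * b + 6 * b^2 + 10 * a + 18 * b"

lemma casimir_highest_weight:
  assumes "highest_weight_vector a b v"
  shows "casimir v = casimir_value a b *\<^sub>C v"
proof -
  note hw = assms[unfolded highest_weight_vector_def]
  have br: "so7_act (lie (g2_vector i) (g2_vector j)) v = 0"
    if "so7_act (g2_vector i) v = 0" "so7_act (g2_vector j) v = 0" for i j
    by (simp add: so7_act_lie that clinearD[OF clinear_so7_act])
  have e3: "so7_act (g2_vector 3) v = 0"
    using br[of 2 1] hw g2_bracket[of 2 1 0] by (simp add: g2_indices_def g2_table_def scaleC_one)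
  have e4: "so7_act (g2_vector 4) v = 0"
    using br[of 1 3] hw e3 g2_bracket[of 1 3 0] by (simp add: g2_indices_def g2_table_def clinearD[OF clinear_so7_act_left])
  have e5: "so7_act (g2_vector 5) v = 0"
    using br[of 1 4] hw e4 g2_bracket[of 1 4 0] by (simp add: g2_indices_def g2_table_def clinearD[OF clinear_so7_act_left])
  have e6: "so7_act (g2_vector 6) v = 0"
    using br[of 2 5] hw e5 g2_bracket[of 2 5 0] by (simp add: g2_indices_def g2_table_def scaleC_one)
  have ef: "so7_act (g2_vector i) (so7_act (g2_vector j) v) = so7_act (lie (g2_vector i) (g2_vector j)) v"
    if "so7_act (g2_vector i) v = 0" for i j
    by (simp add: so7_act_lie that clinearD[OF clinear_so7_act])
  show ?thesis
    using hw e3 e4 e5 e6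
    by (simp add: casimir_def casimir_tensor_def ef g2_coroots clinearD[OF clinear_so7_act] clinearD[OF
        clinear_so7_act_left]
        casimir_value_def scaleC_scaleC power2_eq_square flip: scaleC_add_left cvec.scale_left_diff_distrib
            cvec.scale_minus_left)
qed

lemma generated_submodule_casimir:
  assumes "highest_weight_vector a b v"
  shows "generated_submodule (g2_act \<iota> uact) v \<subseteq> {u. casimir u = casimir_value a b *\<^sub>C u}"
proof -
  have "cvec.subspace {u. casimir u = casimir_value a b *\<^sub>C u}"
    by (simp add: cvec.subspace_def clinearD[OF clinear_casimir] scaleC_add_right scaleC_scaleC mult.commute)
  moreover have "g2_act \<iota> uact x u \<in> {u. casimir u = casimir_value a b *\<^sub>C u}"
    if "u \<in> {u. casimir u = casimir_value a b *\<^sub>C u}" for x u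
    using that by (simp add: casimir_commute) (simp add: g2_act_eq clinearD[OF clinear_so7_act])
  ultimately show ?thesis
    unfolding generated_submodule_def using casimir_highest_weight[OF assms] by blast
qed

lemma zero_intersection:
  assumes "highest_weight_vector a b v" "highest_weight_vector a' b' v'" "casimir_value a b \<noteq> casimir_value a' b'"
  shows "generated_submodule (g2_act \<iota> uact) v \<inter> generated_submodule (g2_act \<iota> uact) v' = {0}"
proof -
  have "0 \<in> generated_submodule (g2_act \<iota> uact) v" for v
    unfolding generated_submodule_def by (auto simp: cvec.subspace_0)
  moreover have "u = 0" if "u \<in> generated_submodule (g2_act \<iota> uact) v" "u \<in> generated_submodule
      (g2_act \<iota> uact) v'" for u
  proof -
    have "casimir_value a b *\<^sub>C u = casimir_value a' b' *\<^sub>C u"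
      using subsetD[OF generated_submodule_casimir[OF assms(1)] that(1)]
        subsetD[OF generated_submodule_casimir[OF assms(2)] that(2)] by simp
    then show ?thesis using assms(3) by simp
  qed
  ultimately show ?thesis by auto
qed

end

section \<open>The five families of singular vectors\<close>

text \<open>\<open>(N, e, (n1, n2), leads)\<close>: the combination \<open>e\<close> of words is
    \<open>N\<close> times the element of \<open>U(so(7))\<close>; the simple
  coroots act on the resulting vector by \<open>x1 + n1\<close> and \<open>n2\<close>; each \<open>(m, js,
      p)\<close> in \<open>leads\<close> asserts that the
  coefficient of the monomial \<open>m\<close>, raised by \<open>js\<close>, is \<open>p w\<close>.\<close>

type_synonym singular_entry =
  "int \<times> (int list \<times> int list) list \<times> (int \<times> int) \<times> (int list \<times> int
      list \<times> int list) list"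

definition entry_check :: "levi_data \<Rightarrow> singular_entry \<Rightarrow> bool" where
  "entry_check D = (\<lambda>(N, e, (n1, n2), leads). N \<noteq> 0 \<and>
     list_all (\<lambda>(p, ws). list_all (\<lambda>r. is_nil_op r \<or> r = - 2 \<or> r = - 3) ws) e \<and>
     (let v = act_elem D e in singular_check D v n1 n2 \<and>
       list_all (\<lambda>(m, js, p). list_all (\<lambda>j. j = 2 \<or> j = 3) js \<and> leading_check D v m js p) leads))"

text \<open>The five tables describe so(5)-modules: the vector representation of dimension 5, the
  spin representation of dimension 4, the traceless symmetric square of the vector representation of
  dimension 14, the module of dimension 16 with both fundamental labels 1, and the adjoint
  representation of dimension 10.\<close>

definition levi_data1 :: levi_data where
  "levi_data1 = Levi_Data (1, 0)
     [(0, 0), (1, 0), (1, 1), (1, 2), (2, 2)]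
     [(0, 0), (2, 0), (3, 1), (3, 2), (2, 3)]
     [[], [(1, 0)], [], [], [(1, 3)]]
     [[], [], [(1, 1)], [(1, 2)], []]
     [[(1, 1)], [], [], [(1, 4)], []]
     [[], [(2, 2)], [(2, 3)], [], []]
     [[(2, 2)], [], [(-2, 4)], [], []]
     [[(-2, 3)], [(-2, 4)], [], [], []]"

definition levi_data2 :: levi_data where
  "levi_data2 = Levi_Data (0, 1)
     [(0, 0), (0, 1), (1, 1), (1, 2)]
     [(0, 0), (3, 0), (2, 1), (3, 2)]
     [[], [], [(1, 1)], []]
     [[], [(1, 0)], [], [(1, 2)]]
     [[], [(1, 2)], [], []]
     [[(1, 1)], [], [(1, 3)], []]
     [[(-1, 2)], [(1, 3)], [], []]
     [[(1, 3)], [], [], []]"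

definition levi_data3 :: levi_data where
  "levi_data3 = Levi_Data (2, 0)
     [(0, 0), (1, 0), (2, 0), (1, 1), (2, 1), (1, 2), (2, 2), (2, 2), (3, 2), (2, 3), (3, 3), (2, 4), (3, 4), (4, 4)]
     [(0, 0), (2, 0), (2, 1), (3, 1), (3, 2), (3, 3), (3, 4), (2, 5), (2, 6), (3, 6), (3, 8), (3, 9), (3, 10), (2, 12)]
     [[], [(1, 0)], [(1, 1)], [], [(1, 3)], [], [(1, 5)], [(2, 5)], [(1, 7)], [], [(1, 9)], [], [(2, 11)], [(1, 12)]]
     [[], [], [], [(1, 1)], [(2, 2)], [(1, 3)], [(3, 4)], [(1, 4)], [], [(1, 6)], [(1, 8)], [(1, 9)], [(1, 10)], []]
     [[(2, 1)], [(2, 2)], [], [(1, 4)], [], [(1, 7)], [(1, 8)], [(2, 8)], [], [(1, 10)], [], [(1, 12)], [(2, 13)], []]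
     [[], [(2, 3)], [(2, 4)], [(2, 5)], [(2, 6)], [], [(6, 9)], [(2, 9)], [(2, 10)], [(4, 11)], [(2, 12)], [], [], []]
     [[(4, 3)], [(2, 4)], [], [(2, 6), (-2, 7)], [(-2, 8)], [(2, 9)], [(-4, 10)], [(2, 10)], [], [(-2, 12)],
         [(-4, 13)], [], [], []]
     [[(-4, 5)], [(-2, 7)], [(-2, 8)], [(-2, 9)], [(-2, 10)], [(-4, 11)], [(-2, 12)], [(-4, 12)], [(-4, 13)],
         [], [], [], [], []]"

definition levi_data4 :: levi_data where
  "levi_data4 = Levi_Data (1, 1)
     [(0, 0), (1, 0), (0, 1), (1, 1), (1, 1), (2, 1), (1, 2), (1, 2), (2, 2), (2, 2), (1, 3), (2, 3), (2, 3),
         (3, 3), (2, 4), (3, 4)]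
     [(0, 0), (2, 0), (3, 0), (3, 1), (2, 2), (2, 3), (3, 3), (3, 4), (3, 5), (2, 6), (3, 6), (3, 8), (3, 9),
         (2, 11), (3, 11), (3, 13)]
     [[], [(1, 0)], [], [(1, 2)], [(2, 2)], [(1, 4)], [], [], [(1, 7)], [(1, 6)], [], [(1, 10)], [(3, 10)],
         [(-1, 11), (1, 12)], [], [(1, 14)]]
     [[], [], [(1, 0)], [(3, 1)], [(1, 1)], [], [(1, 3)], [(1, 3), (1, 4)], [(3, 5)], [(1, 5)], [(1, 6)], [(1,
         8)], [(1, 8), (1, 9)], [], [(1, 11)], [(1, 13)]]
     [[(1, 1)], [], [(1, 4)], [(1, 5)], [(2, 5)], [], [(1, 9)], [(1, 8)], [], [], [(-1, 11), (1, 12)], [(1,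
         13)], [(3, 13)], [], [(1, 15)], []]
     [[(1, 2)], [(1, 3)], [], [(4, 6)], [(1, 7)], [(1, 8)], [(3, 10)], [(4, 10)], [(4, 11)], [(1, 12)], [],
         [(3, 14)], [(4, 14)], [(1, 15)], [], []]
     [[(1, 3), (-1, 4)], [(-1, 5)], [(1, 7)], [(1, 8), (-4, 9)], [(1, 8)], [], [(3, 11), (-2, 12)], [(8, 11),
         (-4, 12)], [(-4, 13)], [(-3, 13)], [(1, 14)], [(-2, 15)], [(-1, 15)], [], [], []]
     [[(-2, 6), (1, 7)], [(1, 8), (-2, 9)], [(-2, 10)], [(4, 11), (-2, 12)], [(2, 11), (-2, 12)], [(-2, 13)],
         [(1, 14)], [(-2, 14)], [(-2, 15)], [(1, 15)], [], [], [], [], [], []]"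

definition levi_data5 :: levi_data where
  "levi_data5 = Levi_Data (0, 2)
     [(0, 0), (0, 1), (1, 1), (0, 2), (1, 2), (1, 2), (2, 2), (1, 3), (2, 3), (2, 4)]
     [(0, 0), (3, 0), (2, 1), (3, 1), (3, 2), (2, 3), (2, 4), (3, 4), (3, 6), (3, 8)]
     [[], [], [(1, 1)], [], [(1, 3)], [(2, 3)], [(1, 5)], [], [(1, 7)], []]
     [[], [(1, 0)], [], [(1, 1)], [(1, 2)], [(1, 2)], [], [(1, 4)], [(1, 6)], [(1, 8)]]
     [[], [(1, 2)], [], [(1, 5)], [(1, 6)], [(2, 6)], [], [(1, 8)], [], []]
     [[(2, 1)], [(2, 3)], [(2, 4)], [], [(2, 7)], [(2, 7)], [(2, 8)], [], [(2, 9)], []]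
     [[(-2, 2)], [(2, 4), (-2, 5)], [(-2, 6)], [(2, 7)], [], [(2, 8)], [], [(2, 9)], [], []]
     [[(4, 4), (-2, 5)], [(2, 7)], [(2, 8)], [], [(2, 9)], [], [], [], [], []]"

text \<open>The factor \<open>N\<close> clears the denominators of the coefficients. In this family
  and the next every lead is a nonzero constant, so independence has no exceptions.\<close>

definition singular_entries1 :: "singular_entry list" where
  "singular_entries1 =
    [(1, [([1], [])],
      (0, 1), [([], [], [1])]),
     (1, [([-2, -1], [-3, -2]), ([-4], [-4]), ([2], [-2, -1])],
      (1, 0), [([-4], [], [-2])]),
     (1, [([0, 2, 1], [-3, -3, -2]), ([-1, 1], [-6]), ([-1, -2], [-1, -3, -2]), ([-2], [-4, -1]),
        ([2], [-1, -1, -2])],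
      (-1, 1), [([-4, -1], [], [-2])])]"

definition singular_entries2 :: "singular_entry list" where
  "singular_entries2 =
    [(1, [([1], [])],
      (1, 0), [([], [], [1])]),
     (1, [([0, -1], [-3]), ([1], [-1])],
      (-1, 1), [([-1], [], [1])]),
     (1, [([5, 2], [-3, -2, -3]), ([-1], [-6]), ([2], [-4, -3]), ([-2], [-1, -2, -3])],
      (0, 0), [([-6], [], [-1])])]"

text \<open>For the last two vectors the first lead vanishes at x1 = - 7 and at x1 = - 7/2
  respectively; a second monomial covers these values.\<close>

definition singular_entries3 :: "singular_entry list" where
  "singular_entries3 =
    [(1, [([1], [])],
      (0, 2), [([], [], [1])]),
     (1, [([-4], [-4]), ([-3, -1], [-3, -2]), ([2], [-1, -2])],
      (1, 1), [([-4], [], [-4])]),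
     (1, [([-4, 4], [-6]), ([-8], [-4, -1]), ([0, 6, 2], [-3, -3, -2]), ([-4, -4], [-1, -3, -2]),
        ([4], [-1, -1, -2])],
      (-1, 2), [([-4, -1], [], [-8])]),
     (1, [([-20, -10], [-4, -3, -2]), ([20], [-4, -1, -2]), ([-20], [-4, -4]),
        ([-6, -5, -1], [-3, -3, -2, -2]), ([6, 5, 1], [-2, -3, -3, -2]), ([10, 5], [-1, -3, -2, -2]),
        ([-10], [-1, -1, -2, -2])],
      (2, 0), [([-4, -4], [], [-20])]),
     (2, [([96, 96, 24], [-9]), ([48, 48, 12], [-8, -2]), ([-336, 120, 24], [-6, -4]),
        ([-144, 0, 48, 6], [-6, -3, -2]), ([168, -60, -12], [-6, -1, -2]),
        ([-24, 144, 102, 12], [-4, -3, -3, -2]), ([-168, -276, -36], [-4, -1, -3, -2]),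
        ([336, 48], [-4, -1, -1, -2]), ([-336, -48], [-4, -4, -1]),
        ([0, 42, 41, 12, 1], [-3, -3, -3, -2, -2]), ([-36, -108, -57, -6], [-1, -3, -3, -2, -2]),
        ([48, 36, 6], [-1, -2, -3, -3, -2]), ([-168, -24], [-1, -1, -1, -2, -2]),
        ([84, 138, 18], [-1, -1, -3, -2, -2])],
      (0, 1), [([-4, -4, -1], [], [-336, -48]), ([-9], [], [96, 96, 24])]),
     (6, [([96, 144, 48], [-9, -1]), ([672, -432, -144], [-8, -4]),
        ([336, -72, -216, -48], [-8, -3, -2]), ([-288, 288, 96], [-8, -1, -2]),
        ([-1008, 48, 96], [-6, -4, -1]), ([-168, 204, 72, -84, -24], [-6, -3, -3, -2]),
        ([-144, -360, 72, 48], [-6, -1, -3, -2]), ([504, -24, -48], [-6, -1, -1, -2]),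
        ([-336, 168, 0, -24], [-6, -6]), ([-192, -72, 168, 48], [-4, -1, -3, -3, -2]),
        ([336, 96], [-4, -1, -1, -1, -2]), ([168, -288, -96], [-4, -1, -1, -3, -2]),
        ([-336, -96], [-4, -4, -1, -1]), ([0, 42, 5, -30, -15, -2], [-3, -3, -3, -3, -2, -2]),
        ([-28, -50, 30, 40, 8], [-1, -3, -3, -3, -2, -2]), ([-168, -48], [-1, -1, -1, -1, -2, -2]),
        ([-84, 144, 48], [-1, -1, -1, -3, -2, -2]), ([48, 12, -84, -24], [-1, -1, -3, -3, -2, -2]),
        ([48, 24], [-1, -1, -2, -3, -3, -2])],
      (-2, 2), [([-4, -4, -1, -1], [], [-336, -96]), ([-9, -1], [], [96, 144, 48])])]"

text \<open>Entries 3 and 4 have the same weight (0, 1). Their leads are taken at the same two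
  monomials and form the two by two matrix that decides their independence.\<close>

definition singular_entries4 :: "singular_entry list" where
  "singular_entries4 =
    [(1, [([1], [])],
      (1, 1), [([], [], [1])]),
     (1, [([0, -1], [-3]), ([1], [-1])],
      (-1, 2), [([-1], [], [1])]),
     (1, [([5], [-1, -2]), ([-4, -2], [-3, -2]), ([2, 1], [-2, -3]), ([-5], [-4])],
      (2, 0), [([-4], [], [-5])]),
     (6, [([0, 16, 10, 1], [-3, -3, -2]), ([0, -6, -3], [-3, -2, -3]), ([-18, 8, 1], [-6]),
        ([-6, 20, 4], [-4, -3]), ([-18, -32, -4], [-1, -3, -2]), ([-42, -6], [-4, -1]),
        ([42, 6], [-1, -1, -2]), ([12, 6], [-1, -2, -3])],
      (0, 1), [([-4, -1], [], [-42, -6]), ([-6], [], [-18, 8, 1])]),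
     (24, [([144, 136, 40, 4], [-3, -2, -3]), ([-48, -30, -3], [-3, -3, -2]), ([-54, -16, -2], [-6]),
        ([62, 70, 12], [-4, -3]), ([-28, -22, -4], [-1, -2, -3]), ([-6, -26, -4], [-1, -3, -2]),
        ([-46, -8], [-4, -1]), ([46, 8], [-1, -1, -2])],
      (0, 1), [([-4, -1], [], [-46, -8]), ([-6], [], [-54, -16, -2])]),
     (2, [([0, 14, -3, -9, -2], [-3, -3, -3, -2]), ([-24, 36, -6, -6], [-6, -3]),
        ([-18, -9, 21, 6], [-1, -3, -3, -2]), ([36, -30, -6], [-8]), ([-60, 6, 6], [-6, -1]),
        ([-48, 24, 12], [-4, -1, -3]), ([24, -36, -12], [-1, -1, -3, -2]),
        ([12, -6, -6], [-1, -3, -2, -3]), ([-42, -12], [-4, -1, -1]), ([42, 12], [-1, -1, -1, -2]),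
        ([12, 6], [-1, -1, -2, -3])],
      (-2, 2), [([-4, -1, -1], [], [-42, -12]), ([-8], [], [36, -30, -6])]),
     (12, [([840, 1038, 459, 87, 6], [-3, -3, -2, -2, -3]), ([240, 228, 66, 6], [-6, -2, -3]),
        ([-480, -456, -132, -12], [-6, -3, -2]), ([-280, -346, -153, -29, -2], [-2, -3, -3, -3, -2]),
        ([2520, 2094, 558, 48], [-4, -3, -2, -3]), ([-540, -363, -81, -6], [-4, -3, -3, -2]),
        ([-1260, -1047, -279, -24], [-1, -3, -2, -2, -3]), ([-600, -270, -30], [-9]),
        ([-600, -270, -30], [-8, -2]), ([1200, 540, 60], [-4, -4, -3]),
        ([-600, -270, -30], [-6, -4]), ([600, 270, 30], [-6, -1, -2]),
        ([-1200, -540, -60], [-4, -1, -2, -3]), ([540, 363, 81, 6], [-1, -2, -3, -3, -2]),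
        ([600, 270, 30], [-1, -1, -2, -2, -3])],
      (1, 0), [([-9], [], [-600, -270, -30])]),
     (48, [([0, -1008, -1548, -920, -265, -37, -2], [-3, -3, -3, -2, -2, -3]),
        ([1728, -288, -1764, -924, -180, -12], [-6, -3, -2, -3]),
        ([-432, 612, 1044, 480, 90, 6], [-6, -3, -3, -2]),
        ([0, -408, -574, -278, -56, -4], [-4, -3, -3, -3, -2]),
        ([432, 1584, 1461, 561, 96, 6], [-1, -3, -3, -2, -2, -3]),
        ([-864, -792, -384, -108, -12], [-9, -3]), ([-864, -1224, -636, -144, -12], [-8, -2, -3]),
        ([864, 1656, 888, 180, 12], [-8, -3, -2]), ([-432, 108, 246, 72, 6], [-6, -6]),
        ([1728, 432, -336, -132, -12], [-6, -4, -3]), ([-720, 300, 504, 144, 12], [-6, -1, -2, -3]),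
        ([-288, -1032, -672, -156, -12], [-6, -1, -3, -2]),
        ([-1152, -1752, -870, -174, -12], [-1, -1, -3, -2, -2, -3]),
        ([2304, 3504, 1740, 348, 24], [-4, -1, -3, -2, -3]),
        ([-144, -324, -200, -48, -4], [-1, -2, -3, -3, -3, -2]),
        ([-2448, -1716, -372, -24], [-8, -1, -2]), ([648, 522, 138, 12], [-1, -1, -2, -3, -3, -2]),
        ([864, 648, 156, 12], [-1, -1, -1, -2, -2, -3]), ([1728, 1296, 312, 24], [-8, -4]),
        ([-648, -522, -138, -12], [-4, -1, -3, -3, -2]), ([864, 648, 156, 12], [-6, -1, -1, -2]),
        ([1728, 1296, 312, 24], [-4, -4, -1, -3]), ([-1728, -1296, -312, -24], [-4, -1, -1, -2, -3]),
        ([-864, -648, -156, -12], [-6, -4, -1]), ([-720, -420, -60], [-9, -1])],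
      (-1, 1), [([-9, -1], [], [-720, -420, -60])])]"

definition singular_entries5 :: "singular_entry list" where
  "singular_entries5 =
    [(1, [([1], [])],
      (2, 0), [([], [], [1])]),
     (1, [([0, -1], [-3]), ([2], [-1])],
      (0, 1), [([-1], [], [2])]),
     (1, [([0, -2, 2], [-3, -3]), ([4, -4], [-1, -3]), ([4], [-1, -1])],
      (-2, 2), [([-1, -1], [], [4])]),
     (1, [([-8, -2], [-6]), ([8, 2], [-4, -3]), ([24, 14, 2], [-3, -2, -3]),
        ([-12, -7, -1], [-2, -3, -3]), ([-8, -2], [-1, -2, -3])],
      (1, 0), [([-6], [], [-8, -2])]),
     (2, [([-42, -20, -2], [-8]), ([-9, -15, -7, -1], [-6, -3]), ([24, 14, 2], [-6, -1]),
        ([-3, 20, 13, 2], [-4, -3, -3]), ([-24, -14, -2], [-4, -1, -3]),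
        ([0, 36, 33, 10, 1], [-3, -3, -2, -3]), ([-51, -56, -19, -2], [-1, -3, -2, -3]),
        ([27, 18, 3], [-1, -2, -3, -3]), ([24, 14, 2], [-1, -1, -2, -3])],
      (-1, 1), [([-6, -1], [], [24, 14, 2])]),
     (6, [([240, 236, 76, 8], [-9, -3]), ([-96, -56, -8], [-9, -1]), ([-96, -56, -8], [-8, -4]),
        ([240, 236, 76, 8], [-8, -2, -3]), ([336, 292, 84, 8], [-6, -4, -3]),
        ([960, 1184, 540, 108, 8], [-6, -3, -2, -3]),
        ([-480, -592, -270, -54, -4], [-6, -2, -3, -3]), ([-336, -292, -84, -8], [-6, -1, -2, -3]),
        ([-192, -160, -44, -4], [-6, -6]), ([-840, -1066, -502, -104, -8], [-4, -3, -3, -2, -3]),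
        ([336, 292, 84, 8], [-4, -1, -2, -3, -3]), ([-336, -292, -84, -8], [-4, -4, -3, -3]),
        ([-720, -1128, -701, -216, -33, -2], [-3, -3, -2, -2, -3, -3]),
        ([420, 533, 251, 52, 4], [-1, -3, -2, -2, -3, -3]),
        ([-168, -146, -42, -4], [-1, -1, -2, -2, -3, -3])],
      (0, 0), [([-8, -4], [], [-96, -56, -8])])]"

lemma levi_check1: "levi_check levi_data1" by code_simp
lemma levi_check2: "levi_check levi_data2" by code_simp
lemma levi_check3: "levi_check levi_data3" by code_simp
lemma levi_check4: "levi_check levi_data4" by code_simp
lemma levi_check5: "levi_check levi_data5" by code_simp

lemma entry_check1: "list_all (entry_check levi_data1) singular_entries1" by code_simp
lemma entry_check2: "list_all (entry_check levi_data2) singular_entries2" by code_simp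
lemma entry_check5: "list_all (entry_check levi_data5) singular_entries5" by code_simp
lemma entry_check3: "list_all (entry_check levi_data3) singular_entries3" by code_simp
lemma entry_check4: "list_all (entry_check levi_data4) singular_entries4" by code_simp

section \<open>Matching the integer combinations with the elements of U(so(7))\<close>

definition word_elem :: "int list \<Rightarrow> so7 uea" where
  "word_elem ws = foldr (\<lambda>r u. g r * u) ws 1"

definition entry_match :: "complex \<Rightarrow> so7 uea \<Rightarrow> singular_entry \<Rightarrow> bool" where
  "entry_match x u = (\<lambda>(N, e, _). of_int N *\<^sub>C u = lc_eval x word_elem e)"

lemma entry_matchI:
  "of_int N *\<^sub>C u = lc_eval x word_elem e \<Longrightarrow> entry_match x u (N, e, r)"
  by (simp add: entry_match_def)

lemma power4: "(a::'a::monoid_mult)^4 = a * (a * (a * a))"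
  by (simp add: numeral_eq_Suc mult.assoc)
lemma power5: "(a::'a::monoid_mult)^5 = a * (a * (a * (a * a)))"
  by (simp add: numeral_eq_Suc mult.assoc)
lemma power6: "(a::'a::monoid_mult)^6 = a * (a * (a * (a * (a * a))))"
  by (simp add: numeral_eq_Suc mult.assoc)

lemma scaleC_eqI: "c = d \<Longrightarrow> c *\<^sub>C u = d *\<^sub>C u" by simp

lemmas powers = power2_eq_square power3_eq_cube power4 power5 power6

lemmas entry_simps = lc_eval_simps word_elem_def foldr_Cons foldr_Nil comp_apply id_apply powers
  mult.assoc mult_1_right scaleC_add_right scaleC_scaleC add.assoc add_0_right

lemma entries1: "list_all2 (entry_match x) (singular_elements1 x) singular_entries1"
  unfolding singular_elements1_def singular_entries1_def list_all2_Cons list_all2_Nil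
  by (intro conjI entry_matchI refl)
    (simp_all only: entry_simps, (intro arg_cong2[where f = "(+)"] scaleC_eqI; simp add: algebra_simps powers)+)

lemma entries2: "list_all2 (entry_match x) (singular_elements2 x) singular_entries2"
  unfolding singular_elements2_def singular_entries2_def list_all2_Cons list_all2_Nil
  by (intro conjI entry_matchI refl)
    (simp_all only: entry_simps, (intro arg_cong2[where f = "(+)"] scaleC_eqI; simp add: algebra_simps powers)+)

lemma entries3: "list_all2 (entry_match x) (singular_elements3 x) singular_entries3"
  unfolding singular_elements3_def singular_entries3_def list_all2_Cons list_all2_Nil
  by (intro conjI entry_matchI refl)
    (simp_all only: entry_simps, (intro arg_cong2[where f = "(+)"] scaleC_eqI; simp add: algebra_simps powers)+)

lemma entries4: "list_all2 (entry_match x) (singular_elements4 x) singular_entries4"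
  unfolding singular_elements4_def singular_entries4_def list_all2_Cons list_all2_Nil
  by (intro conjI entry_matchI refl)
    (simp_all only: entry_simps, (intro arg_cong2[where f = "(+)"] scaleC_eqI; simp add: algebra_simps powers)+)

lemma entries5: "list_all2 (entry_match x) (singular_elements5 x) singular_entries5"
  unfolding singular_elements5_def singular_entries5_def list_all2_Cons list_all2_Nil
  by (intro conjI entry_matchI refl)
    (simp_all only: entry_simps, (intro arg_cong2[where f = "(+)"] scaleC_eqI; simp add: algebra_simps powers)+)

text \<open>A repetition in the list would give a vanishing combination with coefficients 1 and - 1
  at the two places, so the condition on coefficients yields distinctness as well.\<close>

lemma linearly_independentI:
  fixes vs :: "'m::complex_vector list"
  assumes "\<And>c i. (\<Sum>i<length vs. c i *\<^sub>C vs ! i) = 0 \<Longrightarrow> i < length vs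
      \<Longrightarrow> c i = 0"
  shows "linearly_independent vs"
proof -
  have inj: "inj_on (\<lambda>i. vs ! i) {..<length vs}"
  proof (rule inj_onI, rule ccontr)
    fix i j assume ij: "i \<in> {..<length vs}" "j \<in> {..<length vs}" "vs ! i = vs ! j" "i \<noteq> j"
    let ?c = "\<lambda>k. if k = i then 1 else if k = j then - 1 else (0 :: complex)"
    have "(\<Sum>k<length vs. ?c k *\<^sub>C vs ! k) = (\<Sum>k\<in>{i, j}. ?c k *\<^sub>C vs ! k)"
      using ij(1,2) by (intro sum.mono_neutral_right) auto
    also have "\<dots> = 0" using ij(3,4) by (simp add: scaleC_one cvec.scale_minus_left)
    finally have "?c i = 0" using assms[of ?c i] ij(1) by blast
    then show False by simp
  qed
  then have "distinct vs" by (auto simp: distinct_conv_nth inj_on_def)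
  moreover have "\<not> cvec.dependent (set vs)"
  proof
    assume "cvec.dependent (set vs)"
    then obtain u v where u: "v \<in> set vs" "u v \<noteq> 0" "(\<Sum>v\<in>set vs. u v *\<^sub>C v) = 0"
      by (auto simp: cvec.dependent_finite)
    have "set vs = (\<lambda>i. vs ! i) ` {..<length vs}" by (auto simp: set_conv_nth)
    then have "(\<Sum>i<length vs. u (vs ! i) *\<^sub>C vs ! i) = 0"
      using u(3) sum.reindex[OF inj, of "\<lambda>v. u v *\<^sub>C v"] by simp
    moreover obtain i where "i < length vs" "vs ! i = v" using u(1) by (auto simp: in_set_conv_nth)
    ultimately show False using assms[of "\<lambda>i. u (vs ! i)" i] u(2) by simp
  qed
  ultimately show ?thesis by (simp add: linearly_independent_def)
qed

text \<open>Applying H - \<mu> removes the summand for \<mu> and multiplies the others by nonzero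
  factors, which leaves fewer eigenvalues.\<close>

lemma eigenvectors_sum_zero:
  assumes H: "clinear H" and "finite S" and "\<And>\<mu>. \<mu> \<in> S \<Longrightarrow> H (f \<mu>) = \<mu>
      *\<^sub>C f \<mu>" and "(\<Sum>\<mu>\<in>S. f \<mu>) = 0"
    and "\<nu> \<in> S"
  shows "f \<nu> = 0"
  using assms(2-5)
proof (induction S arbitrary: f \<nu> rule: finite_induct)
  case (insert \<mu> S)
  let ?f = "\<lambda>\<nu>. (\<nu> - \<mu>) *\<^sub>C f \<nu>"
  have "(\<Sum>\<nu>\<in>insert \<mu> S. H (f \<nu>) - \<mu> *\<^sub>C f \<nu>) = 0"
    using insert.prems(2) by (simp only: sum_subtractf flip: clinearD(6)[OF H] cvec.scale_sum_right)
      (simp add: clinearD(3)[OF H])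
  moreover have "(\<Sum>\<nu>\<in>insert \<mu> S. H (f \<nu>) - \<mu> *\<^sub>C f \<nu>) =
      (\<Sum>\<nu>\<in>insert \<mu> S. ?f \<nu>)"
    by (rule sum.cong) (simp_all add: insert.prems(1) cvec.scale_left_diff_distrib)
  ultimately have "(\<Sum>\<nu>\<in>S. ?f \<nu>) = 0" using insert.hyps by simp
  moreover have "H (?f \<nu>) = \<nu> *\<^sub>C ?f \<nu>" if "\<nu> \<in> S" for \<nu>
    using insert.prems(1)[of \<nu>] that by (simp add: clinearD[OF H] scaleC_scaleC mult.commute)
  ultimately have "?f \<nu> = 0" if "\<nu> \<in> S" for \<nu> using insert.IH[of ?f \<nu>] that by blast
  then have z: "f \<nu> = 0" if "\<nu> \<in> S" for \<nu> using that insert.hyps(2) by auto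
  then have "f \<mu> = 0" using insert.prems(2) insert.hyps by simp
  then show ?case using z insert.prems(3) by blast
qed simp

lemma eigenvectors_separate:
  fixes v :: "nat \<Rightarrow> 'm::complex_vector"
  assumes H: "clinear H" and eig: "\<And>i. i < n \<Longrightarrow> H (v i) = \<mu> i *\<^sub>C v i"
    and sum: "(\<Sum>i<n. c i *\<^sub>C v i) = 0"
  shows "(\<Sum>i | i < n \<and> \<mu> i = \<nu>. c i *\<^sub>C v i) = 0"
proof (cases "\<nu> \<in> \<mu> ` {..<n}")
  case True
  let ?f = "\<lambda>\<nu>. \<Sum>i\<in>{i \<in> {..<n}. \<mu> i = \<nu>}. c i *\<^sub>C v i"
  have "?f \<nu> = 0"
  proof (rule eigenvectors_sum_zero[OF H _ _ _ True, of ?f])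
    show "H (?f \<nu>) = \<nu> *\<^sub>C ?f \<nu>" for \<nu>
      unfolding clinearD(6)[OF H] cvec.scale_sum_right
      by (rule sum.cong) (auto simp: clinearD[OF H] eig scaleC_scaleC mult.commute)
    show "(\<Sum>\<nu>\<in>\<mu> ` {..<n}. ?f \<nu>) = 0"
      using sum sum.group[of "{..<n}" "\<mu> ` {..<n}" \<mu> "\<lambda>i. c i *\<^sub>C v i"] by simp
  qed simp
  then show ?thesis by simp
next
  case False
  then have "{i. i < n \<and> \<mu> i = \<nu>} = {}" by auto
  then show ?thesis by (simp only: sum.empty)
qed

definition entry_weight :: "singular_entry \<Rightarrow> int \<times> int" where
  "entry_weight = (\<lambda>(N, e, wt, leads). wt)"

definition entry_leads :: "singular_entry \<Rightarrow> (int list \<times> int list \<times> int list) list" where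
  "entry_leads = (\<lambda>(N, e, wt, leads). leads)"

definition entry_scale :: "singular_entry \<Rightarrow> int" where
  "entry_scale = (\<lambda>(N, e, wt, leads). N)"

text \<open>The Casimir eigenvalues of two entries differ by \<open>B x1 + A\<close>; a pair \<open>(a,
    b)\<close> in \<open>exc\<close> stands for the
  excluded value \<open>- a / b\<close>.\<close>

definition casimir_root_check :: "(int \<times> int) list \<Rightarrow> (int \<times> int) \<Rightarrow> (int
    \<times> int) \<Rightarrow> bool" where
  "casimir_root_check exc = (\<lambda>(p, q) (p', q').
     let B = 4 * (p - p') + 6 * (q - q');
         A = (2 * p * p + 6 * p * q + 6 * q * q + 10 * p + 18 * q) - (2 * p' * p' + 6 * p' * q' + 6 * q' * q' +
             10 * p' + 18 * q')
     in if B = 0 then A \<noteq> 0 else list_ex (\<lambda>(a, b). b \<noteq> 0 \<and> A * b = a * B) exc)"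

definition casimir_separated :: "(int \<times> int) list \<Rightarrow> singular_entry list \<Rightarrow> bool" where
  "casimir_separated exc S \<longleftrightarrow> (let W = map entry_weight S in
     list_all (\<lambda>i. list_all (\<lambda>j. i = j \<or> casimir_root_check exc (W ! i) (W ! j))
         [0..<length W]) [0..<length W])"

text \<open>The action of three times the first simple coroot plus the second, up to \<open>3 * x1\<close>.\<close>

definition grade :: "singular_entry \<Rightarrow> int" where
  "grade s = 3 * fst (entry_weight s) + snd (entry_weight s)"

context g2_module
begin

lemma op_act_so7_act: "op_act r m = so7_act (op_vector r) m"
  by (simp add: op_act_def so7_act_def)

text \<open>The squares of \<open>x\<close> cancel, as both weights contain the same
  \<open>x\<close>. The check states that the remaining equation B x + A = 0 has no solution, or
  that its solution is a listed fraction, compared by cross-multiplication.\<close>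

lemma casimir_value_root:
  assumes "casimir_root_check exc (p, q) (p', q')"
    and "x \<notin> (\<lambda>(a, b). - of_int a / of_int b) ` set exc"
  shows "casimir_value (x + of_int p) (of_int q) \<noteq> casimir_value (x + of_int p') (of_int q')"
proof
  assume eq: "casimir_value (x + of_int p) (of_int q) = casimir_value (x + of_int p') (of_int q')"
  define B where "B = 4 * (p - p') + 6 * (q - q')"
  define A where "A = (2 * p * p + 6 * p * q + 6 * q * q + 10 * p + 18 * q) - (2 * p' * p' + 6 * p' * q' + 6 *
      q' * q' + 10 * p' + 18 * q')"
  have "casimir_value (x + of_int p) (of_int q) - casimir_value (x + of_int p') (of_int q') = of_int B * x + of_int A"
    by (simp add: casimir_value_def A_def B_def power2_eq_square algebra_simps)
  then have z: "of_int B * x + of_int A = 0" using eq by simp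
  show False
  proof (cases "B = 0")
    case True
    then have "A \<noteq> 0" using assms(1) by (simp add: casimir_root_check_def Let_def A_def B_def)
    then show False using z True by simp
  next
    case False
    then obtain a b where ab: "(a, b) \<in> set exc" "b \<noteq> 0" "A * b = a * B"
      using assms(1) by (auto simp: casimir_root_check_def Let_def A_def B_def list_ex_iff split: if_splits)
    have x: "x = - of_int A / of_int B" using z False by (simp add: field_simps eq_neg_iff_add_eq_0)
    have AB: "of_int A * of_int b = (of_int a * of_int B :: complex)" using ab(3) by (metis of_int_mult)
    have xB: "x * of_int B = - of_int A" using x False by simp
    have "of_int B * (x * of_int b + of_int a) = (x * of_int B) * of_int b + of_int a * of_int B"
      by (simp add: algebra_simps)
    also have "\<dots> = 0" by (simp add: xB flip: AB)
    finally have "of_int B * (x * of_int b + of_int a) = 0" .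
    then have "x * of_int b = - of_int a" using False by (simp add: eq_neg_iff_add_eq_0)
    then have "x = - of_int a / of_int b" using ab(2) by (metis nonzero_eq_divide_eq of_int_eq_0_iff)
    then show False using assms(2) ab(1) by force
  qed
qed

context
  fixes x :: complex and D :: levi_data and us :: "so7 uea list" and S :: "singular_entry list"
  assumes check: "levi_check D" and compat: "weight_compatible x D"
    and entries: "list_all (entry_check D) S" and matching: "list_all2 (entry_match x) us S"
begin

abbreviation "mvec i \<equiv> uact (us ! i) (tens 1 w)"

lemma length_eq: "length us = length S"
  using matching by (rule list_all2_lengthD)

lemma uact_word_elem:
  assumes "list_all (\<lambda>r. is_nil_op r \<or> r = - 2 \<or> r = - 3) ws"
  shows "uact (word_elem ws) (tens 1 w) = word_act ws"
  using assms
proof (induction ws)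
  case (Cons r ws)
  have "r \<le> 10" using Cons.prems by (auto simp: is_nil_op_def)
  then show ?case using Cons by (simp add: word_elem_def word_act_def[OF check compat] uact_mult op_act_def
      g_def op_vector_root)
qed (simp add: word_elem_def word_act_def[OF check compat] uact_one)

lemma entry_scaled:
  assumes "i < length S" "S ! i = (N, e, wt, leads)"
  shows "mvec i = (1 / of_int N) *\<^sub>C elem_act x e" "N \<noteq> 0" "elem_ok e"
proof -
  have c: "entry_check D (N, e, wt, leads)" using entries assms by (metis list_all_length)
  then show N: "N \<noteq> 0" by (auto simp: entry_check_def)
  have ok: "list_all (\<lambda>(p, ws). list_all (\<lambda>r. is_nil_op r \<or> r = - 2 \<or> r = - 3) ws) e"
    using c by (auto simp: entry_check_def)
  then show "elem_ok e"
    by (fastforce simp: elem_ok_def[OF check compat] list_all_iff op_indices_def is_nil_op_iff)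
  have "entry_match x (us ! i) (N, e, wt, leads)" using matching assms by (metis list_all2_nthD2)
  then have "of_int N *\<^sub>C us ! i = lc_eval x word_elem e" by (simp add: entry_match_def)
  then have "of_int N *\<^sub>C mvec i = uact (lc_eval x word_elem e) (tens 1 w)"
    by (metis clinearD(2)[OF clinear_uact_left])
  also have "\<dots> = lc_eval x (\<lambda>ws. uact (word_elem ws) (tens 1 w)) e"
    by (rule lc_eval_linear[OF clinear_uact_left])
  also have "\<dots> = elem_act x e"
    unfolding elem_act_def[OF check compat] using ok by (intro lc_eval_cong uact_word_elem) (auto simp: list_all_iff)
  finally have "(1 / of_int N) *\<^sub>C of_int N *\<^sub>C mvec i = (1 / of_int N) *\<^sub>C elem_act x e" by simp
  then show "mvec i = (1 / of_int N) *\<^sub>C elem_act x e" using N by (simp add: scaleC_scaleC scaleC_one)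
qed

lemma entry_highest_weight:
  assumes "i < length S" "entry_weight (S ! i) = (n1, n2)"
  shows "highest_weight_vector (x + of_int n1) (of_int n2) (mvec i)"
proof -
  obtain N e leads where s: "S ! i = (N, e, (n1, n2), leads)"
    using assms(2) by (cases "S ! i") (auto simp: entry_weight_def)
  have "entry_check D (N, e, (n1, n2), leads)" using entries assms(1) s by (metis list_all_length)
  then have "singular_check D (act_elem D e) n1 n2" by (auto simp: entry_check_def Let_def)
  note sing = singular_check_sound[OF check compat this entry_scaled(3)[OF assms(1) s]]
  have v: "g2_vector 1 = op_vector 1 + op_vector 3" "g2_vector 2 = op_vector 2"
    "g2_vector 11 = op_vector 11 + op_vector 13" "g2_vector 12 = op_vector 12" by (simp_all add: g2_vector_def)
  show ?thesis
    unfolding highest_weight_vector_def entry_scaled(1)[OF assms(1) s] v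
    using sing by (simp add: clinearD[OF clinear_so7_act_left] clinearD[OF clinear_so7_act] op_act_so7_act
        scaleC_scaleC mult.commute flip: scaleC_add_right)
qed

lemma entry_functional:
  assumes "set js \<subseteq> {2, 3}"
  obtains \<Phi> :: "'m \<Rightarrow> 'v" where "clinear \<Phi>"
    "\<And>i p. i < length S \<Longrightarrow> (m, js, p) \<in> set (entry_leads (S ! i)) \<Longrightarrow>
       \<Phi> (mvec i) = (poly_eval x p / of_int (entry_scale (S ! i))) *\<^sub>C w"
proof -
  obtain \<Phi> :: "'m \<Rightarrow> 'v" where \<Phi>: "clinear \<Phi>"
    "\<And>e p. elem_ok e \<Longrightarrow> leading_check D (act_elem D e) m js p \<Longrightarrow> \<Phi>
        (elem_act x e) = poly_eval x p *\<^sub>C w"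
    using leading_check_sound[OF check compat assms] by metis
  have "\<Phi> (mvec i) = (poly_eval x p / of_int (entry_scale (S ! i))) *\<^sub>C w"
    if i: "i < length S" and l: "(m, js, p) \<in> set (entry_leads (S ! i))" for i p
  proof -
    obtain N e wt leads where s: "S ! i = (N, e, wt, leads)" by (cases "S ! i") auto
    have "entry_check D (N, e, wt, leads)" using entries i s by (metis list_all_length)
    then have "leading_check D (act_elem D e) m js p"
      using l s by (auto simp: entry_check_def Let_def list_all_iff entry_leads_def)
    from \<Phi>(2)[OF entry_scaled(3)[OF i s] this] show ?thesis
      by (simp add: entry_scaled(1)[OF i s] clinearD[OF \<Phi>(1)] s entry_scale_def scaleC_scaleC)
  qed
  then show ?thesis using that \<Phi>(1) by blast
qed

lemma leads_raise: "i < length S \<Longrightarrow> (m, js, p) \<in> set (entry_leads (S ! i)) \<Longrightarrow>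
    set js \<subseteq> {2, 3}"
proof -
  assume i: "i < length S" and l: "(m, js, p) \<in> set (entry_leads (S ! i))"
  obtain N e wt leads where s: "S ! i = (N, e, wt, leads)" by (cases "S ! i") auto
  have "entry_check D (N, e, wt, leads)" using entries i s by (metis list_all_length)
  then show "set js \<subseteq> {2, 3}" using l s by (auto simp: entry_check_def Let_def list_all_iff entry_leads_def)
qed

lemma entry_scale_nonzero: "i < length S \<Longrightarrow> entry_scale (S ! i) \<noteq> 0"
  using entry_scaled(2)[of i] by (cases "S ! i") (auto simp: entry_scale_def)

lemma vec_nonzero:
  assumes "i < length S" "(m, js, p) \<in> set (entry_leads (S ! i))" "poly_eval x p \<noteq> 0"
  shows "mvec i \<noteq> 0"
proof
  assume z: "mvec i = 0"
  obtain \<Phi> :: "'m \<Rightarrow> 'v" where "clinear \<Phi>" "\<Phi> (mvec i) = (poly_eval x p / of_int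
      (entry_scale (S ! i))) *\<^sub>C w"
    using entry_functional[OF leads_raise[OF assms(1,2)], of m] assms(1,2) by metis
  then show False using z assms(3) w_nonzero entry_scale_nonzero[OF assms(1)] by (simp add: clinearD)
qed

lemma all_singular:
  "\<forall>v\<in>set (map (\<lambda>u. uact u (tens 1 w)) us). singular_vector (g2_borel gb \<iota>) (g2_act
      \<iota> uact) v"
proof
  fix v assume "v \<in> set (map (\<lambda>u. uact u (tens 1 w)) us)"
  then obtain i where i: "i < length S" "v = mvec i" using length_eq by (auto simp: in_set_conv_nth)
  obtain n1 n2 where "entry_weight (S ! i) = (n1, n2)" by force
  from highest_weight_singular[OF entry_highest_weight[OF i(1) this]] i(2)
  show "singular_vector (g2_borel gb \<iota>) (g2_act \<iota> uact) v" by simp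
qed

lemma zero_intersections:
  assumes "casimir_separated exc S" "x \<notin> (\<lambda>(a, b). - of_int a / of_int b) ` set exc"
  shows "pairwise_zero_intersections (g2_act \<iota> uact) (map (\<lambda>u. uact u (tens 1 w)) us)"
  unfolding pairwise_zero_intersections_def
proof (intro allI impI)
  fix i j assume ij: "i < length (map (\<lambda>u. uact u (tens 1 w)) us)" "j < length (map (\<lambda>u. uact u
      (tens 1 w)) us)" "i \<noteq> j"
  then have i: "i < length S" and j: "j < length S" using length_eq by simp_all
  obtain p q where pq: "entry_weight (S ! i) = (p, q)" by force
  obtain p' q' where pq': "entry_weight (S ! j) = (p', q')" by force
  have "\<forall>i<length S. \<forall>j<length S. i = j \<or> casimir_root_check exc (entry_weight (S ! i))
      (entry_weight (S ! j))"
    using assms(1) by (simp add: casimir_separated_def Let_def list_all_iff Ball_def)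
  then have "casimir_root_check exc (entry_weight (S ! i)) (entry_weight (S ! j))"
    using i j ij(3) by blast
  then have "casimir_root_check exc (p, q) (p', q')" unfolding pq pq' .
  from zero_intersection[OF entry_highest_weight[OF i pq] entry_highest_weight[OF j pq'] casimir_value_root[OF
      this assms(2)]]
  show "generated_submodule (g2_act \<iota> uact) (map (\<lambda>u. uact u (tens 1 w)) us ! i) \<inter>
      generated_submodule (g2_act \<iota> uact) (map (\<lambda>u. uact u (tens 1 w)) us ! j) = {0}"
    using ij by simp
qed

lemma independent_by_grade:
  assumes "\<And>\<nu> c i. (\<Sum>i | i < length S \<and> grade (S ! i) = \<nu>. c i *\<^sub>C mvec i) = 0
      \<Longrightarrow>
      i < length S \<Longrightarrow> grade (S ! i) = \<nu> \<Longrightarrow> c i = 0"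
  shows "linearly_independent (map (\<lambda>u. uact u (tens 1 w)) us)"
proof (rule linearly_independentI)
  fix c :: "nat \<Rightarrow> complex" and i
  assume "(\<Sum>i<length (map (\<lambda>u. uact u (tens 1 w)) us). c i *\<^sub>C map (\<lambda>u. uact u (tens
      1 w)) us ! i) = 0"
    and "i < length (map (\<lambda>u. uact u (tens 1 w)) us)"
  then have sum: "(\<Sum>i<length S. c i *\<^sub>C mvec i) = 0" and i: "i < length S" by (simp_all add: length_eq)
  \<comment> \<open>On the weights that occur, 3 n1 + n2 separates any two different pairs (n1, n2),
    so this one operator replaces the two coroots.\<close>
  define H where "H m = 3 *\<^sub>C so7_act (g2_vector 11) m + so7_act (g2_vector 12) m" for m
  have "clinear H" unfolding H_def[abs_def] by (intro clinear_intros clinear_so7_act)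
  moreover have "H (mvec i) = (3 * x + of_int (grade (S ! i))) *\<^sub>C mvec i" if "i < length S" for i
  proof -
    obtain n1 n2 where n: "entry_weight (S ! i) = (n1, n2)" by force
    show ?thesis using entry_highest_weight[OF that n]
      by (simp add: H_def highest_weight_vector_def grade_def n scaleC_scaleC scaleC_add_left algebra_simps)
  qed
  ultimately have "(\<Sum>j | j < length S \<and> 3 * x + of_int (grade (S ! j)) = 3 * x + of_int (grade (S !
      i)). c j *\<^sub>C mvec j) = 0"
    using sum by (rule eigenvectors_separate)
  then have "(\<Sum>j | j < length S \<and> grade (S ! j) = grade (S ! i). c j *\<^sub>C mvec j) = 0" by simp
  then show "c i = 0" using assms i by blast
qed

lemma independent_by_distinct_grade:
  assumes "distinct (map grade S)"
    and "\<And>i. i < length S \<Longrightarrow> \<exists>(m, js, p)\<in>set (entry_leads (S ! i)). poly_eval x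
        p \<noteq> 0"
  shows "linearly_independent (map (\<lambda>u. uact u (tens 1 w)) us)"
proof (rule independent_by_grade)
  fix \<nu> c i assume z: "(\<Sum>i | i < length S \<and> grade (S ! i) = \<nu>. c i *\<^sub>C mvec i) = 0" and
      i: "i < length S" "grade (S ! i) = \<nu>"
  have "{j. j < length S \<and> grade (S ! j) = \<nu>} = {i}"
    using i assms(1) by (auto simp: distinct_conv_nth)
  then have "c i *\<^sub>C mvec i = 0" using z by simp
  moreover have "mvec i \<noteq> 0" using assms(2)[OF i(1)] vec_nonzero[OF i(1)] by auto
  ultimately show "c i = 0" by simp
qed

text \<open>Two linear maps applied to a vanishing combination of the pair give two equations for
  its two coefficients, solved by Cramer's rule. Every other vector is alone in its grade and only
  has to be nonzero.\<close>

lemma independent_by_grade_pair: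
  assumes ab: "a < length S" "b < length S" "a \<noteq> b" "grade (S ! a) = grade (S ! b)"
    and distinct: "\<And>i j. i < length S \<Longrightarrow> j < length S \<Longrightarrow> grade (S ! i) =
        grade (S ! j) \<Longrightarrow> i = j \<or> i \<in> {a, b} \<and> j \<in> {a, b}"
    and nonzero: "\<And>i. i < length S \<Longrightarrow> i \<notin> {a, b} \<Longrightarrow> \<exists>(m, js,
        p)\<in>set (entry_leads (S ! i)). poly_eval x p \<noteq> 0"
    and leads: "(m, js, p) \<in> set (entry_leads (S ! a))" "(m, js, q) \<in> set (entry_leads (S ! b))"
      "(m', js', r) \<in> set (entry_leads (S ! a))" "(m', js', s) \<in> set (entry_leads (S ! b))"
    and det: "poly_eval x p * poly_eval x s - poly_eval x q * poly_eval x r \<noteq> 0"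
  shows "linearly_independent (map (\<lambda>u. uact u (tens 1 w)) us)"
proof (rule independent_by_grade)
  fix \<nu> and c :: "nat \<Rightarrow> complex" and i
  assume z: "(\<Sum>i | i < length S \<and> grade (S ! i) = \<nu>. c i *\<^sub>C mvec i) = 0" and i: "i <
      length S" "grade (S ! i) = \<nu>"
  show "c i = 0"
  proof (cases "i \<in> {a, b}")
    case False
    have "{j. j < length S \<and> grade (S ! j) = \<nu>} = {i}"
    proof (intro equalityI subsetI)
      fix j assume "j \<in> {j. j < length S \<and> grade (S ! j) = \<nu>}"
      then show "j \<in> {i}" using distinct[OF i(1), of j] i(2) False by simp
    qed (use i in simp)
    then have "c i *\<^sub>C mvec i = 0" using z by simp
    moreover have "mvec i \<noteq> 0" using nonzero[OF i(1) False] vec_nonzero[OF i(1)] by auto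
    ultimately show ?thesis by simp
  next
    case True
    \<comment> \<open>The factors \<open>N\<close> of the two entries are absorbed into the
      unknowns, so that the determinant is an integer polynomial in x1.\<close>
    define \<alpha> where "\<alpha> = c a / of_int (entry_scale (S ! a))"
    define \<beta> where "\<beta> = c b / of_int (entry_scale (S ! b))"
    have g: "grade (S ! a) = \<nu>" using i(2) True ab(4) by auto
    have "{j. j < length S \<and> grade (S ! j) = \<nu>} = {a, b}"
    proof (intro equalityI subsetI)
      fix j assume "j \<in> {j. j < length S \<and> grade (S ! j) = \<nu>}"
      then show "j \<in> {a, b}" using distinct[OF ab(1), of j] g by auto
    qed (use ab g in auto)
    then have z: "c a *\<^sub>C mvec a + c b *\<^sub>C mvec b = 0" using z ab(3) by simp
    have lead: "\<alpha> * poly_eval x p + \<beta> * poly_eval x q = 0"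
      if l: "(m, js, p) \<in> set (entry_leads (S ! a))" "(m, js, q) \<in> set (entry_leads (S ! b))" for m js p q
    proof -
      obtain \<Phi> :: "'m \<Rightarrow> 'v" where \<Phi>: "clinear \<Phi>"
        "\<Phi> (mvec a) = (poly_eval x p / of_int (entry_scale (S ! a))) *\<^sub>C w"
        "\<Phi> (mvec b) = (poly_eval x q / of_int (entry_scale (S ! b))) *\<^sub>C w"
        using entry_functional[OF leads_raise[OF ab(1) l(1)], of m] ab l by metis
      have "\<Phi> (c a *\<^sub>C mvec a + c b *\<^sub>C mvec b) = (\<alpha> * poly_eval x p + \<beta> *
          poly_eval x q) *\<^sub>C w"
        by (simp add: clinearD(1,2)[OF \<Phi>(1)] \<Phi>(2,3) \<alpha>_def \<beta>_def scaleC_scaleC scaleC_add_left)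
      then show ?thesis using z w_nonzero by (simp add: clinearD(3)[OF \<Phi>(1)])
    qed
    have e: "\<alpha> * poly_eval x p + \<beta> * poly_eval x q = 0" "\<alpha> * poly_eval x r + \<beta> *
        poly_eval x s = 0"
      using lead leads by blast+
    have "\<alpha> * (poly_eval x p * poly_eval x s - poly_eval x q * poly_eval x r)
        = (\<alpha> * poly_eval x p + \<beta> * poly_eval x q) * poly_eval x s - (\<alpha> * poly_eval x r +
            \<beta> * poly_eval x s) * poly_eval x q"
      by (simp add: algebra_simps)
    then have "\<alpha> = 0" using det by (simp add: e)
    moreover have "\<beta> * (poly_eval x p * poly_eval x s - poly_eval x q * poly_eval x r)
        = (\<alpha> * poly_eval x r + \<beta> * poly_eval x s) * poly_eval x p - (\<alpha> * poly_eval x p +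
            \<beta> * poly_eval x q) * poly_eval x r"
      by (simp add: algebra_simps)
    then have "\<beta> = 0" using det by (simp add: e)
    ultimately show ?thesis
      using True entry_scale_nonzero[OF ab(1)] entry_scale_nonzero[OF ab(2)] by (auto simp: \<alpha>_def \<beta>_def)
  qed
qed

end

end

lemma weights_on_coroots:
  "\<omega>1 (op_vector 11) = 1" "\<omega>1 (op_vector 12) = 0" "\<omega>1 (op_vector 13) = 0"
  "\<omega>2 (op_vector 11) = 0" "\<omega>2 (op_vector 12) = 1" "\<omega>2 (op_vector 13) = 0"
  "\<omega>3 (op_vector 11) = 0" "\<omega>3 (op_vector 12) = 0" "\<omega>3 (op_vector 13) = 1"
  by (simp_all add: \<omega>1_def \<omega>2_def \<omega>3_def coroot_simps \<epsilon>_linear, simp_all add: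
      \<epsilon>_def Rep_skew_unit)

text \<open>The pairs list the excluded values of x1 in the order of the theorem. The fourth family
  has no counterpart: entries 3 and 4 share a weight, and hence the Casimir eigenvalue.\<close>

lemma casimir_separated1: "casimir_separated [(1, 1), (7, 2), (6, 1)] singular_entries1" by code_simp
lemma casimir_separated2: "casimir_separated [(5, 1), (3, 1), (1, 1)] singular_entries2" by code_simp
lemma casimir_separated3:
  "casimir_separated [(0, 1), (1, 1), (4, 1), (3, 1), (9, 2), (2, 1), (8, 1), (6, 1), (7, 1), (5, 1), (9, 1)]
      singular_entries3"
  by code_simp
lemma casimir_separated5:
  "casimir_separated [(5, 1), (3, 1), (6, 1), (4, 1), (7, 2), (1, 1), (7, 1), (0, 1), (2, 1)] singular_entries5"
  by code_simp

lemma distinct_grades: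
  "distinct (map grade singular_entries1)" "distinct (map grade singular_entries2)"
  "distinct (map grade singular_entries3)" "distinct (map grade singular_entries5)"
  by code_simp+

lemma grades4: "map grade singular_entries4 = [4, - 1, 6, 1, 1, - 4, 3, - 2]"
  by code_simp

definition leads_nonzero :: "complex \<Rightarrow> singular_entry \<Rightarrow> bool" where
  "leads_nonzero x s \<longleftrightarrow> (\<exists>(m, js, p)\<in>set (entry_leads s). poly_eval x p \<noteq> 0)"

lemma leads_nonzero1: "list_all (leads_nonzero x) singular_entries1"
  by (simp add: singular_entries1_def leads_nonzero_def entry_leads_def)

lemma leads_nonzero2: "list_all (leads_nonzero x) singular_entries2"
  by (simp add: singular_entries2_def leads_nonzero_def entry_leads_def)

lemma linear_root: "b \<noteq> 0 \<Longrightarrow> a + x * b = 0 \<Longrightarrow> x = - a / b" for x :: complex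
  by (simp add: field_simps eq_neg_iff_add_eq_0)

text \<open>The two leads of an entry have no common zero: the second one is 600 at - 7 for entry 4
  and 180 at - 7/2 for entry 5.\<close>

lemma leads_nonzero3: "list_all (leads_nonzero x) singular_entries3"
proof -
  have "- 336 + x * - 48 \<noteq> 0 \<or> 96 + x * (96 + x * 24) \<noteq> 0"
  proof (cases "x = - 7")
    case False then show ?thesis using linear_root[of "- 48" "- 336" x] by auto
  qed simp
  moreover have "- 336 + x * - 96 \<noteq> 0 \<or> 96 + x * (144 + x * 48) \<noteq> 0"
  proof (cases "x = - 7 / 2")
    case False then show ?thesis using linear_root[of "- 96" "- 336" x] by auto
  qed simp
  ultimately show ?thesis
    by (simp add: singular_entries3_def leads_nonzero_def entry_leads_def)
qed

text \<open>The leads of the last three entries are constant multiples of x + 4 or of (x + 3) (x +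
  4). Both exceptions are genuine, as some of the vectors are zero there.\<close>

lemma leads_nonzero5:
  assumes "x \<noteq> - 4" "x \<noteq> - 3"
  shows "list_all (leads_nonzero x) singular_entries5"
proof -
  have nz: "x + 4 \<noteq> 0" "x + 3 \<noteq> 0" using assms by (simp_all add: add_eq_0_iff2)
  have "- 8 + x * - 2 = - 2 * (x + 4)" "24 + x * (14 + x * 2) = 2 * ((x + 3) * (x + 4))"
    "- 96 + x * (- 56 + x * - 8) = - 8 * ((x + 3) * (x + 4))" by (simp_all add: algebra_simps)
  then have "- 8 + x * - 2 \<noteq> 0" "24 + x * (14 + x * 2) \<noteq> 0" "- 96 + x * (- 56 + x * - 8) \<noteq> 0"
    using nz by (simp_all only: mult_eq_0_iff) simp_all
  then show ?thesis
    by (simp add: singular_entries5_def leads_nonzero_def entry_leads_def)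
qed

context g2_module
begin

lemma compatible:
  "lam = (\<lambda>h. x * \<omega>1 h + \<omega>2 h) \<Longrightarrow> weight_compatible x levi_data1"
  "lam = (\<lambda>h. x * \<omega>1 h + \<omega>3 h) \<Longrightarrow> weight_compatible x levi_data2"
  "lam = (\<lambda>h. x * \<omega>1 h + 2 * \<omega>2 h) \<Longrightarrow> weight_compatible x levi_data3"
  "lam = (\<lambda>h. x * \<omega>1 h + \<omega>2 h + \<omega>3 h) \<Longrightarrow> weight_compatible x levi_data4"
  "lam = (\<lambda>h. x * \<omega>1 h + 2 * \<omega>3 h) \<Longrightarrow> weight_compatible x levi_data5"
  unfolding weight_compatible_def
  by (simp_all add: weights_on_coroots levi_data1_def levi_data2_def levi_data3_def levi_data4_def levi_data5_def)

lemma entries_conclusion: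
  assumes "levi_check D" "weight_compatible x D" "list_all (entry_check D) S" "list_all2 (entry_match x) us S"
    and "distinct (map grade S)" "casimir_separated exc S"
  shows "(list_all (leads_nonzero x) S \<longrightarrow> linearly_independent (map (\<lambda>u. uact u (tens 1
      w)) us)) \<and>
    (\<forall>v\<in>set (map (\<lambda>u. uact u (tens 1 w)) us). singular_vector (g2_borel gb \<iota>) (g2_act
        \<iota> uact) v) \<and>
    (x \<notin> (\<lambda>(a, b). - of_int a / of_int b) ` set exc \<longrightarrow>
      pairwise_zero_intersections (g2_act \<iota> uact) (map (\<lambda>u. uact u (tens 1 w)) us))"
  using all_singular[OF assms(1-4)] zero_intersections[OF assms(1-4,6)]
    independent_by_distinct_grade[OF assms(1-5)]
  by (auto simp: list_all_length leads_nonzero_def)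

text \<open>The determinant for entries 3 and 4 is 10 (x + 8) (2 x + 9) (x + 2). The values - 5, - 4
  and - 3 are the zeros of the leads of entries 6 and 7, where these vectors vanish altogether. The
  two leads of entry 5 have no common zero.\<close>

lemma independent4:
  assumes "weight_compatible x levi_data4" "x \<notin> {- 8, - 5, - 9 / 2, - 4, - 3, - 2}"
  shows "linearly_independent (map (\<lambda>u. uact u (tens 1 w)) (singular_elements4 x))"
proof (rule independent_by_grade_pair[OF levi_check4 assms(1) entry_check4 entries4, where a = 3 and b = 4
      and m = "[- 4, - 1]" and js = "[]" and m' = "[- 6]" and js' = "[]"
      and p = "[- 42, - 6]" and q = "[- 46, - 8]" and r = "[- 18, 8, 1]" and s = "[- 54, - 16, - 2]"])
  have len: "length singular_entries4 = 8" by code_simp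
  have gr: "grade (singular_entries4 ! i) = [4, - 1, 6, 1, 1, - 4, 3, - 2] ! i" if "i < 8" for i
    using grades4 that len by (metis nth_map)
  show "3 < length singular_entries4" "4 < length singular_entries4" by (simp_all add: len)
  show "grade (singular_entries4 ! 3) = grade (singular_entries4 ! 4)" by (simp add: gr)
  have all8: "(\<forall>i<8. P i) \<longleftrightarrow> P 0 \<and> P 1 \<and> P 2 \<and> P 3 \<and> P 4 \<and>
      P 5 \<and> P 6 \<and> P 7" for P :: "nat \<Rightarrow> bool"
  proof -
    have "{..<8} = {0, 1, 2, 3, 4, 5, 6, 7 :: nat}" by auto
    moreover have "(\<forall>i<8. P i) \<longleftrightarrow> (\<forall>i\<in>{..<8}. P i)" by auto
    ultimately show ?thesis by simp
  qed
  have "\<forall>i<8. \<forall>j<8. [4, - 1, 6, 1, 1, - 4, 3, - 2 :: int] ! i = [4, - 1, 6, 1, 1, - 4, 3, - 2]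
      ! j \<longrightarrow>
     i = j \<or> i \<in> {3, 4} \<and> j \<in> {3, 4}"
    unfolding all8 by simp
  then show "i = j \<or> i \<in> {3, 4} \<and> j \<in> {3, 4}"
    if "i < length singular_entries4" "j < length singular_entries4" "grade (singular_entries4 ! i) = grade
        (singular_entries4 ! j)" for i j
    using that by (simp add: len gr)
  show "([- 4, - 1], [], [- 42, - 6]) \<in> set (entry_leads (singular_entries4 ! 3))"
    "([- 4, - 1], [], [- 46, - 8]) \<in> set (entry_leads (singular_entries4 ! 4))"
    "([- 6], [], [- 18, 8, 1]) \<in> set (entry_leads (singular_entries4 ! 3))"
    "([- 6], [], [- 54, - 16, - 2]) \<in> set (entry_leads (singular_entries4 ! 4))"
    by (simp_all add: singular_entries4_def entry_leads_def)
  have "(x + 8) * (2 * x + 9) * (x + 2) \<noteq> 0"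
    using assms(2) linear_root[of 2 9 x] by (auto simp: add_eq_0_iff2 mult.commute add.commute)
  moreover have "poly_eval x [- 42, - 6] * poly_eval x [- 54, - 16, - 2] - poly_eval x [- 46, - 8] * poly_eval
      x [- 18, 8, 1]
      = 10 * ((x + 8) * (2 * x + 9) * (x + 2))"
    by (simp add: algebra_simps)
  ultimately show "poly_eval x [- 42, - 6] * poly_eval x [- 54, - 16, - 2] - poly_eval x [- 46, - 8] *
      poly_eval x [- 18, 8, 1] \<noteq> 0"
    by (simp only: mult_eq_0_iff) simp
  have 5: "- 42 + x * - 12 \<noteq> 0 \<or> 36 + x * (- 30 + x * - 6) \<noteq> 0"
  proof (cases "x = - 7 / 2")
    case False then show ?thesis using linear_root[of "- 12" "- 42" x] by auto
  qed simp
  have nz: "x + 4 \<noteq> 0" "x + 5 \<noteq> 0" "x + 3 \<noteq> 0" using assms(2) by (simp_all add: add_eq_0_iff2)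
  have "- 600 + x * (- 270 + x * - 30) = - 30 * ((x + 4) * (x + 5))"
    "- 720 + x * (- 420 + x * - 60) = - 60 * ((x + 3) * (x + 4))" by (simp_all add: algebra_simps)
  then have 67: "- 600 + x * (- 270 + x * - 30) \<noteq> 0" "- 720 + x * (- 420 + x * - 60) \<noteq> 0"
    using nz by (simp_all only: mult_eq_0_iff) simp_all
  have "\<forall>i<8. i \<notin> {3, 4} \<longrightarrow> leads_nonzero x (singular_entries4 ! i)"
    unfolding all8 using 5 67 by (simp add: singular_entries4_def leads_nonzero_def entry_leads_def)
  then show "\<exists>(m, js, p)\<in>set (entry_leads (singular_entries4 ! i)). poly_eval x p \<noteq> 0"
    if "i < length singular_entries4" "i \<notin> {3, 4}" for i
    using that by (auto simp: len leads_nonzero_def)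
qed simp

end

text \<open>In the fourth and fifth case independence holds off a finite set of x1 only: at the
  excluded values a vector of the list is zero, or two of them are proportional. Singularity holds
  for every x1, the zero vector being singular by definition.\<close>

theorem theorem5p5:
  fixes x1 :: complex
    and lam :: "so7 \<Rightarrow> complex"
    and act :: "so7 \<Rightarrow> 'v::complex_vector \<Rightarrow> 'v" and w :: 'v
    and tens :: "so7 uea \<Rightarrow> 'v \<Rightarrow> 'm::complex_vector" and uact :: "so7 uea \<Rightarrow>
        'm \<Rightarrow> 'm"
    and gb :: "int \<Rightarrow> 'g::complex_lie_algebra" and \<iota> :: "'g \<Rightarrow> so7"
  assumes "is_G2_chevalley gb" and "is_G2_embedding gb \<iota>"
    and "is_levi_module lam act w"
    and "is_induced_module parabolic act tens uact"
  shows "let v0 = tens 1 w;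
             \<rho> = g2_act \<iota> uact;
             vecs = map (\<lambda>u. uact u v0);
             singular = singular_vector (g2_borel gb \<iota>) \<rho>
         in
     (lam = (\<lambda>h. x1 * \<omega>1 h + \<omega>2 h) \<longrightarrow>
        (let vs = vecs (singular_elements1 x1) in
          linearly_independent vs \<and> (\<forall>v\<in>set vs. singular v) \<and>
          (x1 \<notin> {- 1, - 7 / 2, - 6} \<longrightarrow> pairwise_zero_intersections \<rho> vs))) \<and>
     (lam = (\<lambda>h. x1 * \<omega>1 h + \<omega>3 h) \<longrightarrow>
        (let vs = vecs (singular_elements2 x1) in
          linearly_independent vs \<and> (\<forall>v\<in>set vs. singular v) \<and>
          (x1 \<notin> {- 5, - 3, - 1} \<longrightarrow> pairwise_zero_intersections \<rho> vs))) \<and>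
     (lam = (\<lambda>h. x1 * \<omega>1 h + 2 * \<omega>2 h) \<longrightarrow>
        (let vs = vecs (singular_elements3 x1) in
          linearly_independent vs \<and> (\<forall>v\<in>set vs. singular v) \<and>
          (x1 \<notin> {0, - 1, - 4, - 3, - 9 / 2, - 2, - 8, - 6, - 7, - 5, - 9} \<longrightarrow>
             pairwise_zero_intersections \<rho> vs))) \<and>
     (lam = (\<lambda>h. x1 * \<omega>1 h + \<omega>2 h + \<omega>3 h) \<longrightarrow>
        (let vs = vecs (singular_elements4 x1) in
          (x1 \<notin> {- 8, - 5, - 9 / 2, - 4, - 3, - 2} \<longrightarrow> linearly_independent vs) \<and>
          (\<forall>v\<in>set vs. singular v))) \<and>
     (lam = (\<lambda>h. x1 * \<omega>1 h + 2 * \<omega>3 h) \<longrightarrow>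
        (let vs = vecs (singular_elements5 x1) in
          (x1 \<notin> {- 4, - 3} \<longrightarrow> linearly_independent vs) \<and> (\<forall>v\<in>set vs.
              singular v) \<and>
          (x1 \<notin> {- 5, - 3, - 6, - 4, - 7 / 2, - 1, - 7, 0, - 2} \<longrightarrow>
             pairwise_zero_intersections \<rho> vs)))"
proof -
  interpret g2_module gb \<iota> lam act w tens uact
    by unfold_locales (fact assms)+
  show ?thesis
    unfolding Let_def
    apply (intro conjI)
    subgoal
      using entries_conclusion[OF levi_check1 compatible(1) entry_check1 entries1 distinct_grades(1) casimir_separated1]
        leads_nonzero1 by simp
    subgoal
      using entries_conclusion[OF levi_check2 compatible(2) entry_check2 entries2 distinct_grades(2) casimir_separated2]
        leads_nonzero2 by simp
    subgoal
      using entries_conclusion[OF levi_check3 compatible(3) entry_check3 entries3 distinct_grades(3) casimir_separated3]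
        leads_nonzero3 by simp
    subgoal
      using independent4[OF compatible(4)] all_singular[OF levi_check4 compatible(4) entry_check4 entries4] by blast
    subgoal
      using entries_conclusion[OF levi_check5 compatible(5) entry_check5 entries5 distinct_grades(4) casimir_separated5]
        leads_nonzero5 by simp
    done
qed

end
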